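(* Let $k$ be a positive integer. For all $c>0$ there exist a positive integer $s$ and an $\alpha<1$ such that for all $\vec{x},\vec{y}\in D$, $$\rho(\Psi_c^s(\vec{x}),\Psi_c^s(\vec{y}))\le \alpha\,\rho(\vec{x},\vec{y}),$$ where $\rho$ is the Euclidean metric on $D\subset\mathbb{R}^m$ and $\Psi_c^s$ is the $s$-fold iterate of $\Psi_c:D\to D$.
   Context: The first order language of rooted trees has a constant symbol $R$ (the root), equality, and the parent relation $\pi[v]=w$ ("$w$ is the parent of $v$"); sentences are finite, with Boolean connectives and quantification over vertices, and the quantifier depth of a sentence is the depth of nesting of its quantifiers. Fix a positive integer $k$. For rooted trees (finite or infinite), $T\equiv_k T'$ means that $T,T'$ have the same truth value for all first order sentences of quantifier depth at most $k$ (equivalently, Duplicator wins the $k$-move Ehrenfeucht game on $T,T'$). The set $\Sigma=\Sigma_k$ of equivalence classes is finite; write $\Sigma=\{1,\ldots,m\}$. $EV[T]\in\Sigma$ denotes the class of $T$. $D=\{(x_1,\ldots,x_m)\in\mathbb{R}^m:\sum_j x_j=1,\ x_j\ge 0\}$ is the set of probability distributions on $\Sigma$. Let $C=\{0,1,\ldots,k-1,\omega\}$, where a count of $\omega$ means "at least $k$" and a count $n\ne\omega$ means exactly $n$. $T(v)$ denotes the rooted tree consisting of $v$ and all its descendants, with root $v$. A rootchild is a child of the root. The recursion function $\Gamma:C^m\to\Sigma$ is given by: $\Gamma(n_1,\ldots,n_m)$ is the class $EV[T]$ of any rooted tree $T$ which for each $j$ has $n_j$ rootchildren $v$ with $EV[T(v)]=j$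 (this class depends only on $(n_1,\ldots,n_m)$). For $c>0$, $\Psi_c:D\to D$ is defined as follows: give a root a Poisson($c$) number of children, assign each child independently a label in $\Sigma$ with distribution $\vec{x}$, and let $n_j\in C$ be the number of children with label $j$ (with $\omega$ recorded when there are at least $k$); $\Psi_c(\vec{x})$ is the distribution of $\Gamma(n_1,\ldots,n_m)$. Equivalently, the $j$-th coordinate of $\Psi_c(\vec{x})$ is $\sum_{\vec{a}\in C^m:\Gamma(\vec{a})=j}\prod_{i=1}^m p_i(a_i)$, where $p_i(u)=e^{-cx_i}(cx_i)^u/u!$ for $u\in\{0,\ldots,k-1\}$ and $p_i(\omega)=1-\sum_{u=0}^{k-1}p_i(u)$. *)

theory Defs
  imports "HOL-Analysis.L2_Norm" "HOL-Library.Infinite_Typeclass" "HOL-Library.FuncSet"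
begin

section \<open>Rooted trees\<close>

text \<open>A pair \<open>(v, w)\<close> in \<open>parent T\<close> means that \<open>w\<close> is the parent of \<open>v\<close>. Trees may be finite or
  infinite, and a vertex may have infinitely many children.\<close>

record 'v rtree =
  verts :: "'v set"
  root :: 'v
  parent :: "('v \<times> 'v) set"

definition rooted_tree :: "'v rtree \<Rightarrow> bool" where
  "rooted_tree T \<longleftrightarrow>
     root T \<in> verts T \<and>
     parent T \<subseteq> verts T \<times> verts T \<and>
     (\<forall>w. (root T, w) \<notin> parent T) \<and>
     (\<forall>v\<in>verts T - {root T}. \<exists>!w. (v, w) \<in> parent T) \<and>
     (\<forall>v\<in>verts T. (v, root T) \<in> (parent T)\<^sup>*)"

definition rootchildren :: "'v rtree \<Rightarrow> 'v set" where
  "rootchildren T = {v. (v, root T) \<in> parent T}"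

definition descendants :: "'v rtree \<Rightarrow> 'v \<Rightarrow> 'v set" where
  "descendants T v = {u. (u, v) \<in> (parent T)\<^sup>*}"

definition subtree :: "'v rtree \<Rightarrow> 'v \<Rightarrow> 'v rtree" where
  "subtree T v = \<lparr>verts = descendants T v, root = v,
     parent = parent T \<inter> (descendants T v \<times> descendants T v)\<rparr>"

lemma rooted_tree_subtree:
  assumes T: "rooted_tree T" and v: "v \<in> verts T"
  shows "rooted_tree (subtree T v)"
proof -
  have uniq: "w = w'" if "(u, w) \<in> parent T" "(u, w') \<in> parent T" for u w w'
    using T that unfolding rooted_tree_def by blast
  have no_loop: "(v, v) \<notin> (parent T)\<^sup>+"
  proof
    assume loop: "(v, v) \<in> (parent T)\<^sup>+"
    have "(u, v) \<in> (parent T)\<^sup>+" if "(v, u) \<in> (parent T)\<^sup>*" for u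
      using that
    proof (induction rule: rtrancl_induct)
      case base
      show ?case by (rule loop)
    next
      case (step y z)
      from \<open>(y, v) \<in> (parent T)\<^sup>+\<close> obtain y' where "(y, y') \<in> parent T" "(y', v) \<in> (parent T)\<^sup>*"
        by (meson tranclD)
      with step.hyps(2) uniq have "(z, v) \<in> (parent T)\<^sup>*" by metis
      then show ?case using loop by (rule rtrancl_trancl_trancl)
    qed
    then have "(root T, v) \<in> (parent T)\<^sup>+"
      using T v unfolding rooted_tree_def by blast
    then show False
      using T unfolding rooted_tree_def by (meson tranclD)
  qed
  have reach: "(u, v) \<in> (parent T \<inter> (descendants T v \<times> descendants T v))\<^sup>*"
    if "(u, v) \<in> (parent T)\<^sup>*" for u
    using that
  proof (induction rule: converse_rtrancl_induct)
    case base
    show ?case by simp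
  next
    case (step y z)
    have "(y, z) \<in> parent T \<inter> (descendants T v \<times> descendants T v)"
      using step.hyps by (auto simp: descendants_def intro: converse_rtrancl_into_rtrancl)
    then show ?case using step.IH by (rule converse_rtrancl_into_rtrancl)
  qed
  have "(v, w) \<notin> parent T \<inter> (descendants T v \<times> descendants T v)" for w
    using no_loop by (auto simp: descendants_def dest: rtrancl_into_trancl2)
  moreover have "\<exists>!w. (u, w) \<in> parent T \<inter> (descendants T v \<times> descendants T v)"
    if "u \<in> descendants T v" "u \<noteq> v" for u
  proof -
    have "(u, v) \<in> (parent T \<inter> (descendants T v \<times> descendants T v))\<^sup>*"
      using reach that(1) by (simp add: descendants_def)
    with that(2) obtain w where "(u, w) \<in> parent T \<inter> (descendants T v \<times> descendants T v)"
      by (meson converse_rtranclE)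
    then show ?thesis using uniq by blast
  qed
  ultimately show ?thesis
    using reach by (auto simp: rooted_tree_def subtree_def descendants_def)
qed

section \<open>First order sentences and the Ehrenfeucht classes\<close>

text \<open>Negation, conjunction and existential quantification are primitive; the other connectives and
  the universal quantifier are definable from them without increasing the quantifier depth.\<close>

datatype trm = Root | Var nat

datatype form =
    Eq trm trm
  | Parent trm trm
  | Neg form
  | Conj form form
  | Exists nat form

fun trm_vars :: "trm \<Rightarrow> nat set" where
  "trm_vars Root = {}"
| "trm_vars (Var x) = {x}"

fun free_vars :: "form \<Rightarrow> nat set" where
  "free_vars (Eq s t) = trm_vars s \<union> trm_vars t"
| "free_vars (Parent s t) = trm_vars s \<union> trm_vars t"
| "free_vars (Neg \<phi>) = free_vars \<phi>"
| "free_vars (Conj \<phi> \<psi>) = free_vars \<phi> \<union> free_vars \<psi>"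
| "free_vars (Exists x \<phi>) = free_vars \<phi> - {x}"

fun qdepth :: "form \<Rightarrow> nat" where
  "qdepth (Eq s t) = 0"
| "qdepth (Parent s t) = 0"
| "qdepth (Neg \<phi>) = qdepth \<phi>"
| "qdepth (Conj \<phi> \<psi>) = max (qdepth \<phi>) (qdepth \<psi>)"
| "qdepth (Exists x \<phi>) = Suc (qdepth \<phi>)"

fun trm_val :: "'v rtree \<Rightarrow> (nat \<Rightarrow> 'v) \<Rightarrow> trm \<Rightarrow> 'v" where
  "trm_val T e Root = root T"
| "trm_val T e (Var x) = e x"

fun sat :: "'v rtree \<Rightarrow> (nat \<Rightarrow> 'v) \<Rightarrow> form \<Rightarrow> bool" where
  "sat T e (Eq s t) \<longleftrightarrow> trm_val T e s = trm_val T e t"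
| "sat T e (Parent s t) \<longleftrightarrow> (trm_val T e s, trm_val T e t) \<in> parent T"
| "sat T e (Neg \<phi>) \<longleftrightarrow> \<not> sat T e \<phi>"
| "sat T e (Conj \<phi> \<psi>) \<longleftrightarrow> sat T e \<phi> \<and> sat T e \<psi>"
| "sat T e (Exists x \<phi>) \<longleftrightarrow> (\<exists>v\<in>verts T. sat T (e(x := v)) \<phi>)"

text \<open>The truth value of a sentence does not depend on the assignment, so an arbitrary one is used.\<close>

definition holds :: "'v rtree \<Rightarrow> form \<Rightarrow> bool" where
  "holds T \<phi> \<longleftrightarrow> sat T (\<lambda>_. root T) \<phi>"

definition tree_equiv :: "nat \<Rightarrow> ('v rtree \<times> 'v rtree) set" where
  "tree_equiv k = {(T, T'). rooted_tree T \<and> rooted_tree T' \<and>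
     (\<forall>\<phi>. free_vars \<phi> = {} \<and> qdepth \<phi> \<le> k \<longrightarrow> (holds T \<phi> \<longleftrightarrow> holds T' \<phi>))}"

lemma equiv_tree_equiv: "equiv {T. rooted_tree T} (tree_equiv k)"
  by (rule equivI) (auto simp: tree_equiv_def refl_on_def sym_def trans_def)

text \<open>\<open>ehr_classes k\<close> is the set \<open>\<Sigma>\<close>; it indexes coordinates directly, without an enumeration by
  \<open>1, \<dots>, m\<close>. The type of vertices is an arbitrary infinite type. By the downward
  Loewenheim-Skolem theorem every tree is equivalent to a countable one, so the classes do not
  depend on the choice of this type, up to the canonical identification.\<close>

definition ehr_classes :: "nat \<Rightarrow> ('v::infinite) rtree set set" where
  "ehr_classes k = {T. rooted_tree T} // tree_equiv k"

definition EV :: "nat \<Rightarrow> ('v::infinite) rtree \<Rightarrow> 'v rtree set" where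
  "EV k T = tree_equiv k `` {T}"

section \<open>The recursion function\<close>

datatype count = Exactly nat | Omega

definition counts :: "nat \<Rightarrow> count set" where
  "counts k = Exactly ` {..<k} \<union> {Omega}"

text \<open>Infinite sets have \<open>card\<close> zero and need separate treatment.\<close>

definition trunc_card :: "nat \<Rightarrow> 'b set \<Rightarrow> count" where
  "trunc_card k A = (if finite A \<and> card A < k then Exactly (card A) else Omega)"

definition Gam :: "nat \<Rightarrow> ('v rtree set \<Rightarrow> count) \<Rightarrow> ('v::infinite) rtree set" where
  "Gam k n = (THE \<sigma>. \<exists>T. rooted_tree T \<and> EV k T = \<sigma> \<and>
     (\<forall>j\<in>ehr_classes k. trunc_card k {v \<in> rootchildren T. EV k (subtree T v) = j} = n j))"

section \<open>The distributions and the map\<close>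

text \<open>A vector in \<open>\<real>\<^sup>m\<close> is a function on the classes that vanishes outside \<open>ehr_classes k\<close>.\<close>

definition distrs :: "nat \<Rightarrow> (('v::infinite) rtree set \<Rightarrow> real) set" where
  "distrs k = {x. (\<forall>j\<in>ehr_classes k. 0 \<le> x j) \<and> (\<forall>j. j \<notin> ehr_classes k \<longrightarrow> x j = 0) \<and>
     (\<Sum>j\<in>ehr_classes k. x j) = 1}"

definition poisson_weight :: "real \<Rightarrow> nat \<Rightarrow> real" where
  "poisson_weight r u = exp (- r) * r ^ u / fact u"

fun count_prob :: "nat \<Rightarrow> real \<Rightarrow> count \<Rightarrow> real" where
  "count_prob k r (Exactly u) = poisson_weight r u"
| "count_prob k r Omega = 1 - (\<Sum>u<k. poisson_weight r u)"

text \<open>By Poisson thinning, the numbers of children with label \<open>i\<close> are independent Poisson variables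
  of mean \<open>c * x i\<close>.\<close>

definition Psi ::
  "nat \<Rightarrow> real \<Rightarrow> (('v::infinite) rtree set \<Rightarrow> real) \<Rightarrow> 'v rtree set \<Rightarrow> real" where
  "Psi k c x j =
     (\<Sum>a\<in>{a \<in> ehr_classes k \<rightarrow>\<^sub>E counts k. Gam k a = j}.
        \<Prod>i\<in>ehr_classes k. count_prob k (c * x i) (a i))"

definition rho ::
  "nat \<Rightarrow> (('v::infinite) rtree set \<Rightarrow> real) \<Rightarrow> ('v rtree set \<Rightarrow> real) \<Rightarrow> real" where
  "rho k x y = L2_set (\<lambda>j. x j - y j) (ehr_classes k)"

end

theory Submission
  imports Defs "HOL-Library.Nat_Bijection"
begin

text \<open>
  The derivative of \<open>\<Psi>\<^sup>s\<close> along a segment of distributions is \<open>c\<^sup>s\<close> times the action of a random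
  composition of the maps \<open>\<sigma> \<mapsto> \<Gamma>(n + e\<^sub>\<sigma>)\<close> on a vector of sum zero, where \<open>n\<close> is the random vector of
  child counts at the successive vertices of a spine. Such a vector is annihilated as soon as the
  composition is constant.

  Call a tree rich if it realises every type of a local neighbourhood infinitely often, far from the
  root and far apart. Two rich trees which look alike near the root are equivalent (a Hanf-style
  argument), so a composition of length at least \<open>2\<^sup>k\<close> is constant as soon as the last count vector
  contains a child whose class is that of a rich tree. Hence each step of the spine beyond the first
  \<open>2\<^sup>k\<close> contributes a factor \<open>c exp(c (u - 1))\<close>, where \<open>u\<close> is the probability that a tree is not of
  such a class. Since there are rich trees of bounded depth, and these occur with probability bounded
  below, the limit of the bounds for \<open>u\<close> satisfies \<open>u < exp(c (u - 1))\<close>; by convexity of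
  \<open>u \<mapsto> exp(c (u - 1))\<close>, which fixes \<open>1\<close>, its derivative \<open>c exp(c (u - 1))\<close> is then less than \<open>1\<close>.
  This covers the subcritical, critical and supercritical cases at once.
\<close>

section \<open>Back-and-forth characterisation of the classes\<close>

text \<open>A single application of \<Psi> need not contract. The derivative of a Poisson
  expectation in its mean is the expected effect of one further child, so each iteration multiplies
  a tangent vector by \<open>c\<close> and pushes it forward along a random map on classes.
  Push-forward does not increase the l1 norm. Hence lengths are measured in l1, with a factor of at
  most \<open>c\<close> per step until compositions of length \<open>2 ^ k\<close> are available;
  this fixed cost, and that of passing to the Euclidean norm, is beaten by many later steps at a
  rate below 1. Rich trees have infinitely many vertices within bounded depth, so some vertex has
  infinitely many children, which a Poisson number never is. The counts are truncated at
  \<open>k\<close>, however: \<open>Omega\<close> covers an infinite number of children and has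
  positive probability. The class of a rich tree of bounded depth is therefore reached after a
  bounded number of iterations, with a probability bounded below uniformly in the starting point. A
  rich subtree at a rootchild makes the whole tree rich, so a class outside the rich ones requires
  that no child has a rich class; this has probability \<open>exp (c * (u - 1))\<close>.\<close>

definition partial_iso :: "'a rtree \<Rightarrow> 'b rtree \<Rightarrow> ('a \<times> 'b) set \<Rightarrow> bool" where
  "partial_iso T T' R \<longleftrightarrow> (\<forall>a b a' b'. (a, b) \<in> R \<longrightarrow> (a', b') \<in> R \<longrightarrow>
     (a = a' \<longleftrightarrow> b = b') \<and> ((a, a') \<in> parent T \<longleftrightarrow> (b, b') \<in> parent T'))"

primrec ef :: "nat \<Rightarrow> 'a rtree \<Rightarrow> 'b rtree \<Rightarrow> ('a \<times> 'b) set \<Rightarrow> bool" where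
  "ef 0 T T' R \<longleftrightarrow> partial_iso T T' R"
| "ef (Suc j) T T' R \<longleftrightarrow>
     (\<forall>v\<in>verts T. \<exists>v'\<in>verts T'. ef j T T' (insert (v, v') R)) \<and>
     (\<forall>v'\<in>verts T'. \<exists>v\<in>verts T. ef j T T' (insert (v, v') R))"

lemma partial_isoD:
  assumes "partial_iso T T' R" "(a, b) \<in> R" "(a', b') \<in> R"
  shows "a = a' \<longleftrightarrow> b = b'" "(a, a') \<in> parent T \<longleftrightarrow> (b, b') \<in> parent T'"
  using assms unfolding partial_iso_def by simp_all

lemma partial_iso_subset: "partial_iso T T' R \<Longrightarrow> R' \<subseteq> R \<Longrightarrow> partial_iso T T' R'"
  unfolding partial_iso_def[of T T' R']
  by (intro allI impI conjI partial_isoD[of T T' R]) auto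

lemma partial_iso_converse: "partial_iso T T' R \<Longrightarrow> partial_iso T' T (R\<inverse>)"
  unfolding partial_iso_def by simp

lemma ef_subset: "ef j T T' R \<Longrightarrow> R' \<subseteq> R \<Longrightarrow> ef j T T' R'"
proof (induction j arbitrary: R R')
  case 0
  then show ?case by (auto intro: partial_iso_subset)
next
  case (Suc j)
  have "insert p R' \<subseteq> insert p R" for p using Suc.prems by blast
  with Suc show ?case by (simp, meson)
qed

lemma ef_converse: "ef j T T' R \<Longrightarrow> ef j T' T (R\<inverse>)"
proof (induction j arbitrary: R)
  case 0
  then show ?case by (auto intro: partial_iso_converse)
next
  case (Suc j)
  have "insert (b, a) (R\<inverse>) = (insert (a, b) R)\<inverse>" for a b by blast
  with Suc show ?case by (simp, metis)
qed

lemma ef_Suc_imp: "verts T \<noteq> {} \<Longrightarrow> ef (Suc j) T T' R \<Longrightarrow> ef j T T' R"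
  by (auto intro: ef_subset)

lemma ef_mono:
  assumes "verts T \<noteq> {}" "i \<le> j" "ef j T T' R"
  shows "ef i T T' R"
  using assms(2,3) by (induction j rule: dec_induct) (auto intro: ef_Suc_imp[OF assms(1)] simp del: ef.simps)

lemma ef_sat:
  assumes "ef j T T' R" "(root T, root T') \<in> R" "\<forall>x\<in>free_vars \<phi>. (e x, e' x) \<in> R"
    "qdepth \<phi> \<le> j" "verts T \<noteq> {}"
  shows "sat T e \<phi> \<longleftrightarrow> sat T' e' \<phi>"
  using assms
proof (induction \<phi> arbitrary: j R e e')
  case (Eq s t)
  have "(trm_val T e s, trm_val T' e' s) \<in> R" "(trm_val T e t, trm_val T' e' t) \<in> R"
    using Eq.prems by (cases s; cases t; auto)+
  moreover have "partial_iso T T' R" using ef_mono[of T 0 j T' R] Eq.prems by simp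
  ultimately show ?case using partial_isoD(1) by fastforce
next
  case (Parent s t)
  have "(trm_val T e s, trm_val T' e' s) \<in> R" "(trm_val T e t, trm_val T' e' t) \<in> R"
    using Parent.prems by (cases s; cases t; auto)+
  moreover have "partial_iso T T' R" using ef_mono[of T 0 j T' R] Parent.prems by simp
  ultimately show ?case using partial_isoD(2) by fastforce
next
  case (Neg \<phi>)
  then show ?case by (metis free_vars.simps(3) qdepth.simps(3) sat.simps(3))
next
  case (Conj \<phi> \<psi>)
  have "sat T e \<phi> = sat T' e' \<phi>"
    using Conj.prems by (intro Conj.IH(1)[of j R e e']) auto
  moreover have "sat T e \<psi> = sat T' e' \<psi>"
    using Conj.prems by (intro Conj.IH(2)[of j R e e']) auto
  ultimately show ?case by simp
next
  case (Exists x \<phi>)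
  then obtain i where j: "j = Suc i" by (cases j) auto
  have step: "sat T (e(x := v)) \<phi> = sat T' (e'(x := v')) \<phi>"
    if "ef i T T' (insert (v, v') R)" for v v'
    using Exists.prems that by (intro Exists.IH[of i "insert (v, v') R"]) (auto simp: j)
  have "ef (Suc i) T T' R" using Exists.prems j by simp
  then show ?case using step by (simp, meson)
qed

text \<open>The propositional part of a Hintikka formula: each member of \<Phi> is conjoined plain
  or negated according to \<open>S\<close>, which costs no quantifier depth.
  \<open>Eq Root Root\<close> is the empty conjunction.\<close>

lemma conj_form:
  assumes "finite \<Phi>" "\<And>\<phi>. \<phi> \<in> \<Phi> \<Longrightarrow> qdepth \<phi> \<le> j" "\<And>\<phi>. \<phi> \<in> \<Phi> \<Longrightarrow> free_vars \<phi> \<subseteq> X"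
  shows "\<exists>\<psi>. qdepth \<psi> \<le> j \<and> free_vars \<psi> \<subseteq> X \<and>
    (\<forall>(T::'a rtree) e. sat T e \<psi> \<longleftrightarrow> (\<forall>\<phi>\<in>\<Phi>. sat T e \<phi> \<longleftrightarrow> \<phi> \<in> S))"
  using assms
proof (induction \<Phi> rule: finite_induct)
  case empty
  show ?case by (rule exI[of _ "Eq Root Root"]) simp
next
  case (insert \<phi> \<Phi>)
  then obtain \<psi> where \<psi>: "qdepth \<psi> \<le> j" "free_vars \<psi> \<subseteq> X"
    "\<forall>(T::'a rtree) e. sat T e \<psi> \<longleftrightarrow> (\<forall>\<phi>\<in>\<Phi>. sat T e \<phi> \<longleftrightarrow> \<phi> \<in> S)" by auto
  show ?case
    using insert.prems \<psi>
    by (intro exI[of _ "Conj (if \<phi> \<in> S then \<phi> else Neg \<phi>) \<psi>"]) auto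
qed

text \<open>Hintikka formulas: finitely many formulas decide the game with \<open>j\<close> moves.
  Variables below \<open>n\<close> carry the earlier choices and variable \<open>n\<close> the next
  one, so the step quantifies \<open>n\<close> over every truth pattern of the formulas obtained for
  \<open>Suc n\<close>.\<close>

lemma finite_hintikka:
  "\<exists>\<Phi>. finite \<Phi> \<and> (\<forall>\<phi>\<in>\<Phi>. qdepth \<phi> \<le> j \<and> free_vars \<phi> \<subseteq> {..<n}) \<and>
    (\<forall>(T::'a rtree) (T'::'a rtree) e e'. (\<forall>\<phi>\<in>\<Phi>. sat T e \<phi> \<longleftrightarrow> sat T' e' \<phi>) \<longrightarrow>
      ef j T T' (insert (root T, root T') ((\<lambda>i. (e i, e' i)) ` {..<n})))"
proof (induction j arbitrary: n)
  case 0
  define X where "X = insert Root (Var ` {..<n})"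
  define \<Phi> where "\<Phi> = (\<lambda>(s, t). Eq s t) ` (X \<times> X) \<union> (\<lambda>(s, t). Parent s t) ` (X \<times> X)"
  have "partial_iso T T' (insert (root T, root T') ((\<lambda>i. (e i, e' i)) ` {..<n}))"
    if *: "\<forall>\<phi>\<in>\<Phi>. sat T e \<phi> \<longleftrightarrow> sat T' e' \<phi>" for T T' :: "'a rtree" and e e'
  proof -
    have R: "insert (root T, root T') ((\<lambda>i. (e i, e' i)) ` {..<n}) =
        (\<lambda>t. (trm_val T e t, trm_val T' e' t)) ` X"
      by (auto simp: X_def image_image)
    have "(trm_val T e s = trm_val T e t) = (trm_val T' e' s = trm_val T' e' t)"
      "((trm_val T e s, trm_val T e t) \<in> parent T) = ((trm_val T' e' s, trm_val T' e' t) \<in> parent T')"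
      if "s \<in> X" "t \<in> X" for s t
      using *[rule_format, of "Eq s t"] *[rule_format, of "Parent s t"] that
      by (auto simp: \<Phi>_def)
    then show ?thesis unfolding R partial_iso_def by blast
  qed
  moreover have "finite \<Phi>" by (simp add: \<Phi>_def X_def)
  moreover have "\<forall>\<phi>\<in>\<Phi>. qdepth \<phi> \<le> 0 \<and> free_vars \<phi> \<subseteq> {..<n}" by (auto simp: \<Phi>_def X_def)
  ultimately show ?case by (intro exI[of _ \<Phi>] conjI allI impI) simp_all
next
  case (Suc j)
  obtain \<Phi> where \<Phi>: "finite \<Phi>" "\<forall>\<phi>\<in>\<Phi>. qdepth \<phi> \<le> j \<and> free_vars \<phi> \<subseteq> {..<Suc n}"
    and ef: "\<forall>(T::'a rtree) (T'::'a rtree) e e'. (\<forall>\<phi>\<in>\<Phi>. sat T e \<phi> \<longleftrightarrow> sat T' e' \<phi>) \<longrightarrow>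
      ef j T T' (insert (root T, root T') ((\<lambda>i. (e i, e' i)) ` {..<Suc n}))"
    using Suc[of "Suc n"] by (elim exE conjE) (rule that)
  have "\<forall>S. \<exists>\<psi>. qdepth \<psi> \<le> j \<and> free_vars \<psi> \<subseteq> {..<Suc n} \<and>
    (\<forall>(T::'a rtree) e. sat T e \<psi> \<longleftrightarrow> (\<forall>\<phi>\<in>\<Phi>. sat T e \<phi> \<longleftrightarrow> \<phi> \<in> S))"
    using conj_form[OF \<Phi>(1)] \<Phi>(2) by blast
  from choice[OF this] obtain \<chi> where *: "\<forall>S. qdepth (\<chi> S) \<le> j \<and> free_vars (\<chi> S) \<subseteq> {..<Suc n} \<and>
    (\<forall>(T::'a rtree) e. sat T e (\<chi> S) \<longleftrightarrow> (\<forall>\<phi>\<in>\<Phi>. sat T e \<phi> \<longleftrightarrow> \<phi> \<in> S))" ..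
  then have \<chi>: "qdepth (\<chi> S) \<le> j" "free_vars (\<chi> S) \<subseteq> {..<Suc n}"
    "sat (T::'a rtree) e (\<chi> S) \<longleftrightarrow> (\<forall>\<phi>\<in>\<Phi>. sat T e \<phi> \<longleftrightarrow> \<phi> \<in> S)" for S T e
    by blast+
  define \<Phi>' where "\<Phi>' = (\<lambda>S. Exists n (\<chi> S)) ` Pow \<Phi>"
  have half: "\<exists>v'\<in>verts T'. ef j T T' (insert (v, v')
        (insert (root T, root T') ((\<lambda>i. (e i, e' i)) ` {..<n})))"
    if agree: "\<forall>\<phi>\<in>\<Phi>'. sat T e \<phi> \<longleftrightarrow> sat T' e' \<phi>" and v: "v \<in> verts T"
    for T T' :: "'a rtree" and e e' v
  proof -
    \<comment> \<open>The truth pattern of Spoiler's choice \<open>v\<close>. Agreement on \<Phi>'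
      yields a \<open>v'\<close> in the other tree with the same pattern, which is Duplicator's
      answer.\<close>
    define S where "S = {\<phi>\<in>\<Phi>. sat T (e(n := v)) \<phi>}"
    have "sat T e (Exists n (\<chi> S))" using v by (auto simp: \<chi> S_def)
    moreover have "Exists n (\<chi> S) \<in> \<Phi>'" by (auto simp: \<Phi>'_def S_def)
    ultimately have "sat T' e' (Exists n (\<chi> S))" using agree by blast
    then obtain v' where v': "v' \<in> verts T'" "sat T' (e'(n := v')) (\<chi> S)" by auto
    have "insert (v, v') (insert (root T, root T') ((\<lambda>i. (e i, e' i)) ` {..<n})) =
      insert (root T, root T') ((\<lambda>i. ((e(n := v)) i, (e'(n := v')) i)) ` {..<Suc n})"
      by (auto simp: lessThan_Suc)
    moreover have "\<forall>\<phi>\<in>\<Phi>. sat T (e(n := v)) \<phi> \<longleftrightarrow> sat T' (e'(n := v')) \<phi>"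
      using v'(2) by (auto simp: \<chi> S_def)
    ultimately have "ef j T T' (insert (v, v')
        (insert (root T, root T') ((\<lambda>i. (e i, e' i)) ` {..<n})))"
      using ef by (simp only:)
    then show ?thesis using v'(1) by blast
  qed
  have "ef (Suc j) T T' (insert (root T, root T') ((\<lambda>i. (e i, e' i)) ` {..<n}))"
    if agree: "\<forall>\<phi>\<in>\<Phi>'. sat T e \<phi> \<longleftrightarrow> sat T' e' \<phi>" for T T' :: "'a rtree" and e e'
  proof -
    have conv: "(insert (v', v) (insert (root T', root T) ((\<lambda>i. (e' i, e i)) ` {..<n})))\<inverse> =
        insert (v, v') (insert (root T, root T') ((\<lambda>i. (e i, e' i)) ` {..<n}))" for v v'
      by auto
    have "\<exists>v\<in>verts T. ef j T T' (insert (v, v')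
        (insert (root T, root T') ((\<lambda>i. (e i, e' i)) ` {..<n})))" if v': "v' \<in> verts T'" for v'
    proof -
      obtain v where "v \<in> verts T" and "ef j T' T (insert (v', v)
          (insert (root T', root T) ((\<lambda>i. (e' i, e i)) ` {..<n})))"
        using half[of T' e' T e v'] agree v' by auto
      then show ?thesis using ef_converse unfolding conv[symmetric] by blast
    qed
    then show ?thesis using half[OF agree] by simp
  qed
  moreover have "finite \<Phi>'" using \<Phi> by (simp add: \<Phi>'_def)
  moreover have "\<forall>\<phi>\<in>\<Phi>'. qdepth \<phi> \<le> Suc j \<and> free_vars \<phi> \<subseteq> {..<n}"
    using \<chi>(1,2) by (fastforce simp: \<Phi>'_def lessThan_Suc)
  ultimately show ?case by (intro exI[of _ \<Phi>'] conjI allI impI) simp_all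
qed

text \<open>Ehrenfeucht's theorem, from \<open>finite_hintikka\<close> without free variables and
  \<open>ef_sat\<close>. Formulas do not occur beyond this point.\<close>

lemma tree_equiv_iff_ef:
  fixes T T' :: "'a rtree"
  shows "(T, T') \<in> tree_equiv k \<longleftrightarrow>
     rooted_tree T \<and> rooted_tree T' \<and> ef k T T' {(root T, root T')}"
proof -
  obtain \<Phi> where "finite \<Phi>" and \<Phi>: "\<forall>\<phi>\<in>\<Phi>. qdepth \<phi> \<le> k \<and> free_vars \<phi> \<subseteq> {..<0}"
    and ef: "\<forall>(T::'a rtree) (T'::'a rtree) e e'. (\<forall>\<phi>\<in>\<Phi>. sat T e \<phi> \<longleftrightarrow> sat T' e' \<phi>) \<longrightarrow>
      ef k T T' (insert (root T, root T') ((\<lambda>i. (e i, e' i)) ` {..<0}))"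
    using finite_hintikka[of k 0] by (elim exE conjE) (rule that)
  have "ef k T T' {(root T, root T')}"
    if "\<forall>\<phi>. free_vars \<phi> = {} \<and> qdepth \<phi> \<le> k \<longrightarrow> holds T \<phi> = holds T' \<phi>"
  proof -
    have "\<forall>\<phi>\<in>\<Phi>. sat T (\<lambda>_. root T) \<phi> = sat T' (\<lambda>_. root T') \<phi>"
      using that \<Phi> by (simp add: holds_def)
    then show ?thesis using ef by fastforce
  qed
  moreover have "holds T \<phi> = holds T' \<phi>"
    if "ef k T T' {(root T, root T')}" "rooted_tree T" "free_vars \<phi> = {}" "qdepth \<phi> \<le> k" for \<phi>
    unfolding holds_def using that by (intro ef_sat[OF that(1)]) (auto simp: rooted_tree_def)
  ultimately show ?thesis unfolding tree_equiv_def by blast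
qed

lemma EV_eq_iff:
  assumes "rooted_tree T" "rooted_tree T'"
  shows "EV k T = EV k T' \<longleftrightarrow> ef k T T' {(root T, root T')}"
proof -
  have "EV k T = EV k T' \<longleftrightarrow> (T, T') \<in> tree_equiv k"
    unfolding EV_def using eq_equiv_class_iff[OF equiv_tree_equiv] assms by blast
  then show ?thesis using assms by (simp add: tree_equiv_iff_ef)
qed

lemma EV_in_classes: "rooted_tree T \<Longrightarrow> EV k T \<in> ehr_classes k"
  by (simp add: EV_def ehr_classes_def quotientI)

lemma ehr_classesE:
  assumes "j \<in> ehr_classes k"
  obtains T where "rooted_tree T" "EV k T = j"
  using assms by (auto simp: EV_def ehr_classes_def elim!: quotientE)

section \<open>Gluing trees along the root\<close>

lemma parent_unique:
  assumes "rooted_tree T" "(u, w) \<in> parent T" "(u, w') \<in> parent T"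
  shows "w = w'"
  using assms unfolding rooted_tree_def by blast

lemma single_valued_parent: "rooted_tree T \<Longrightarrow> single_valued (parent T)"
  by (auto simp: single_valued_def dest: parent_unique)

lemma parent_verts:
  assumes "rooted_tree T" "(u, w) \<in> parent T"
  shows "u \<in> verts T" "w \<in> verts T"
  using assms unfolding rooted_tree_def by blast+

lemma root_verts: "rooted_tree T \<Longrightarrow> root T \<in> verts T"
  by (simp add: rooted_tree_def)

lemma root_no_parent: "rooted_tree T \<Longrightarrow> (root T, w) \<notin> parent T"
  by (simp add: rooted_tree_def)

lemma rootchild_iff: "u \<in> rootchildren T \<longleftrightarrow> (u, root T) \<in> parent T"
  by (simp add: rootchildren_def)

lemma rootchild_verts: "rooted_tree T \<Longrightarrow> u \<in> rootchildren T \<Longrightarrow> u \<in> verts T"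
  by (auto simp: rootchild_iff dest: parent_verts)

lemma rootchild_neq_root: "rooted_tree T \<Longrightarrow> u \<in> rootchildren T \<Longrightarrow> u \<noteq> root T"
  by (auto simp: rootchild_iff root_no_parent)

lemma descendants_refl: "u \<in> descendants T u"
  by (simp add: descendants_def)

lemma descendants_subset:
  assumes "rooted_tree T" "u \<in> verts T"
  shows "descendants T u \<subseteq> verts T"
proof
  fix a assume "a \<in> descendants T u"
  then have "(a, u) \<in> (parent T)\<^sup>*" by (simp add: descendants_def)
  then show "a \<in> verts T"
  proof (cases rule: converse_rtranclE)
    case base
    then show ?thesis using assms(2) by simp
  next
    case (step b)
    then show ?thesis using parent_verts(1)[OF assms(1)] by simp
  qed
qed

lemma descendants_down: "(a, b) \<in> parent T \<Longrightarrow> b \<in> descendants T u \<Longrightarrow> a \<in> descendants T u"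
  by (auto simp: descendants_def)

lemma descendants_up:
  assumes "rooted_tree T" "(a, b) \<in> parent T" "a \<in> descendants T u" "a \<noteq> u"
  shows "b \<in> descendants T u"
proof -
  from assms(3,4) obtain c where "(a, c) \<in> parent T" "(c, u) \<in> (parent T)\<^sup>*"
    by (auto simp: descendants_def elim: converse_rtranclE)
  then show ?thesis using parent_unique[OF assms(1,2)] by (simp add: descendants_def)
qed

lemma root_rtrancl: "rooted_tree T \<Longrightarrow> (root T, u) \<in> (parent T)\<^sup>* \<Longrightarrow> u = root T"
  by (auto elim: converse_rtranclE simp: root_no_parent)

lemma root_notin_descendants:
  assumes "rooted_tree T" "u \<noteq> root T"
  shows "root T \<notin> descendants T u"
  using assms by (auto simp: descendants_def dest: root_rtrancl)

lemma rootchild_of_vertex: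
  assumes "rooted_tree T" "v \<in> verts T" "v \<noteq> root T"
  obtains u where "u \<in> rootchildren T" "v \<in> descendants T u"
proof -
  have "(v, root T) \<in> (parent T)\<^sup>*" using assms unfolding rooted_tree_def by blast
  with assms(3) that show ?thesis
    by (auto simp: descendants_def rootchild_iff elim: rtranclE)
qed

text \<open>Since the parent relation is single-valued, two ancestors of \<open>v\<close> are
  comparable; and a rootchild is not a proper descendant of another one, because its only parent is
  the root.\<close>

lemma rootchild_unique:
  assumes T: "rooted_tree T" and u: "u \<in> rootchildren T" "u' \<in> rootchildren T"
    and v: "v \<in> descendants T u" "v \<in> descendants T u'"
  shows "u = u'"
proof -
  have *: "w = w'" if "(w, w') \<in> (parent T)\<^sup>*" "w \<in> rootchildren T" "w' \<in> rootchildren T" for w w'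
  proof (rule ccontr)
    assume "w \<noteq> w'"
    with that(1) obtain y where "(w, y) \<in> parent T" "(y, w') \<in> (parent T)\<^sup>*"
      by (auto elim: converse_rtranclE)
    with that(2) have "(root T, w') \<in> (parent T)\<^sup>*"
      using parent_unique[OF T, of w y "root T"] by (simp add: rootchild_iff)
    with that(3) show False using root_rtrancl[OF T] rootchild_neq_root[OF T] by blast
  qed
  have "(u, u') \<in> (parent T)\<^sup>* \<or> (u', u) \<in> (parent T)\<^sup>*"
    using single_valued_confluent[OF single_valued_parent[OF T]] v
    by (auto simp: descendants_def)
  then show ?thesis using * u by blast
qed

lemma subtree_simps [simp]:
  "verts (subtree T u) = descendants T u" "root (subtree T u) = u"
  "parent (subtree T u) = parent T \<inter> (descendants T u \<times> descendants T u)"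
  by (simp_all add: subtree_def)

lemma rooted_tree_rootchild: "rooted_tree T \<Longrightarrow> u \<in> rootchildren T \<Longrightarrow> rooted_tree (subtree T u)"
  by (simp add: rooted_tree_subtree rootchild_verts)

text \<open>A position of Duplicator is a finite set \<open>M\<close> of triples \<open>(u, u', R)\<close>, where \<open>u\<close> and \<open>u'\<close> are
  matched rootchildren and \<open>R\<close> is the position reached in the game on their subtrees.\<close>

definition child_match ::
    "nat \<Rightarrow> nat \<Rightarrow> 'a rtree \<Rightarrow> 'a rtree \<Rightarrow> ('a::infinite \<times> 'a \<times> ('a \<times> 'a) set) set \<Rightarrow> bool" where
  "child_match k j T T' M \<longleftrightarrow> finite M \<and> card M + j \<le> k \<and>
     (\<forall>u u' R. (u, u', R) \<in> M \<longrightarrow>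
        u \<in> rootchildren T \<and> u' \<in> rootchildren T' \<and>
        EV k (subtree T u) = EV k (subtree T' u') \<and> (u, u') \<in> R \<and>
        R \<subseteq> descendants T u \<times> descendants T' u' \<and> ef j (subtree T u) (subtree T' u') R) \<and>
     (\<forall>u u' R w w' Q. (u, u', R) \<in> M \<longrightarrow> (w, w', Q) \<in> M \<longrightarrow> u = w \<or> u' = w' \<longrightarrow>
        u = w \<and> u' = w' \<and> R = Q)"

definition match_rel :: "'a rtree \<Rightarrow> 'a rtree \<Rightarrow> ('a \<times> 'a \<times> ('a \<times> 'a) set) set \<Rightarrow> ('a \<times> 'a) set" where
  "match_rel T T' M = insert (root T, root T') {p. \<exists>u u' R. (u, u', R) \<in> M \<and> p \<in> R}"

definition match_conv :: "('a \<times> 'a \<times> ('a \<times> 'a) set) set \<Rightarrow> ('a \<times> 'a \<times> ('a \<times> 'a) set) set" where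
  "match_conv M = (\<lambda>(u, u', R). (u', u, R\<inverse>)) ` M"

lemma match_conv_iff: "(u, u', R) \<in> match_conv M \<longleftrightarrow> (u', u, R\<inverse>) \<in> M"
  by (force simp: match_conv_def)

lemma match_rel_conv: "match_rel T' T (match_conv M) = (match_rel T T' M)\<inverse>"
proof -
  have *: "(\<exists>u u' R. (u, u', R) \<in> match_conv M \<and> (b, a) \<in> R) \<longleftrightarrow> (\<exists>u u' R. (u, u', R) \<in> M \<and> (a, b) \<in> R)"
    for a b
  proof
    assume "\<exists>u u' R. (u, u', R) \<in> match_conv M \<and> (b, a) \<in> R"
    then obtain u u' R where "(u', u, R\<inverse>) \<in> M" "(a, b) \<in> R\<inverse>" by (auto simp: match_conv_iff)
    then show "\<exists>u u' R. (u, u', R) \<in> M \<and> (a, b) \<in> R" by blast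
  next
    assume "\<exists>u u' R. (u, u', R) \<in> M \<and> (a, b) \<in> R"
    then obtain u u' R where "(u', u, R\<inverse>) \<in> match_conv M" "(b, a) \<in> R\<inverse>"
      by (auto simp: match_conv_iff)
    then show "\<exists>u u' R. (u, u', R) \<in> match_conv M \<and> (b, a) \<in> R" by blast
  qed
  have "(b, a) \<in> match_rel T' T (match_conv M) \<longleftrightarrow> (a, b) \<in> match_rel T T' M" for a b
    unfolding match_rel_def insert_iff mem_Collect_eq * by auto
  then show ?thesis by auto
qed

lemma child_match_conv:
  assumes "child_match k j T T' M"
  shows "child_match k j T' T (match_conv M)"
proof -
  have "inj_on (\<lambda>(u, u', R). (u', u, R\<inverse>)) M" by (auto simp: inj_on_def)
  then have "card (match_conv M) = card M" by (simp add: match_conv_def card_image)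
  moreover have "finite (match_conv M)" using assms by (simp add: match_conv_def child_match_def)
  moreover have "u \<in> rootchildren T' \<and> u' \<in> rootchildren T \<and>
        EV k (subtree T' u) = EV k (subtree T u') \<and> (u, u') \<in> R \<and>
        R \<subseteq> descendants T' u \<times> descendants T u' \<and> ef j (subtree T' u) (subtree T u') R"
    if "(u, u', R) \<in> match_conv M" for u u' R
  proof -
    have "(u', u, R\<inverse>) \<in> M" using that by (simp add: match_conv_iff)
    with assms have *: "u \<in> rootchildren T'" "u' \<in> rootchildren T"
        "EV k (subtree T u') = EV k (subtree T' u)" "(u', u) \<in> R\<inverse>"
        "R\<inverse> \<subseteq> descendants T u' \<times> descendants T' u" "ef j (subtree T u') (subtree T' u) (R\<inverse>)"
      unfolding child_match_def by blast+
    then show ?thesis using ef_converse[OF *(6)] by auto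
  qed
  moreover have "u = w \<and> u' = w' \<and> R = Q" if "(u, u', R) \<in> match_conv M"
      "(w, w', Q) \<in> match_conv M" "u = w \<or> u' = w'" for u u' R w w' Q
  proof -
    have "(u', u, R\<inverse>) \<in> M" "(w', w, Q\<inverse>) \<in> M" using that by (simp_all add: match_conv_iff)
    with assms that(3) have "u' = w' \<and> u = w \<and> R\<inverse> = Q\<inverse>"
      unfolding child_match_def by blast
    then show ?thesis by (metis converse_converse)
  qed
  moreover have "card M + j \<le> k" using assms by (simp add: child_match_def)
  ultimately show ?thesis unfolding child_match_def by (intro conjI allI impI) metis+
qed

lemma child_match_Suc:
  assumes T: "rooted_tree T" and M: "child_match k (Suc j) T T' M"
  shows "child_match k j T T' M"
proof -
  have "ef j (subtree T u) (subtree T' u') R" if "(u, u', R) \<in> M" for u u' R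
  proof (rule ef_Suc_imp)
    show "ef (Suc j) (subtree T u) (subtree T' u') R"
      using M that unfolding child_match_def by blast
    show "verts (subtree T u) \<noteq> {}" using descendants_refl[of u T] by auto
  qed
  then show ?thesis using M unfolding child_match_def by auto
qed

text \<open>A move below a matched rootchild is answered inside that subgame. Otherwise Duplicator
  opens a new subgame at a fresh rootchild of the same class. By the invariant
  \<open>card M + Suc j \<le> k\<close>, fewer than \<open>k\<close> children are matched, so
  equality of truncated counts is enough to find one, and a new subgame, which is won for
  \<open>k\<close> moves, lasts for all the moves that remain.\<close>

lemma child_match_step:
  assumes T: "rooted_tree T" and T': "rooted_tree T'"
    and cnt: "\<And>c. c \<in> ehr_classes k \<Longrightarrow>
      trunc_card k {v \<in> rootchildren T. EV k (subtree T v) = c} =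
      trunc_card k {v \<in> rootchildren T'. EV k (subtree T' v) = c}"
    and M: "child_match k (Suc j) T T' M" and v: "v \<in> verts T"
  shows "\<exists>v'\<in>verts T'. \<exists>M'. child_match k j T T' M' \<and>
    insert (v, v') (match_rel T T' M) \<subseteq> match_rel T T' M'"
proof -
  note Mj = child_match_Suc[OF T M]
  have Mfin: "finite M" and Mcard: "card M + Suc j \<le> k"
    using M by (auto simp: child_match_def)
  have M1: "u \<in> rootchildren T" "u' \<in> rootchildren T'"
      "EV k (subtree T u) = EV k (subtree T' u')" "(u, u') \<in> R"
      "R \<subseteq> descendants T u \<times> descendants T' u'" "ef (Suc j) (subtree T u) (subtree T' u') R"
      "ef j (subtree T u) (subtree T' u') R"
    if "(u, u', R) \<in> M" for u u' R
    using that M Mj unfolding child_match_def by blast+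
  have M2: "u = w \<and> u' = w' \<and> R = Q" if "(u, u', R) \<in> M" "(w, w', Q) \<in> M" "u = w \<or> u' = w'"
    for u u' R w w' Q
    using that M unfolding child_match_def by blast
  show ?thesis
  proof (cases "v = root T")
    case True
    then show ?thesis using Mj root_verts[OF T'] by (auto simp: match_rel_def)
  next
    case False
    then obtain u where u: "u \<in> rootchildren T" "v \<in> descendants T u"
      using rootchild_of_vertex[OF T v] by blast
    show ?thesis
    proof (cases "\<exists>u' R. (u, u', R) \<in> M")
      case True
      then obtain u' R where uM: "(u, u', R) \<in> M" by blast
      from M1(6)[OF uM] u(2) obtain v' where v': "v' \<in> descendants T' u'"
        and ef: "ef j (subtree T u) (subtree T' u') (insert (v, v') R)" by auto
      define M' where "M' = insert (u, u', insert (v, v') R) (M - {(u, u', R)})"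
      have "card M' \<le> card M"
        using Mfin uM card_Diff1_less[OF Mfin uM]
        by (auto simp: M'_def card_insert_if)
      then have "card M' + j \<le> k" using Mcard by simp
      moreover have "finite M'" using Mfin by (simp add: M'_def)
      moreover have "w \<in> rootchildren T \<and> w' \<in> rootchildren T' \<and>
        EV k (subtree T w) = EV k (subtree T' w') \<and> (w, w') \<in> Q \<and>
        Q \<subseteq> descendants T w \<times> descendants T' w' \<and> ef j (subtree T w) (subtree T' w') Q"
        if "(w, w', Q) \<in> M'" for w w' Q
      proof (cases "(w, w', Q) \<in> M")
        case True
        then show ?thesis using M1[OF True] by blast
      next
        case False
        then have "w = u" "w' = u'" "Q = insert (v, v') R" using that by (auto simp: M'_def)
        then show ?thesis using M1[OF uM] u v' ef by simp
      qed
      moreover have "a = w \<and> a' = w' \<and> P = Q"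
        if "(a, a', P) \<in> M'" "(w, w', Q) \<in> M'" "a = w \<or> a' = w'" for a a' P w w' Q
        using that M2[of a a' P w w' Q] M2[OF uM, of w w' Q] M2[OF uM, of a a' P]
        by (auto simp: M'_def)
      ultimately have "child_match k j T T' M'"
        unfolding child_match_def by blast
      moreover have "insert (v, v') (match_rel T T' M) \<subseteq> match_rel T T' M'"
      proof -
        have "\<exists>w w' Q. (w, w', Q) \<in> M' \<and> p \<in> Q" if "(w, w', Q) \<in> M" "p \<in> Q" for w w' Q p
        proof (cases "(w, w', Q) = (u, u', R)")
          case True
          then have "p \<in> insert (v, v') R" using that by simp
          then show ?thesis unfolding M'_def by blast
        next
          case False
          then have "(w, w', Q) \<in> M'" using that by (simp add: M'_def)
          then show ?thesis using that(2) by blast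
        qed
        moreover have "\<exists>w w' Q. (w, w', Q) \<in> M' \<and> (v, v') \<in> Q" unfolding M'_def by blast
        ultimately show ?thesis unfolding match_rel_def by blast
      qed
      moreover have "v' \<in> verts T'"
        using v' descendants_subset[OF T' rootchild_verts[OF T' M1(2)[OF uM]]] by blast
      ultimately show ?thesis by blast
    next
      case unmatched: False
      define c where "c = EV k (subtree T u)"
      define C where "C = {v \<in> rootchildren T. EV k (subtree T v) = c}"
      define C' where "C' = {v \<in> rootchildren T'. EV k (subtree T' v) = c}"
      define N where "N = {p \<in> M. fst p \<in> C}"
      have "c \<in> ehr_classes k"
        using EV_in_classes[OF rooted_tree_rootchild[OF T u(1)]] by (simp add: c_def)
      then have CC: "trunc_card k C = trunc_card k C'" using cnt by (simp add: C_def C'_def)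
      have N: "finite N" "card N \<le> card M" using Mfin by (auto simp: N_def intro: card_mono)
      \<comment> \<open>If all of \<open>C'\<close> were matched, it would have at most
        \<open>card N < k\<close> elements, so its truncated count would be exact and
        \<open>C\<close> would have the same size. But \<open>C\<close> contains the unmatched
        \<open>u\<close> besides the children matched in \<open>N\<close>.\<close>
      have "\<exists>u'\<in>C'. \<forall>w R. (w, u', R) \<notin> M"
      proof (rule ccontr)
        assume "\<not> ?thesis"
        then have all: "\<forall>u'\<in>C'. \<exists>w R. (w, u', R) \<in> M" by blast
        have sub: "C' \<subseteq> (\<lambda>p. fst (snd p)) ` N"
        proof
          fix u' assume "u' \<in> C'"
          with all obtain w R where "(w, u', R) \<in> M" by blast
          moreover from this have "w \<in> C" using M1[of w u' R] \<open>u' \<in> C'\<close>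
            by (simp add: C_def C'_def)
          ultimately show "u' \<in> (\<lambda>p. fst (snd p)) ` N" by (force simp: N_def)
        qed
        have "finite C'" using finite_subset[OF sub] N by simp
        have C'N: "card C' \<le> card N" using surj_card_le[OF N(1) sub] .
        then have "trunc_card k C' = Exactly (card C')"
          using \<open>finite C'\<close> N Mcard by (simp add: trunc_card_def)
        with CC have C: "finite C" "card C = card C'"
          by (auto simp: trunc_card_def split: if_splits)
        have "inj_on fst N"
        proof (rule inj_onI)
          fix p q assume pq: "p \<in> N" "q \<in> N" "fst p = fst q"
          obtain w w' Q where p: "p = (w, w', Q)" by (cases p)
          obtain x x' Q' where q: "q = (x, x', Q')" by (cases q)
          have "w = x \<and> w' = x' \<and> Q = Q'"
            using pq by (intro M2) (simp_all add: N_def p q)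
          then show "p = q" by (simp add: p q)
        qed
        then have "card (fst ` N) = card N" by (rule card_image)
        moreover have "fst ` N \<subset> C"
        proof -
          have "u \<in> C" using u by (simp add: C_def c_def)
          moreover have "u \<notin> fst ` N" using unmatched by (auto simp: N_def)
          moreover have "fst ` N \<subseteq> C" by (auto simp: N_def)
          ultimately show ?thesis by blast
        qed
        ultimately have "card N < card C" using psubset_card_mono[OF C(1)] by metis
        then show False using C(2) C'N by simp
      qed
      then obtain u' where u': "u' \<in> C'" "\<forall>w R. (w, u', R) \<notin> M" by blast
      then have u'1: "u' \<in> rootchildren T'" "EV k (subtree T u) = EV k (subtree T' u')"
        by (auto simp: C'_def c_def)
      have "ef k (subtree T u) (subtree T' u') {(u, u')}"
        using u'1(2) EV_eq_iff[OF rooted_tree_rootchild[OF T u(1)] rooted_tree_rootchild[OF T' u'1(1)]]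
        by simp
      then have "ef (Suc j) (subtree T u) (subtree T' u') {(u, u')}"
        by (rule ef_mono[rotated 2]) (use Mcard u(2) in auto)
      then obtain v' where v': "v' \<in> descendants T' u'"
        and ef: "ef j (subtree T u) (subtree T' u') {(v, v'), (u, u')}"
        using u(2) by auto
      define M' where "M' = insert (u, u', {(v, v'), (u, u')}) M"
      have "card M' \<le> Suc (card M)" using Mfin by (simp add: M'_def card_insert_if)
      then have "card M' + j \<le> k" using Mcard by simp
      moreover have "finite M'" using Mfin by (simp add: M'_def)
      moreover have "w \<in> rootchildren T \<and> w' \<in> rootchildren T' \<and>
        EV k (subtree T w) = EV k (subtree T' w') \<and> (w, w') \<in> R \<and>
        R \<subseteq> descendants T w \<times> descendants T' w' \<and> ef j (subtree T w) (subtree T' w') R"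
        if "(w, w', R) \<in> M'" for w w' R
      proof (cases "(w, w', R) \<in> M")
        case True
        then show ?thesis using M1[OF True] by blast
      next
        case False
        then have "w = u" "w' = u'" "R = {(v, v'), (u, u')}" using that by (auto simp: M'_def)
        then show ?thesis using u u'1 v' ef descendants_refl[of u T] descendants_refl[of u' T']
          by auto
      qed
      moreover have "a = w \<and> a' = w' \<and> R = Q"
        if "(a, a', R) \<in> M'" "(w, w', Q) \<in> M'" "a = w \<or> a' = w'" for a a' R w w' Q
        using that u'(2) unmatched M2[of a a' R w w' Q] by (auto simp: M'_def)
      ultimately have "child_match k j T T' M'"
        unfolding child_match_def by blast
      moreover have "insert (v, v') (match_rel T T' M) \<subseteq> match_rel T T' M'"
        by (auto simp: match_rel_def M'_def)
      moreover have "v' \<in> verts T'"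
        using v' descendants_subset[OF T' rootchild_verts[OF T' u'1(1)]] by blast
      ultimately show ?thesis by blast
    qed
  qed
qed

text \<open>Subtrees at different rootchildren are disjoint and not joined by an edge, so only the
  root needs attention. Among the vertices of one subtree, the rootchild alone is attached to the
  root; this is preserved because the pair of rootchildren belongs to each \<open>R\<close>.\<close>

lemma child_match_partial_iso:
  assumes T: "rooted_tree T" and T': "rooted_tree T'" and M: "child_match k 0 T T' M"
  shows "partial_iso T T' (match_rel T T' M)"
proof -
  have M1: "u \<in> rootchildren T" "u' \<in> rootchildren T'" "(u, u') \<in> R"
      "R \<subseteq> descendants T u \<times> descendants T' u'" "partial_iso (subtree T u) (subtree T' u') R"
    if "(u, u', R) \<in> M" for u u' R
    using that M unfolding child_match_def by auto
  have M2: "u = w \<and> u' = w' \<and> R = Q" if "(u, u', R) \<in> M" "(w, w', Q) \<in> M" "u = w \<or> u' = w'"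
    for u u' R w w' Q
    using that M unfolding child_match_def by blast
  have root_iff: "a \<noteq> root T \<and> b \<noteq> root T' \<and> (root T, a) \<notin> parent T \<and> (root T', b) \<notin> parent T' \<and>
      ((a, root T) \<in> parent T \<longleftrightarrow> (b, root T') \<in> parent T')"
    if uM: "(u, u', R) \<in> M" and ab: "(a, b) \<in> R" for u u' R a b
  proof -
    have d: "a \<in> descendants T u" "b \<in> descendants T' u'" using M1(4)[OF uM] ab by auto
    have "(a, root T) \<in> parent T \<longleftrightarrow> a = u"
      using rootchild_unique[OF T, of a u a] d M1(1)[OF uM] descendants_refl[of a T]
      by (auto simp: rootchild_iff)
    moreover have "(b, root T') \<in> parent T' \<longleftrightarrow> b = u'"
      using rootchild_unique[OF T', of b u' b] d M1(2)[OF uM] descendants_refl[of b T']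
      by (auto simp: rootchild_iff)
    moreover have "a = u \<longleftrightarrow> b = u'"
      using partial_isoD(1)[OF M1(5)[OF uM] ab M1(3)[OF uM]] .
    moreover have "a \<noteq> root T" "b \<noteq> root T'"
      using d root_notin_descendants[OF T rootchild_neq_root[OF T M1(1)[OF uM]]]
        root_notin_descendants[OF T' rootchild_neq_root[OF T' M1(2)[OF uM]]] by auto
    ultimately show ?thesis using root_no_parent[OF T] root_no_parent[OF T'] by simp
  qed
  have in_desc: "a \<in> descendants T u" "b \<in> descendants T' u'"
    if "(u, u', R) \<in> M" "(a, b) \<in> R" for u u' R a b
    using subsetD[OF M1(4)[OF that(1)] that(2)] by auto
  have main: "(a = a' \<longleftrightarrow> b = b') \<and> ((a, a') \<in> parent T \<longleftrightarrow> (b, b') \<in> parent T')"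
    if uM: "(u, u', R) \<in> M" and ab: "(a, b) \<in> R" and wM: "(w, w', Q) \<in> M" and a'b': "(a', b') \<in> Q"
    for u u' R w w' Q a b a' b'
  proof (cases "u = w")
    case True
    then have eq: "u' = w'" "R = Q" using M2[OF uM wM disjI1] by blast+
    show ?thesis
      using partial_isoD[OF M1(5)[OF uM] ab a'b'[folded eq(2)]] in_desc[OF uM ab]
        in_desc[OF wM a'b'] True eq(1) by simp
  next
    case False
    then have "u' \<noteq> w'" using M2[OF uM wM] by blast
    have 1: "c \<notin> descendants T w" if "c \<in> descendants T u" for c
      using rootchild_unique[OF T M1(1)[OF uM] M1(1)[OF wM] that] False by blast
    have 2: "c \<notin> descendants T' w'" if "c \<in> descendants T' u'" for c
      using rootchild_unique[OF T' M1(2)[OF uM] M1(2)[OF wM] that] \<open>u' \<noteq> w'\<close> by blast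
    show ?thesis
      using 1[of a] 2[of b] in_desc[OF uM ab] in_desc[OF wM a'b']
        descendants_down[of a a' T w] descendants_down[of b b' T' w'] by auto
  qed
  show ?thesis
    unfolding partial_iso_def
  proof (intro allI impI)
    fix a b a' b'
    assume "(a, b) \<in> match_rel T T' M" "(a', b') \<in> match_rel T T' M"
    then consider "a = root T" "b = root T'" "a' = root T" "b' = root T'"
      | u u' R where "a = root T" "b = root T'" "(u, u', R) \<in> M" "(a', b') \<in> R"
      | u u' R where "a' = root T" "b' = root T'" "(u, u', R) \<in> M" "(a, b) \<in> R"
      | u u' R w w' Q where "(u, u', R) \<in> M" "(a, b) \<in> R" "(w, w', Q) \<in> M" "(a', b') \<in> Q"
      unfolding match_rel_def by blast
    then show "(a = a' \<longleftrightarrow> b = b') \<and> ((a, a') \<in> parent T \<longleftrightarrow> (b, b') \<in> parent T')"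
    proof cases
      case 1
      then show ?thesis using root_no_parent[OF T] root_no_parent[OF T'] by simp
    next
      case 2
      then show ?thesis using root_iff[OF 2(3,4)] by auto
    next
      case 3
      then show ?thesis using root_iff[OF 3(3,4)] by auto
    next
      case 4
      then show ?thesis using main by blast
    qed
  qed
qed

text \<open>This makes \<Gamma> well defined. Duplicator starts with no matched children and all
  \<open>k\<close> moves left.\<close>

lemma EV_cong_children:
  assumes T: "rooted_tree T" and T': "rooted_tree T'"
    and cnt: "\<And>c. c \<in> ehr_classes k \<Longrightarrow>
      trunc_card k {v \<in> rootchildren T. EV k (subtree T v) = c} =
      trunc_card k {v \<in> rootchildren T'. EV k (subtree T' v) = c}"
  shows "EV k T = EV k T'"
proof -
  have "ef j T T' (match_rel T T' M)" if "child_match k j T T' M" for j M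
    using that
  proof (induction j arbitrary: M)
    case 0
    then show ?case using child_match_partial_iso[OF T T'] by simp
  next
    case (Suc j)
    have "\<exists>v'\<in>verts T'. ef j T T' (insert (v, v') (match_rel T T' M))" if "v \<in> verts T" for v
      using child_match_step[OF T T' cnt Suc.prems that] Suc.IH ef_subset by metis
    moreover have "\<exists>v\<in>verts T. ef j T T' (insert (v, v') (match_rel T T' M))"
      if v': "v' \<in> verts T'" for v'
    proof -
      obtain v M' where v: "v \<in> verts T" and M': "child_match k j T' T M'"
        and sub: "insert (v', v) (match_rel T' T (match_conv M)) \<subseteq> match_rel T' T M'"
        using child_match_step[OF T' T cnt[symmetric] child_match_conv[OF Suc.prems] v'] by blast
      have "ef j T T' (match_rel T T' (match_conv M'))"
        using Suc.IH[OF child_match_conv[OF M']] .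
      moreover have "insert (v, v') (match_rel T T' M) \<subseteq> match_rel T T' (match_conv M')"
        using sub unfolding match_rel_conv by auto
      ultimately show ?thesis using v ef_subset by blast
    qed
    ultimately show ?case by simp
  qed
  moreover have "child_match k k T T' {}" by (simp add: child_match_def)
  ultimately have "ef k T T' (match_rel T T' {})" by blast
  then show ?thesis using EV_eq_iff[OF T T'] by (simp add: match_rel_def)
qed

lemma Gam_eq:
  assumes T: "rooted_tree T"
    and n: "\<And>c. c \<in> ehr_classes k \<Longrightarrow> trunc_card k {v \<in> rootchildren T. EV k (subtree T v) = c} = n c"
  shows "Gam k n = EV k T"
  unfolding Gam_def
proof (rule the_equality)
  show "\<exists>T'. rooted_tree T' \<and> EV k T' = EV k T \<and>
     (\<forall>j\<in>ehr_classes k. trunc_card k {v \<in> rootchildren T'. EV k (subtree T' v) = j} = n j)"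
    using T n by blast
next
  fix \<sigma>
  assume "\<exists>T'. rooted_tree T' \<and> EV k T' = \<sigma> \<and>
     (\<forall>j\<in>ehr_classes k. trunc_card k {v \<in> rootchildren T'. EV k (subtree T' v) = j} = n j)"
  then obtain T' where T': "rooted_tree T'" "EV k T' = \<sigma>"
    and n': "\<And>j. j \<in> ehr_classes k \<Longrightarrow>
      trunc_card k {v \<in> rootchildren T'. EV k (subtree T' v) = j} = n j" by blast
  have "EV k T = EV k T'" by (rule EV_cong_children[OF T T'(1)]) (simp add: n n')
  then show "\<sigma> = EV k T" using T'(2) by simp
qed

section \<open>Relabelled copies and joins of trees\<close>

definition map_tree :: "('a \<Rightarrow> 'b) \<Rightarrow> 'a rtree \<Rightarrow> 'b rtree" where
  "map_tree h T = \<lparr>verts = h ` verts T, root = h (root T), parent = map_prod h h ` parent T\<rparr>"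

lemma map_tree_simps [simp]:
  "verts (map_tree h T) = h ` verts T" "root (map_tree h T) = h (root T)"
  "parent (map_tree h T) = map_prod h h ` parent T"
  by (simp_all add: map_tree_def)

lemma map_prod_rtrancl: "(a, b) \<in> r\<^sup>* \<Longrightarrow> (h a, h b) \<in> (map_prod h h ` r)\<^sup>*"
  by (induction rule: rtrancl_induct) (auto intro: rtrancl_into_rtrancl)

lemma rooted_tree_map:
  assumes h: "inj h" and T: "rooted_tree T"
  shows "rooted_tree (map_tree h T)"
proof -
  have iff: "(h a, w) \<in> map_prod h h ` parent T \<longleftrightarrow> (\<exists>b. w = h b \<and> (a, b) \<in> parent T)" for a w
    using h by (auto simp: inj_def)
  have "map_prod h h ` parent T \<subseteq> h ` verts T \<times> h ` verts T"
    using parent_verts[OF T] by auto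
  moreover have "(h (root T), w) \<notin> map_prod h h ` parent T" for w
    by (simp add: iff root_no_parent[OF T])
  moreover have "\<exists>!w. (v, w) \<in> map_prod h h ` parent T" if "v \<in> h ` verts T - {h (root T)}" for v
  proof -
    from that obtain a where a: "v = h a" "a \<in> verts T" "a \<noteq> root T" by blast
    with T obtain b where "(a, b) \<in> parent T" unfolding rooted_tree_def by blast
    then show ?thesis unfolding a(1) iff using parent_unique[OF T] by blast
  qed
  moreover have "(v, h (root T)) \<in> (map_prod h h ` parent T)\<^sup>*" if "v \<in> h ` verts T" for v
    using that T map_prod_rtrancl[of _ "root T" "parent T" h] unfolding rooted_tree_def by blast
  ultimately show ?thesis using root_verts[OF T] unfolding rooted_tree_def map_tree_simps by simp
qed

lemma ef_map_tree:
  assumes "inj h" "R \<subseteq> {(a, h a) |a. a \<in> verts T}"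
  shows "ef j T (map_tree h T) R"
  using assms(2)
proof (induction j arbitrary: R)
  case 0
  have "(h a, h b) \<in> map_prod h h ` parent T \<longleftrightarrow> (a, b) \<in> parent T" for a b
    using assms(1) by (auto simp: inj_def)
  moreover have "b = h a" if "(a, b) \<in> R" for a b using 0 that by blast
  ultimately have "(a = a' \<longleftrightarrow> b = b') \<and> ((a, a') \<in> parent T \<longleftrightarrow> (b, b') \<in> map_prod h h ` parent T)"
    if "(a, b) \<in> R" "(a', b') \<in> R" for a b a' b'
    using that inj_eq[OF assms(1)] by metis
  then show ?case unfolding ef.simps partial_iso_def map_tree_simps by blast
next
  case (Suc j)
  have "ef j T (map_tree h T) (insert (a, h a) R)" if "a \<in> verts T" for a
    using Suc.prems that by (intro Suc.IH) simp
  then show ?case by auto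
qed

lemma EV_map_tree:
  fixes h :: "'a::infinite \<Rightarrow> 'a"
  assumes "inj h" "rooted_tree T"
  shows "EV k (map_tree h T) = EV k T"
  using EV_eq_iff[OF assms(2) rooted_tree_map[OF assms]] ef_map_tree[OF assms(1)] root_verts[OF assms(2)]
  by auto

text \<open>The classes are those of trees over one fixed vertex type, so disjoint copies have to be
  made inside that type. An injective pairing exists because an infinite type is equipotent with its
  square; \<open>tag t\<close> embeds the copy with label \<open>t\<close>.\<close>

definition tag :: "'a::infinite \<Rightarrow> 'a \<Rightarrow> 'a" where
  "tag = (SOME f. inj (\<lambda>(a, b). f a b))"

lemma inj_tag: "inj (\<lambda>(a::'a::infinite, b). tag a b)"
proof -
  have "infinite (UNIV :: 'a set)" by (rule infinite_UNIV)
  from card_of_Times_same_infinite[OF this]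
  obtain f :: "'a \<times> 'a \<Rightarrow> 'a" where "bij_betw f (UNIV \<times> UNIV) UNIV"
    unfolding card_of_ordIso[symmetric] by blast
  then have "inj (\<lambda>(a, b). curry f a b)" by (simp add: bij_betw_def)
  then show ?thesis unfolding tag_def by (rule someI[of "\<lambda>f. inj (\<lambda>(a, b). f a b)"])
qed

lemma tag_eq_iff [simp]: "tag a b = tag a' b' \<longleftrightarrow> a = a' \<and> b = b'"
  using injD[OF inj_tag, of "(a, b)" "(a', b')"] by auto

lemma inj_tag': "inj (tag a)"
  by (auto simp: inj_def)

text \<open>The value \<open>undefined\<close> is reserved for the new root and must not belong to the index set \<open>I\<close>.\<close>

definition join :: "'a set \<Rightarrow> ('a \<Rightarrow> 'a rtree) \<Rightarrow> ('a::infinite) rtree" where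
  "join I F = \<lparr>verts = insert (tag undefined undefined) (\<Union>t\<in>I. tag t ` verts (F t)),
     root = tag undefined undefined,
     parent = (\<Union>t\<in>I. map_prod (tag t) (tag t) ` parent (F t)) \<union>
       (\<lambda>t. (tag t (root (F t)), tag undefined undefined)) ` I\<rparr>"

lemma join_simps [simp]:
  "verts (join I F) = insert (tag undefined undefined) (\<Union>t\<in>I. tag t ` verts (F t))"
  "root (join I F) = tag undefined undefined"
  by (simp_all add: join_def)

lemma join_parent_iff:
  assumes "undefined \<notin> I"
  shows "(tag t a, tag s b) \<in> parent (join I F) \<longleftrightarrow>
     t \<in> I \<and> (t = s \<and> (a, b) \<in> parent (F t) \<or> a = root (F t) \<and> s = undefined \<and> b = undefined)"
  using assms by (auto simp: join_def)

lemma join_parentE: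
  assumes "(x, y) \<in> parent (join I F)"
  obtains t a b where "t \<in> I" "x = tag t a" "y = tag t b" "(a, b) \<in> parent (F t)"
  | t where "t \<in> I" "x = tag t (root (F t))" "y = tag undefined undefined"
  using assms by (auto simp: join_def)

lemma join_rtrancl:
  assumes "undefined \<notin> I" "t \<in> I" "(a, b) \<in> (parent (F t))\<^sup>*"
  shows "(tag t a, tag t b) \<in> (parent (join I F))\<^sup>*"
  using assms(3)
  by (induction rule: rtrancl_induct)
    (use assms(1,2) in \<open>auto simp: join_parent_iff intro: rtrancl_into_rtrancl\<close>)

lemma join_rtranclD:
  assumes I: "undefined \<notin> I" and t: "t \<in> I" and x: "(x, tag t b) \<in> (parent (join I F))\<^sup>*"
  obtains a where "x = tag t a" "(a, b) \<in> (parent (F t))\<^sup>*"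
proof -
  from x have "\<exists>a. x = tag t a \<and> (a, b) \<in> (parent (F t))\<^sup>*"
  proof (induction rule: converse_rtrancl_induct)
    case base
    then show ?case by simp
  next
    case (step y z)
    then obtain a where a: "z = tag t a" "(a, b) \<in> (parent (F t))\<^sup>*" by blast
    from step(1) show ?case
    proof (cases rule: join_parentE)
      case (1 s c d)
      then show ?thesis using a by (auto intro: converse_rtrancl_into_rtrancl)
    next
      case (2 s)
      then show ?thesis using a I t by auto
    qed
  qed
  then show ?thesis using that by blast
qed

lemma rooted_tree_join:
  assumes I: "undefined \<notin> I" and F: "\<And>t. t \<in> I \<Longrightarrow> rooted_tree (F t)"
  shows "rooted_tree (join I F)"
proof -
  let ?r = "tag undefined undefined"
  have "parent (join I F) \<subseteq> verts (join I F) \<times> verts (join I F)"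
    using F parent_verts root_verts by (fastforce elim!: join_parentE)
  moreover have "(?r, w) \<notin> parent (join I F)" for w
    using I by (auto elim!: join_parentE)
  moreover have "\<exists>!w. (v, w) \<in> parent (join I F)" if "v \<in> verts (join I F) - {?r}" for v
  proof -
    from that have "v \<in> (\<Union>t\<in>I. tag t ` verts (F t))" by simp
    then obtain t a where ta: "t \<in> I" "a \<in> verts (F t)" "v = tag t a" by blast
    show ?thesis
    proof (cases "a = root (F t)")
      case True
      then show ?thesis
        using ta I root_no_parent[OF F[OF ta(1)]]
        by (intro ex1I[of _ ?r]) (auto simp: join_parent_iff elim!: join_parentE)
    next
      case False
      then obtain b where "(a, b) \<in> parent (F t)"
        using F[OF ta(1)] ta(2) unfolding rooted_tree_def by blast
      then show ?thesis
        using ta I False parent_unique[OF F[OF ta(1)]]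
        by (intro ex1I[of _ "tag t b"]) (auto simp: join_parent_iff elim!: join_parentE)
    qed
  qed
  moreover have "(v, ?r) \<in> (parent (join I F))\<^sup>*" if "v \<in> verts (join I F)" for v
  proof (cases "v = ?r")
    case False
    with that have "v \<in> (\<Union>t\<in>I. tag t ` verts (F t))" by simp
    then obtain t a where ta: "t \<in> I" "a \<in> verts (F t)" "v = tag t a" by blast
    then have "(a, root (F t)) \<in> (parent (F t))\<^sup>*"
      using F[OF ta(1)] unfolding rooted_tree_def by blast
    then have "(v, tag t (root (F t))) \<in> (parent (join I F))\<^sup>*"
      using join_rtrancl[OF I ta(1)] ta(3) by blast
    moreover have "(tag t (root (F t)), ?r) \<in> parent (join I F)"
      using I ta(1) by (simp add: join_parent_iff)
    ultimately show ?thesis by (rule rtrancl_into_rtrancl)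
  qed simp
  ultimately show ?thesis unfolding rooted_tree_def by simp
qed

lemma rootchildren_join:
  assumes I: "undefined \<notin> I"
  shows "rootchildren (join I F) = (\<lambda>t. tag t (root (F t))) ` I"
  using I by (auto simp: rootchild_iff join_parent_iff elim!: join_parentE)

lemma subtree_join:
  assumes I: "undefined \<notin> I" and F: "\<And>t. t \<in> I \<Longrightarrow> rooted_tree (F t)" and t: "t \<in> I"
  shows "subtree (join I F) (tag t (root (F t))) = map_tree (tag t) (F t)"
proof -
  have d: "descendants (join I F) (tag t (root (F t))) = tag t ` verts (F t)"
  proof (intro equalityI subsetI)
    fix x assume "x \<in> descendants (join I F) (tag t (root (F t)))"
    then have "(x, tag t (root (F t))) \<in> (parent (join I F))\<^sup>*" by (simp add: descendants_def)
    then obtain a where "x = tag t a" "(a, root (F t)) \<in> (parent (F t))\<^sup>*"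
      using join_rtranclD[OF I t] by blast
    moreover from this have "a \<in> verts (F t)"
      using descendants_subset[OF F[OF t] root_verts[OF F[OF t]]] by (auto simp: descendants_def)
    ultimately show "x \<in> tag t ` verts (F t)" by blast
  next
    fix x assume "x \<in> tag t ` verts (F t)"
    then obtain a where a: "x = tag t a" "a \<in> verts (F t)" by blast
    then have "(a, root (F t)) \<in> (parent (F t))\<^sup>*" using F[OF t] unfolding rooted_tree_def by blast
    then show "x \<in> descendants (join I F) (tag t (root (F t)))"
      using join_rtrancl[OF I t] a by (simp add: descendants_def)
  qed
  have "parent (join I F) \<inter> (tag t ` verts (F t) \<times> tag t ` verts (F t)) =
      map_prod (tag t) (tag t) ` parent (F t)"
    using I t parent_verts[OF F[OF t]]
    by (auto simp: join_parent_iff)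
  then show ?thesis by (simp add: subtree_def map_tree_def d)
qed

lemma trunc_card_image:
  assumes "inj_on f A"
  shows "trunc_card k (f ` A) = trunc_card k A"
  using assms by (auto simp: trunc_card_def card_image dest: finite_imageD)

lemma Gam_join:
  assumes I: "undefined \<notin> I" and F: "\<And>t. t \<in> I \<Longrightarrow> rooted_tree (F t)"
    and n: "\<And>c. c \<in> ehr_classes k \<Longrightarrow> trunc_card k {t \<in> I. EV k (F t) = c} = n c"
  shows "Gam k n = EV k (join I F)"
proof (rule Gam_eq)
  show "rooted_tree (join I F)" using I F by (rule rooted_tree_join)
next
  fix c :: "'a rtree set" assume c: "c \<in> ehr_classes k"
  have "EV k (subtree (join I F) (tag t (root (F t)))) = EV k (F t)" if "t \<in> I" for t
    using subtree_join[where F = F, OF I F that] EV_map_tree[OF inj_tag'[of t] F[OF that]] by simp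
  then have "{v \<in> rootchildren (join I F). EV k (subtree (join I F) v) = c} =
      (\<lambda>t. tag t (root (F t))) ` {t \<in> I. EV k (F t) = c}"
    unfolding rootchildren_join[OF I] by auto
  also have "trunc_card k \<dots> = trunc_card k {t \<in> I. EV k (F t) = c}"
    by (rule trunc_card_image) (auto simp: inj_on_def)
  finally show "trunc_card k {v \<in> rootchildren (join I F). EV k (subtree (join I F) v) = c} = n c"
    using n[OF c] by simp
qed

section \<open>Local equivalence\<close>

text \<open>The identity is included so that the \<open>n\<close>-th power relates vertices at
  distance at most \<open>n\<close>, not exactly \<open>n\<close>.\<close>

definition adj :: "'a rtree \<Rightarrow> ('a \<times> 'a) set" where
  "adj T = Id \<union> parent T \<union> (parent T)\<inverse>"

definition near :: "'a rtree \<Rightarrow> nat \<Rightarrow> 'a \<Rightarrow> 'a \<Rightarrow> bool" where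
  "near T n a b \<longleftrightarrow> (a, b) \<in> adj T ^^ n"

lemma adj_iff: "(a, b) \<in> adj T \<longleftrightarrow> a = b \<or> (a, b) \<in> parent T \<or> (b, a) \<in> parent T"
  by (auto simp: adj_def)

lemma near_0 [simp]: "near T 0 a b \<longleftrightarrow> a = b"
  by (simp add: near_def)

lemma near_SucI: "near T n a c \<Longrightarrow> (c, b) \<in> adj T \<Longrightarrow> near T (Suc n) a b"
  unfolding near_def by (rule relpow_Suc_I)

lemma near_SucE:
  assumes "near T (Suc n) a b"
  obtains c where "near T n a c" "(c, b) \<in> adj T"
  using assms unfolding near_def by (rule relpow_Suc_E)

lemma near_adj: "(a, b) \<in> adj T \<Longrightarrow> near T (Suc 0) a b"
  by (rule near_SucI[of _ 0]) simp_all

lemma near_trans: "near T m a b \<Longrightarrow> near T n b c \<Longrightarrow> near T (m + n) a c"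
  unfolding near_def relpow_add by (rule relcompI)

lemma near_refl: "near T n a a"
proof (induction n)
  case (Suc n)
  then show ?case by (rule near_SucI) (simp add: adj_iff)
qed simp

lemma near_mono: "m \<le> n \<Longrightarrow> near T m a b \<Longrightarrow> near T n a b"
  using near_trans[OF _ near_refl, of T m a b "n - m"] by simp

lemma near_sym: "near T n a b \<Longrightarrow> near T n b a"
proof (induction n arbitrary: b)
  case (Suc n)
  from Suc.prems obtain c where c: "near T n a c" "(c, b) \<in> adj T" by (rule near_SucE)
  then have "near T (Suc 0) b c" by (intro near_adj) (auto simp: adj_iff)
  then show ?case using near_trans[of T "Suc 0" b c n a] Suc.IH[OF c(1)] by simp
qed simp

lemma near_verts:
  assumes "rooted_tree T" "a \<in> verts T" "near T n a b"
  shows "b \<in> verts T"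
  using assms(3)
proof (induction n arbitrary: b)
  case 0
  then show ?case using assms(2) by simp
next
  case (Suc n)
  from Suc.prems obtain c where c: "near T n a c" "(c, b) \<in> adj T" by (rule near_SucE)
  then show ?case using Suc.IH[OF c(1)] parent_verts[OF assms(1)] by (auto simp: adj_iff)
qed

text \<open>A function that varies by at most 1 along each edge bounds distances from below. It is
  applied to the depth and, in \<open>near_join_diff\<close>, to a signed depth.\<close>

lemma near_Lipschitz:
  fixes f :: "'a \<Rightarrow> int"
  assumes f: "\<And>a b. (a, b) \<in> parent T \<Longrightarrow> \<bar>f a - f b\<bar> \<le> 1" and n: "near T n a b"
  shows "\<bar>f a - f b\<bar> \<le> int n"
  using n
proof (induction n arbitrary: b)
  case (Suc n)
  from Suc.prems obtain c where c: "near T n a c" "(c, b) \<in> adj T" by (rule near_SucE)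
  have "\<bar>f c - f b\<bar> \<le> 1" using c(2) f[of c b] f[of b c] by (auto simp: adj_iff)
  then show ?case using Suc.IH[OF c(1)] by simp
qed simp

text \<open>A map that sends each edge to an edge or to a single vertex does not increase
  distances.\<close>

lemma near_retract:
  assumes r: "\<And>a b. (a, b) \<in> parent T \<Longrightarrow> (r a, r b) \<in> adj T'" and n: "near T n a b"
  shows "near T' n (r a) (r b)"
  using n
proof (induction n arbitrary: b)
  case (Suc n)
  from Suc.prems obtain c where c: "near T n a c" "(c, b) \<in> adj T" by (rule near_SucE)
  have "(r c, r b) \<in> adj T'" using c(2) r[of c b] r[of b c] by (auto simp: adj_iff)
  with Suc.IH[OF c(1)] show ?case by (rule near_SucI)
qed simp

section \<open>Depth of a vertex\<close>

definition depth :: "'a rtree \<Rightarrow> 'a \<Rightarrow> nat" where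
  "depth T a = (THE n. (a, root T) \<in> parent T ^^ n)"

lemma depth_unique:
  assumes T: "rooted_tree T"
  shows "(a, root T) \<in> parent T ^^ m \<Longrightarrow> (a, root T) \<in> parent T ^^ n \<Longrightarrow> m = n"
proof (induction m arbitrary: a n)
  case 0
  then have "a = root T" by simp
  then show ?case
    using 0(2) root_no_parent[OF T] relpow_Suc_D2[of a "root T" _ "parent T"] by (cases n) auto
next
  case (Suc m)
  obtain b where b: "(a, b) \<in> parent T" "(b, root T) \<in> parent T ^^ m"
    using relpow_Suc_D2[OF Suc.prems(1)] by blast
  show ?case
  proof (cases n)
    case 0
    then show ?thesis using Suc.prems(2) b(1) root_no_parent[OF T] by simp
  next
    case n: (Suc n')
    obtain c where c: "(a, c) \<in> parent T" "(c, root T) \<in> parent T ^^ n'"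
      using relpow_Suc_D2 Suc.prems(2) n by metis
    have "c = b" using parent_unique[OF T c(1) b(1)] .
    then show ?thesis using Suc.IH[OF b(2)] c(2) n by simp
  qed
qed

lemma depth_eqI:
  assumes "rooted_tree T" "(a, root T) \<in> parent T ^^ n"
  shows "depth T a = n"
  unfolding depth_def
proof (rule the_equality)
  show "(a, root T) \<in> parent T ^^ n" by (rule assms)
  show "m = n" if "(a, root T) \<in> parent T ^^ m" for m using depth_unique[OF assms(1) that assms(2)] .
qed

lemma depth_relpow:
  assumes T: "rooted_tree T" and a: "a \<in> verts T"
  shows "(a, root T) \<in> parent T ^^ depth T a"
proof -
  have "(a, root T) \<in> (parent T)\<^sup>*" using assms unfolding rooted_tree_def by blast
  then obtain n where "(a, root T) \<in> parent T ^^ n" by (auto dest: rtrancl_imp_relpow)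
  then show ?thesis using depth_eqI[OF T] by simp
qed

lemma depth_root [simp]: "rooted_tree T \<Longrightarrow> depth T (root T) = 0"
  by (rule depth_eqI) simp_all

lemma depth_0_iff:
  assumes "rooted_tree T" "a \<in> verts T"
  shows "depth T a = 0 \<longleftrightarrow> a = root T"
  using depth_relpow[OF assms] assms(1) by auto

lemma depth_parent:
  assumes T: "rooted_tree T" and ab: "(a, b) \<in> parent T"
  shows "depth T a = Suc (depth T b)"
  using relpow_Suc_I2[OF ab depth_relpow[OF T parent_verts(2)[OF T ab]]] by (rule depth_eqI[OF T])

lemma depth_parent_relpow:
  assumes T: "rooted_tree T"
  shows "(a, b) \<in> parent T ^^ n \<Longrightarrow> depth T a = depth T b + n"
proof (induction n arbitrary: b)
  case (Suc n)
  from Suc.prems obtain c where c: "(a, c) \<in> parent T ^^ n" "(c, b) \<in> parent T"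
    by (rule relpow_Suc_E)
  then show ?case using Suc.IH[OF c(1)] depth_parent[OF T c(2)] by simp
qed simp

lemma near_depth:
  assumes T: "rooted_tree T" and n: "near T n a b"
  shows "depth T a \<le> depth T b + n" "depth T b \<le> depth T a + n"
proof -
  have "\<bar>int (depth T a) - int (depth T b)\<bar> \<le> int n"
    using n by (rule near_Lipschitz[rotated]) (simp add: depth_parent[OF T])
  then show "depth T a \<le> depth T b + n" "depth T b \<le> depth T a + n" by linarith+
qed

lemma near_relpow: "(a, b) \<in> parent T ^^ n \<Longrightarrow> near T n a b"
proof (induction n arbitrary: b)
  case (Suc n)
  from Suc.prems obtain c where c: "(a, c) \<in> parent T ^^ n" "(c, b) \<in> parent T"
    by (rule relpow_Suc_E)
  then show ?case by (intro near_SucI[OF Suc.IH[OF c(1)]]) (simp add: adj_iff)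
qed simp

lemma near_root_iff:
  assumes T: "rooted_tree T" and a: "a \<in> verts T"
  shows "near T n (root T) a \<longleftrightarrow> depth T a \<le> n"
proof
  assume "near T n (root T) a"
  then show "depth T a \<le> n" using near_depth(2)[OF T] T by fastforce
next
  assume "depth T a \<le> n"
  moreover have "near T (depth T a) (root T) a"
    using near_sym[OF near_relpow[OF depth_relpow[OF T a]]] .
  ultimately show "near T n (root T) a" by (rule near_mono)
qed

text \<open>With \<open>j + 1\<close> moves left, a new vertex has to be chosen within distance \<open>2\<^sup>j\<close> of an earlier choice.
  Winning positions whose vertices are more than \<open>2\<^sup>j\<close> apart can therefore be played side by side.\<close>

primrec lef :: "nat \<Rightarrow> 'a rtree \<Rightarrow> 'b rtree \<Rightarrow> ('a \<times> 'b) set \<Rightarrow> bool" where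
  "lef 0 T T' R \<longleftrightarrow> partial_iso T T' R"
| "lef (Suc j) T T' R \<longleftrightarrow>
     (\<forall>a b v. (a, b) \<in> R \<longrightarrow> near T (2 ^ j) a v \<longrightarrow>
        (\<exists>v'. near T' (2 ^ j) b v' \<and> lef j T T' (insert (v, v') R))) \<and>
     (\<forall>a b v'. (a, b) \<in> R \<longrightarrow> near T' (2 ^ j) b v' \<longrightarrow>
        (\<exists>v. near T (2 ^ j) a v \<and> lef j T T' (insert (v, v') R)))"

lemma lef_forth:
  assumes "lef (Suc j) T T' R" "(a, b) \<in> R" "near T (2 ^ j) a v"
  obtains v' where "near T' (2 ^ j) b v'" "lef j T T' (insert (v, v') R)"
  using assms by (simp; metis)

lemma lef_back:
  assumes "lef (Suc j) T T' R" "(a, b) \<in> R" "near T' (2 ^ j) b v'"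
  obtains v where "near T (2 ^ j) a v" "lef j T T' (insert (v, v') R)"
  using assms by (simp; metis)

lemma lef_SucI:
  assumes "\<And>a b v. (a, b) \<in> R \<Longrightarrow> near T (2 ^ j) a v \<Longrightarrow>
        \<exists>v'. near T' (2 ^ j) b v' \<and> lef j T T' (insert (v, v') R)"
    and "\<And>a b v'. (a, b) \<in> R \<Longrightarrow> near T' (2 ^ j) b v' \<Longrightarrow>
        \<exists>v. near T (2 ^ j) a v \<and> lef j T T' (insert (v, v') R)"
  shows "lef (Suc j) T T' R"
  using assms by simp

lemma lef_subset: "lef j T T' R \<Longrightarrow> R' \<subseteq> R \<Longrightarrow> lef j T T' R'"
proof (induction j arbitrary: R R')
  case 0
  then show ?case by (auto intro: partial_iso_subset)
next
  case (Suc j)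
  have sub: "insert p R' \<subseteq> insert p R" for p using Suc.prems(2) by blast
  show ?case
  proof (rule lef_SucI)
    fix a b v assume ab: "(a, b) \<in> R'" and v: "near T (2 ^ j) a v"
    obtain v' where "near T' (2 ^ j) b v'" "lef j T T' (insert (v, v') R)"
      using lef_forth[OF Suc.prems(1) subsetD[OF Suc.prems(2) ab] v] .
    then show "\<exists>v'. near T' (2 ^ j) b v' \<and> lef j T T' (insert (v, v') R')"
      using Suc.IH[OF _ sub] by blast
  next
    fix a b v' assume ab: "(a, b) \<in> R'" and v: "near T' (2 ^ j) b v'"
    obtain v where "near T (2 ^ j) a v" "lef j T T' (insert (v, v') R)"
      using lef_back[OF Suc.prems(1) subsetD[OF Suc.prems(2) ab] v] .
    then show "\<exists>v. near T (2 ^ j) a v \<and> lef j T T' (insert (v, v') R')"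
      using Suc.IH[OF _ sub] by blast
  qed
qed

lemma lef_converse: "lef j T T' R \<Longrightarrow> lef j T' T (R\<inverse>)"
proof (induction j arbitrary: R)
  case 0
  then show ?case by (auto intro: partial_iso_converse)
next
  case (Suc j)
  have ins: "insert (b, a) (R\<inverse>) = (insert (a, b) R)\<inverse>" for a b by blast
  show ?case
  proof (rule lef_SucI)
    fix a b v assume ab: "(a, b) \<in> R\<inverse>" and v: "near T' (2 ^ j) a v"
    obtain v' where "near T (2 ^ j) b v'" "lef j T T' (insert (v', v) R)"
      using lef_back[OF Suc.prems, of b a v] ab v by auto
    then show "\<exists>v'. near T (2 ^ j) b v' \<and> lef j T' T (insert (v, v') (R\<inverse>))"
      unfolding ins using Suc.IH by blast
  next
    fix a b v' assume ab: "(a, b) \<in> R\<inverse>" and v: "near T (2 ^ j) b v'"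
    obtain v where "near T' (2 ^ j) a v" "lef j T T' (insert (v', v) R)"
      using lef_forth[OF Suc.prems, of b a v'] ab v by auto
    then show "\<exists>v. near T' (2 ^ j) a v \<and> lef j T' T (insert (v, v') (R\<inverse>))"
      unfolding ins using Suc.IH by blast
  qed
qed

lemma lef_empty: "lef j T T' {}"
  by (cases j) (simp_all add: partial_iso_def)

text \<open>A move can be spent on a vertex chosen before, at distance 0. The empty position offers
  no such vertex and is treated separately.\<close>

lemma lef_Suc_imp: "lef (Suc j) T T' R \<Longrightarrow> lef j T T' R"
proof (cases "R = {}")
  case True
  then show ?thesis by (simp add: lef_empty)
next
  case False
  assume *: "lef (Suc j) T T' R"
  from False obtain a b where "(a, b) \<in> R" by fast
  from lef_forth[OF * this near_refl] obtain v' where "lef j T T' (insert (a, v') R)" .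
  then show ?thesis by (rule lef_subset) blast
qed

text \<open>Duplicator plays both strategies at once, using the answer in the middle tree as
  Spoiler's move in the other game.\<close>

lemma lef_compose: "lef j T1 T2 R \<Longrightarrow> lef j T2 T3 R' \<Longrightarrow> lef j T1 T3 (R O R')"
proof (induction j arbitrary: R R')
  case 0
  show ?case unfolding lef.simps partial_iso_def
  proof (intro allI impI)
    fix a c a' c' assume "(a, c) \<in> R O R'" "(a', c') \<in> R O R'"
    then obtain b b' where "(a, b) \<in> R" "(b, c) \<in> R'" "(a', b') \<in> R" "(b', c') \<in> R'" by blast
    then show "(a = a' \<longleftrightarrow> c = c') \<and> ((a, a') \<in> parent T1 \<longleftrightarrow> (c, c') \<in> parent T3)"
      using 0 partial_isoD[of T1 T2 R a b a' b'] partial_isoD[of T2 T3 R' b c b' c'] by simp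
  qed
next
  case (Suc j)
  have sub: "insert (a, c) (R O R') \<subseteq> insert (a, b) R O insert (b, c) R'" for a b c by blast
  show ?case
  proof (rule lef_SucI)
    fix a c v assume "(a, c) \<in> R O R'" and v: "near T1 (2 ^ j) a v"
    then obtain b where b: "(a, b) \<in> R" "(b, c) \<in> R'" by blast
    obtain v2 where v2: "near T2 (2 ^ j) b v2" "lef j T1 T2 (insert (v, v2) R)"
      using lef_forth[OF Suc.prems(1) b(1) v] .
    obtain v3 where v3: "near T3 (2 ^ j) c v3" "lef j T2 T3 (insert (v2, v3) R')"
      using lef_forth[OF Suc.prems(2) b(2) v2(1)] .
    show "\<exists>v'. near T3 (2 ^ j) c v' \<and> lef j T1 T3 (insert (v, v') (R O R'))"
      using v3(1) lef_subset[OF Suc.IH[OF v2(2) v3(2)] sub] by blast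
  next
    fix a c v3 assume "(a, c) \<in> R O R'" and v: "near T3 (2 ^ j) c v3"
    then obtain b where b: "(a, b) \<in> R" "(b, c) \<in> R'" by blast
    obtain v2 where v2: "near T2 (2 ^ j) b v2" "lef j T2 T3 (insert (v2, v3) R')"
      using lef_back[OF Suc.prems(2) b(2) v] .
    obtain v where v: "near T1 (2 ^ j) a v" "lef j T1 T2 (insert (v, v2) R)"
      using lef_back[OF Suc.prems(1) b(1) v2(1)] .
    show "\<exists>v. near T1 (2 ^ j) a v \<and> lef j T1 T3 (insert (v, v3) (R O R'))"
      using v(1) lef_subset[OF Suc.IH[OF v(2) v2(2)] sub] by blast
  qed
qed

lemma lef_compose_single:
  "lef j T1 T2 {(a, b)} \<Longrightarrow> lef j T2 T3 {(b, c)} \<Longrightarrow> lef j T1 T3 {(a, c)}"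
  using lef_subset[OF lef_compose[of j T1 T2 "{(a, b)}" T3 "{(b, c)}"], of "{(a, c)}"] by auto

text \<open>Vertices of depth at most \<open>2\<^sup>j\<close> are left out because their neighbourhood contains the root.\<close>

definition rich :: "nat \<Rightarrow> 'a rtree \<Rightarrow> bool" where
  "rich k T \<longleftrightarrow> (\<forall>(T1 :: 'a rtree) v j. rooted_tree T1 \<longrightarrow> v \<in> verts T1 \<longrightarrow> j < k \<longrightarrow>
     2 ^ j < depth T1 v \<longrightarrow>
     (\<exists>W\<subseteq>verts T. infinite W \<and> (\<forall>w\<in>W. 2 ^ j < depth T w \<and> lef j T1 T {(v, w)}) \<and>
       (\<forall>w\<in>W. \<forall>w'\<in>W. w \<noteq> w' \<longrightarrow> \<not> near T (2 ^ Suc j) w w')))"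

section \<open>Hanf-style play between rich trees\<close>

definition separated :: "'a rtree \<Rightarrow> 'b rtree \<Rightarrow> nat \<Rightarrow> ('a \<times> 'b) set \<Rightarrow> ('a \<times> 'b) set \<Rightarrow> bool" where
  "separated T T' n R Q \<longleftrightarrow> (\<forall>a b a' b'. (a, b) \<in> R \<longrightarrow> (a', b') \<in> Q \<longrightarrow>
     \<not> near T n a a' \<and> \<not> near T' n b b')"

lemma separated_sym: "separated T T' n R Q \<Longrightarrow> separated T T' n Q R"
  unfolding separated_def using near_sym by metis

lemma separated_mono: "m \<le> n \<Longrightarrow> separated T T' n R Q \<Longrightarrow> separated T T' m R Q"
  unfolding separated_def using near_mono by metis

lemma separated_converse: "separated T T' n R Q \<Longrightarrow> separated T' T n (R\<inverse>) (Q\<inverse>)"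
  unfolding separated_def by simp

text \<open>The invariant with \<open>j\<close> moves left. Clusters are local games played
  independently; keeping them more than \<open>2 ^ j\<close> apart in both trees excludes edges and
  equalities between them when the game ends.\<close>

definition clusters :: "nat \<Rightarrow> 'a rtree \<Rightarrow> 'b rtree \<Rightarrow> ('a \<times> 'b) set set \<Rightarrow> bool" where
  "clusters j T T' C \<longleftrightarrow> finite (\<Union>C) \<and> \<Union>C \<subseteq> verts T \<times> verts T' \<and> (root T, root T') \<in> \<Union>C \<and>
     (\<forall>R\<in>C. lef j T T' R) \<and> (\<forall>R\<in>C. \<forall>Q\<in>C. R \<noteq> Q \<longrightarrow> separated T T' (2 ^ j) R Q)"

lemma clusters_converse:
  assumes "clusters j T T' C"
  shows "clusters j T' T (converse ` C)"
proof -
  have U: "\<Union>(converse ` C) = (\<Union>C)\<inverse>" by auto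
  have lef: "lef j T T' R" if "R \<in> C" for R
    using assms that unfolding clusters_def by simp
  have sep: "separated T T' (2 ^ j) R Q" if "R \<in> C" "Q \<in> C" "R \<noteq> Q" for R Q
    using assms that unfolding clusters_def by simp
  have "lef j T' T R" if "R \<in> converse ` C" for R
    using that lef_converse[OF lef] by auto
  moreover have "separated T' T (2 ^ j) R Q"
    if RQ: "R \<in> converse ` C" "Q \<in> converse ` C" "R \<noteq> Q" for R Q
  proof -
    obtain R' Q' where "R = R'\<inverse>" "R' \<in> C" "Q = Q'\<inverse>" "Q' \<in> C" using RQ by auto
    moreover from this have "R' \<noteq> Q'" using RQ(3) by auto
    ultimately show ?thesis using separated_converse[OF sep] by simp
  qed
  ultimately show ?thesis
    using assms unfolding clusters_def U by auto
qed

lemma clusters_partial_iso: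
  assumes C: "clusters 0 T T' C"
  shows "partial_iso T T' (\<Union>C)"
  unfolding partial_iso_def
proof (intro allI impI)
  fix a b a' b' assume "(a, b) \<in> \<Union>C" "(a', b') \<in> \<Union>C"
  then obtain R Q where R: "R \<in> C" "(a, b) \<in> R" and Q: "Q \<in> C" "(a', b') \<in> Q" by blast
  show "(a = a' \<longleftrightarrow> b = b') \<and> ((a, a') \<in> parent T \<longleftrightarrow> (b, b') \<in> parent T')"
  proof (cases "R = Q")
    case True
    have "partial_iso T T' R" using C R unfolding clusters_def by simp
    then show ?thesis using partial_isoD[of T T' R a b a' b'] R Q True by simp
  next
    case False
    then have "separated T T' 1 R Q" using C R Q unfolding clusters_def by simp
    then have "\<not> near T 1 a a'" "\<not> near T' 1 b b'" using R Q unfolding separated_def by blast+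
    then have "(a, a') \<notin> adj T" "(b, b') \<notin> adj T'" using near_adj by fastforce+
    then show ?thesis by (simp add: adj_iff)
  qed
qed

text \<open>A move within \<open>2 ^ j\<close> of a cluster is a legal local move there, and the
  enlarged cluster stays more than \<open>2 ^ j\<close> from the others because they were more than
  \<open>2 ^ Suc j\<close> apart. A move far from all clusters opens a new one, answered by a vertex
  of the same local type that richness supplies far from everything chosen so far.\<close>

lemma clusters_step:
  fixes T T' :: "'a rtree"
  assumes T: "rooted_tree T" and T': "rooted_tree T'" and rich: "rich k T'" and j: "j < k"
    and C: "clusters (Suc j) T T' C" and v: "v \<in> verts T"
  shows "\<exists>v'\<in>verts T'. \<exists>C'. clusters j T T' C' \<and> insert (v, v') (\<Union>C) \<subseteq> \<Union>C'"
proof -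
  have fin: "finite (\<Union>C)" and sub: "\<Union>C \<subseteq> verts T \<times> verts T'"
    and root: "(root T, root T') \<in> \<Union>C"
    using C unfolding clusters_def by auto
  have lefS: "lef (Suc j) T T' R" if "R \<in> C" for R using C that unfolding clusters_def by blast
  have sepS: "separated T T' (2 ^ Suc j) R Q" if "R \<in> C" "Q \<in> C" "R \<noteq> Q" for R Q
    using C that unfolding clusters_def by blast
  have sep: "separated T T' (2 ^ j) R Q" if "R \<in> C" "Q \<in> C" "R \<noteq> Q" for R Q
    using separated_mono[OF _ sepS[OF that]] by simp
  show ?thesis
  proof (cases "\<exists>R a b. R \<in> C \<and> (a, b) \<in> R \<and> near T (2 ^ j) a v")
    case True
    then obtain R a b where R: "R \<in> C" "(a, b) \<in> R" and a: "near T (2 ^ j) a v" by blast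
    obtain v' where v': "near T' (2 ^ j) b v'" and lef: "lef j T T' (insert (v, v') R)"
      using lef_forth[OF lefS[OF R(1)] R(2) a] .
    have "b \<in> verts T'" using sub R by blast
    then have v'T: "v' \<in> verts T'" using near_verts[OF T' _ v'] by blast
    define C' where "C' = insert (insert (v, v') R) (C - {R})"
    have UC': "\<Union>C' = insert (v, v') (\<Union>C)" using R(1) by (auto simp: C'_def)
    have sep': "separated T T' (2 ^ j) (insert (v, v') R) Q" if Q: "Q \<in> C" "Q \<noteq> R" for Q
      unfolding separated_def
    proof (intro allI impI)
      fix p q a' b' assume pq: "(p, q) \<in> insert (v, v') R" and Q': "(a', b') \<in> Q"
      show "\<not> near T (2 ^ j) p a' \<and> \<not> near T' (2 ^ j) q b'"
      proof (cases "(p, q) \<in> R")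
        case True
        then show ?thesis using sep[OF R(1) Q(1)] Q(2) Q' unfolding separated_def by blast
      next
        case False
        then have pq: "p = v" "q = v'" using pq by auto
        have "\<not> near T (2 ^ Suc j) a a'" "\<not> near T' (2 ^ Suc j) b b'"
          using sepS[OF R(1) Q(1)] Q(2) Q' R(2) unfolding separated_def by blast+
        then show ?thesis
          using near_trans[OF a, of "2 ^ j" a'] near_trans[OF v', of "2 ^ j" b']
          unfolding pq by (auto simp: mult_2)
      qed
    qed
    have "separated T T' (2 ^ j) P Q" if PQ: "P \<in> C'" "Q \<in> C'" "P \<noteq> Q" for P Q
    proof -
      consider "P = insert (v, v') R" "Q \<in> C" "Q \<noteq> R" | "Q = insert (v, v') R" "P \<in> C" "P \<noteq> R"
        | "P \<in> C" "Q \<in> C" using PQ unfolding C'_def by blast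
      then show ?thesis
        by cases (simp add: sep', simp add: separated_sym[OF sep'], simp add: sep PQ(3))
    qed
    moreover have "lef j T T' Q" if "Q \<in> C'" for Q
      using that lef lef_Suc_imp[OF lefS] unfolding C'_def by blast
    ultimately have "clusters j T T' C'"
      unfolding clusters_def UC' using fin sub root v v'T by simp
    then show ?thesis using v'T UC' by blast
  next
    case far: False
    \<comment> \<open>The pair of roots belongs to the position from the start, so a far move has
      the depth that \<open>rich\<close> asks for.\<close>
    then have "\<not> near T (2 ^ j) (root T) v" using root by blast
    then have "2 ^ j < depth T v" using near_root_iff[OF T v] by simp
    then have "\<exists>W\<subseteq>verts T'. infinite W \<and> (\<forall>w\<in>W. 2 ^ j < depth T' w \<and> lef j T T' {(v, w)}) \<and>
       (\<forall>w\<in>W. \<forall>w'\<in>W. w \<noteq> w' \<longrightarrow> \<not> near T' (2 ^ Suc j) w w')"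
      using rich T v j unfolding rich_def by simp
    then obtain W where W: "W \<subseteq> verts T'" "infinite W"
      and Wlef: "\<forall>w\<in>W. 2 ^ j < depth T' w \<and> lef j T T' {(v, w)}"
      and Wsep: "\<forall>w\<in>W. \<forall>w'\<in>W. w \<noteq> w' \<longrightarrow> \<not> near T' (2 ^ Suc j) w w'"
      by (elim exE conjE) (rule that)
    \<comment> \<open>Two members of \<open>W\<close> within \<open>2 ^ j\<close> of the same
      \<open>b\<close> would be within \<open>2 ^ Suc j\<close> of each other. So each of the
      finitely many earlier vertices rules out at most one member of the infinite set
      \<open>W\<close>.\<close>
    have "\<exists>w\<in>W. \<forall>b\<in>Range (\<Union>C). \<not> near T' (2 ^ j) b w"
    proof (rule ccontr)
      assume "\<not> ?thesis"
      then have "\<forall>w\<in>W. \<exists>b\<in>Range (\<Union>C). near T' (2 ^ j) b w" by simp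
      then have "W \<subseteq> (\<Union>b\<in>Range (\<Union>C). {w\<in>W. near T' (2 ^ j) b w})" by fast
      moreover have "finite {w\<in>W. near T' (2 ^ j) b w}" for b
      proof (cases "\<exists>w\<in>W. near T' (2 ^ j) b w")
        case True
        then obtain w where w: "w \<in> W" "near T' (2 ^ j) b w" by blast
        have "w' = w" if w': "w' \<in> W" "near T' (2 ^ j) b w'" for w'
          using Wsep[rule_format, OF w(1) w'(1)] near_trans[OF near_sym[OF w(2)] w'(2)] by (auto simp: mult_2)
        then have "{w\<in>W. near T' (2 ^ j) b w} \<subseteq> {w}" by blast
        then show ?thesis by (rule finite_subset) simp
      next
        case False
        then have "{w\<in>W. near T' (2 ^ j) b w} = {}" by blast
        then show ?thesis by (simp only: finite.emptyI)
      qed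
      moreover have "finite (Range (\<Union>C))" using fin by (rule finite_Range)
      ultimately show False using W(2) finite_subset by blast
    qed
    then obtain w where w: "w \<in> W" and wfar: "\<forall>b\<in>Range (\<Union>C). \<not> near T' (2 ^ j) b w" by blast
    define C' where "C' = insert {(v, w)} C"
    have UC': "\<Union>C' = insert (v, w) (\<Union>C)" by (simp add: C'_def)
    have sep': "separated T T' (2 ^ j) Q {(v, w)}" if Q: "Q \<in> C" for Q
      unfolding separated_def
    proof (intro allI impI)
      fix a b p q assume ab: "(a, b) \<in> Q" and "(p, q) \<in> {(v, w)}"
      then have pq: "p = v" "q = w" by auto
      have "b \<in> Range (\<Union>C)" using ab Q by blast
      then show "\<not> near T (2 ^ j) a p \<and> \<not> near T' (2 ^ j) b q"
        unfolding pq using wfar far Q ab by blast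
    qed
    have "separated T T' (2 ^ j) P Q" if PQ: "P \<in> C'" "Q \<in> C'" "P \<noteq> Q" for P Q
    proof -
      consider "P = {(v, w)}" "Q \<in> C" | "Q = {(v, w)}" "P \<in> C" | "P \<in> C" "Q \<in> C"
        using PQ unfolding C'_def by blast
      then show ?thesis
        by cases (simp add: separated_sym[OF sep'], simp add: sep', simp add: sep PQ(3))
    qed
    moreover have "lef j T T' Q" if "Q \<in> C'" for Q
      using that Wlef w lef_Suc_imp[OF lefS] unfolding C'_def by blast
    ultimately have "clusters j T T' C'"
      unfolding clusters_def UC' using fin sub root v w W(1) by auto
    then show ?thesis using w W(1) UC' by blast
  qed
qed

text \<open>The game starts with one cluster, the pair of roots. Both trees have to be rich because
  Spoiler may play in either; moves in the second tree are handled by the converse clusters.\<close>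

lemma EV_eq_if_rich:
  fixes T T' :: "'a::infinite rtree"
  assumes T: "rooted_tree T" and T': "rooted_tree T'" and rich: "rich k T" "rich k T'"
    and root: "lef k T T' {(root T, root T')}"
  shows "EV k T = EV k T'"
proof -
  have "ef j T T' (\<Union>C)" if "j \<le> k" "clusters j T T' C" for j C
    using that
  proof (induction j arbitrary: C)
    case 0
    then show ?case using clusters_partial_iso by simp
  next
    case (Suc j)
    then have j: "j < k" and IH: "\<And>C. clusters j T T' C \<Longrightarrow> ef j T T' (\<Union>C)" by simp_all
    have "\<exists>v'\<in>verts T'. ef j T T' (insert (v, v') (\<Union>C))" if vT: "v \<in> verts T" for v
    proof -
      obtain v' C' where v': "v' \<in> verts T'" and C': "clusters j T T' C'"
        and sub: "insert (v, v') (\<Union>C) \<subseteq> \<Union>C'"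
        using clusters_step[OF T T' rich(2) j Suc.prems(2) vT] by blast
      then show ?thesis using ef_subset[OF IH[OF C'] sub] by blast
    qed
    moreover have "\<exists>v\<in>verts T. ef j T T' (insert (v, v') (\<Union>C))" if v': "v' \<in> verts T'" for v'
    proof -
      obtain v C' where v: "v \<in> verts T" and C': "clusters j T' T C'"
        and sub: "insert (v', v) (\<Union>(converse ` C)) \<subseteq> \<Union>C'"
        using clusters_step[OF T' T rich(1) j clusters_converse[OF Suc.prems(2)] v'] by blast
      have "ef j T T' (\<Union>(converse ` C'))" using IH[OF clusters_converse[OF C']] .
      moreover have "insert (v, v') (\<Union>C) \<subseteq> \<Union>(converse ` C')"
      proof -
        have "\<Union>(converse ` C') = (\<Union>C')\<inverse>" "\<Union>(converse ` C) = (\<Union>C)\<inverse>" by auto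
        then show ?thesis using sub by auto
      qed
      ultimately show ?thesis using v ef_subset by blast
    qed
    ultimately show ?case by simp
  qed
  moreover have "clusters k T T' {{(root T, root T')}}"
    using root root_verts[OF T] root_verts[OF T'] by (simp add: clusters_def)
  ultimately have "ef k T T' {(root T, root T')}" by fastforce
  then show ?thesis using EV_eq_iff[OF T T'] by simp
qed

text \<open>Here \<open>h\<close> is an isomorphism of \<open>V\<close> onto its image, and
  \<open>U\<close> is an interior: all neighbours of \<open>U\<close> lie in \<open>V\<close>, and
  all neighbours of \<open>h\<close> U\<open>in\<close>h \<open>V\<close>. Local moves of lengths
  \<open>2 ^ (j - 1)\<close>, ..., 1 reach distances of at most \<open>2 ^ j - 1\<close> from
  \<open>X\<close>, so the game never leaves \<open>U\<close> and Duplicator answers with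
  \<open>h\<close>.\<close>

lemma lef_local:
  assumes inj: "inj_on h V"
    and par: "\<And>a b. a \<in> V \<Longrightarrow> b \<in> V \<Longrightarrow> (a, b) \<in> parent T \<longleftrightarrow> (h a, h b) \<in> parent T'"
    and int1: "\<And>a b. a \<in> U \<Longrightarrow> (a, b) \<in> adj T \<Longrightarrow> b \<in> V"
    and int2: "\<And>a y. a \<in> U \<Longrightarrow> (h a, y) \<in> adj T' \<Longrightarrow> y \<in> h ` V"
    and X: "\<And>a n c. a \<in> X \<Longrightarrow> n < 2 ^ j \<Longrightarrow> near T n a c \<Longrightarrow> c \<in> U"
  shows "lef j T T' ((\<lambda>a. (a, h a)) ` X)"
proof -
  have UV: "U \<subseteq> V" using int1 by (auto simp: adj_iff)
  have adj: "(h a, h b) \<in> adj T' \<longleftrightarrow> (a, b) \<in> adj T" if "a \<in> V" "b \<in> V" for a b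
    using that par inj_on_eq_iff[OF inj] by (simp add: adj_iff)
  \<comment> \<open>Walks are transported by \<open>h\<close> as long as all vertices but the last
    are interior; \<open>lift\<close> is the same for walks in the image.\<close>
  have push: "v \<in> V \<and> near T' n (h a) (h v)"
    if "near T n a v" "a \<in> V" "\<And>m c. m < n \<Longrightarrow> near T m a c \<Longrightarrow> c \<in> U" for a v n
    using that
  proof (induction n arbitrary: v)
    case (Suc n)
    from Suc.prems(1) obtain c where c: "near T n a c" "(c, v) \<in> adj T" by (rule near_SucE)
    have cU: "c \<in> U" using Suc.prems(3)[of n c] c by simp
    then have "v \<in> V" using int1 c by blast
    moreover have "near T' n (h a) (h c)"
    proof (rule conjunct2[OF Suc.IH[OF c(1) Suc.prems(2)]])
      show "d \<in> U" if "m < n" "near T m a d" for m d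
        using Suc.prems(3)[of m d] that by simp
    qed
    moreover have "(h c, h v) \<in> adj T'" using adj[of c v] c(2) cU UV \<open>v \<in> V\<close> by blast
    ultimately show ?case using near_SucI by metis
  qed simp
  have lift: "\<exists>v\<in>V. y = h v \<and> near T n a v"
    if "near T' n (h a) y" "a \<in> V" "\<And>m c. m < n \<Longrightarrow> near T m a c \<Longrightarrow> c \<in> U" for a y n
    using that
  proof (induction n arbitrary: y)
    case (Suc n)
    from Suc.prems(1) obtain z where z: "near T' n (h a) z" "(z, y) \<in> adj T'" by (rule near_SucE)
    have "\<exists>v\<in>V. z = h v \<and> near T n a v"
    proof (rule Suc.IH[OF z(1) Suc.prems(2)])
      show "d \<in> U" if "m < n" "near T m a d" for m d
        using Suc.prems(3)[of m d] that by simp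
    qed
    then obtain c where c: "c \<in> V" "z = h c" "near T n a c" by blast
    have cU: "c \<in> U" using Suc.prems(3)[of n c] c by simp
    obtain v where v: "v \<in> V" "y = h v" using int2[OF cU] z(2) c(2) by blast
    have "(c, v) \<in> adj T" using adj[OF c(1) v(1)] z(2) c(2) v(2) by simp
    then show ?case using v near_SucI[OF c(3)] by blast
  qed auto
  show ?thesis using X
  proof (induction j arbitrary: X)
    case 0
    have XV: "X \<subseteq> V" using 0[of _ 0] UV by auto
    show ?case unfolding lef.simps partial_iso_def
    proof (intro allI impI)
      fix a b a' b' assume "(a, b) \<in> (\<lambda>a. (a, h a)) ` X" "(a', b') \<in> (\<lambda>a. (a, h a)) ` X"
      then have "b = h a" "b' = h a'" "a \<in> V" "a' \<in> V" using XV by auto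
      then show "(a = a' \<longleftrightarrow> b = b') \<and> ((a, a') \<in> parent T \<longleftrightarrow> (b, b') \<in> parent T')"
        using par inj_on_eq_iff[OF inj] by simp
    qed
  next
    case (Suc j)
    have U: "c \<in> U" if "a \<in> X" "m < 2 ^ j" "near T m a c" for a m c
      by (rule Suc.prems[OF that(1) _ that(3)]) (use that(2) in simp)
    have XV: "X \<subseteq> V" using Suc.prems[of _ 0] UV by auto
    have step: "lef j T T' (insert (v, h v) ((\<lambda>a. (a, h a)) ` X))"
      if a: "a \<in> X" "near T (2 ^ j) a v" for a v
    proof -
      have "c \<in> U" if "x \<in> insert v X" "m < 2 ^ j" "near T m x c" for x m c
      proof (cases "x \<in> X")
        case True
        then show ?thesis using U that by blast
      next
        case False
        then have "near T (2 ^ j + m) a c" using that near_trans[OF a(2)] by simp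
        moreover have "2 ^ j + m < 2 ^ Suc j" using that(2) by simp
        ultimately show ?thesis using Suc.prems[OF a(1)] by blast
      qed
      then have "lef j T T' ((\<lambda>a. (a, h a)) ` insert v X)" by (rule Suc.IH)
      then show ?thesis by simp
    qed
    show ?case
    proof (rule lef_SucI)
      fix a b v assume "(a, b) \<in> (\<lambda>a. (a, h a)) ` X" and v: "near T (2 ^ j) a v"
      then have ab: "a \<in> X" "b = h a" by auto
      have "near T' (2 ^ j) (h a) (h v)" using push[OF v] ab XV U by blast
      then show "\<exists>v'. near T' (2 ^ j) b v' \<and> lef j T T' (insert (v, v') ((\<lambda>a. (a, h a)) ` X))"
        using step[OF ab(1) v] ab(2) by blast
    next
      fix a b v' assume "(a, b) \<in> (\<lambda>a. (a, h a)) ` X" and v: "near T' (2 ^ j) b v'"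
      then have ab: "a \<in> X" "b = h a" by auto
      obtain v where "v' = h v" "near T (2 ^ j) a v" using lift[of "2 ^ j" a v'] v ab XV U by blast
      then show "\<exists>v. near T (2 ^ j) a v \<and> lef j T T' (insert (v, v') ((\<lambda>a. (a, h a)) ` X))"
        using step[OF ab(1)] by blast
    qed
  qed
qed

text \<open>There are finitely many local types of lists of \<open>n\<close> vertices. At level 0
  the type is the pattern of equalities and edges; at level \<open>Suc j\<close> it is the set of
  pairs of a position \<open>i\<close> and a type of the list extended by a vertex near its
  \<open>i\<close>-th entry. The bound \<open>N\<close> keeps that set inside a finite power set,
  which is then coded by numbers.\<close>

lemma lef_finite_index:
  "\<exists>(f :: 'a rtree \<Rightarrow> 'a list \<Rightarrow> nat) N. (\<forall>T as. f T as < N) \<and>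
     (\<forall>T T' as bs. length as = n \<longrightarrow> length bs = n \<longrightarrow> f T as = f T' bs \<longrightarrow> lef j T T' (set (zip as bs)))"
proof (induction j arbitrary: n)
  case 0
  define E :: "'a rtree \<Rightarrow> 'a list \<Rightarrow> (nat \<times> nat) set \<times> (nat \<times> nat) set" where
    "E = (\<lambda>T as. ({(i, l). i < n \<and> l < n \<and> as ! i = as ! l},
      {(i, l). i < n \<and> l < n \<and> (as ! i, as ! l) \<in> parent T}))"
  define P where "P = Pow ({..<n} \<times> {..<n}) \<times> Pow ({..<n} \<times> {..<n})"
  have "finite P" by (simp add: P_def)
  note seg = finite_imp_inj_to_nat_seg[OF this]
  obtain e N where e: "e ` P = {i::nat. i < N}" "inj_on e P"
    using seg by (elim exE conjE) (rule that)
  have EP: "E T as \<in> P" for T as by (auto simp: E_def P_def)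
  have "e (E T as) < N" for T as using e(1) EP by blast
  moreover have "partial_iso T T' (set (zip as bs))"
    if len: "length as = n" "length bs = n" and "e (E T as) = e (E T' bs)" for T T' as bs
  proof -
    have eq: "E T as = E T' bs" using that(3) inj_onD[OF e(2)] EP by blast
    have 1: "as ! i = as ! l \<longleftrightarrow> bs ! i = bs ! l" if "i < n" "l < n" for i l
      using arg_cong[OF eq, of "\<lambda>p. (i, l) \<in> fst p"] that by (simp add: E_def)
    have 2: "(as ! i, as ! l) \<in> parent T \<longleftrightarrow> (bs ! i, bs ! l) \<in> parent T'" if "i < n" "l < n" for i l
      using arg_cong[OF eq, of "\<lambda>p. (i, l) \<in> snd p"] that by (simp add: E_def)
    show ?thesis
      unfolding partial_iso_def
    proof (intro allI impI)
      fix a b a' b' assume "(a, b) \<in> set (zip as bs)" "(a', b') \<in> set (zip as bs)"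
      then obtain i l where "i < n" "a = as ! i" "b = bs ! i" "l < n" "a' = as ! l" "b' = bs ! l"
        using len by (auto simp: in_set_zip)
      then show "(a = a' \<longleftrightarrow> b = b') \<and> ((a, a') \<in> parent T \<longleftrightarrow> (b, b') \<in> parent T')"
        using 1[of i l] 2[of i l] by simp
    qed
  qed
  ultimately show ?case by (intro exI[of _ "\<lambda>T as. e (E T as)"] exI[of _ N]) simp
next
  case (Suc j)
  obtain f N where f: "\<And>(T :: 'a rtree) as. f T as < (N::nat)"
    and lef: "\<And>(T :: 'a rtree) (T' :: 'a rtree) as bs. length as = Suc n \<Longrightarrow> length bs = Suc n \<Longrightarrow>
      f T as = f T' bs \<Longrightarrow> lef j T T' (set (zip as bs))"
    using Suc[of "Suc n"] by metis
  define E :: "'a rtree \<Rightarrow> 'a list \<Rightarrow> (nat \<times> nat) set" where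
    "E = (\<lambda>T as. {(i, f T (v # as)) |i v. i < n \<and> near T (2 ^ j) (as ! i) v})"
  define P where "P = Pow ({..<n} \<times> {..<N})"
  have "finite P" by (simp add: P_def)
  note seg = finite_imp_inj_to_nat_seg[OF this]
  obtain e M where e: "e ` P = {i::nat. i < M}" "inj_on e P"
    using seg by (elim exE conjE) (rule that)
  have EP: "E T as \<in> P" for T as using f by (auto simp: E_def P_def)
  have "e (E T as) < M" for T as using e(1) EP by blast
  moreover have "lef (Suc j) T T' (set (zip as bs))"
    if len: "length as = n" "length bs = n" and "e (E T as) = e (E T' bs)" for T T' as bs
  proof -
    have eq: "E T as = E T' bs" using that(3) inj_onD[OF e(2)] EP by blast
    show ?thesis
    proof (rule lef_SucI)
      fix a b v assume "(a, b) \<in> set (zip as bs)" and v: "near T (2 ^ j) a v"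
      then obtain i where i: "i < n" "a = as ! i" "b = bs ! i" using len by (auto simp: in_set_zip)
      have "(i, f T (v # as)) \<in> E T as" using i v by (auto simp: E_def)
      then have "(i, f T (v # as)) \<in> E T' bs" using eq by simp
      then obtain v' where "near T' (2 ^ j) b v'" "f T (v # as) = f T' (v' # bs)"
        using i by (auto simp: E_def)
      then show "\<exists>v'. near T' (2 ^ j) b v' \<and> lef j T T' (insert (v, v') (set (zip as bs)))"
        using lef[of "v # as" "v' # bs" T T'] len by auto
    next
      fix a b v' assume "(a, b) \<in> set (zip as bs)" and v: "near T' (2 ^ j) b v'"
      then obtain i where i: "i < n" "a = as ! i" "b = bs ! i" using len by (auto simp: in_set_zip)
      have "(i, f T' (v' # bs)) \<in> E T' bs" using i v by (auto simp: E_def)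
      then have "(i, f T' (v' # bs)) \<in> E T as" using eq by simp
      then obtain v where "near T (2 ^ j) a v" "f T (v # as) = f T' (v' # bs)"
        using i by (auto simp: E_def)
      then show "\<exists>v. near T (2 ^ j) a v \<and> lef j T T' (insert (v, v') (set (zip as bs)))"
        using lef[of "v # as" "v' # bs" T T'] len by auto
    qed
  qed
  ultimately show ?case by (intro exI[of _ "\<lambda>T as. e (E T as)"] exI[of _ M]) simp
qed

section \<open>Rich trees\<close>

locale tree_family =
  fixes I :: "'a::infinite set" and F :: "'a \<Rightarrow> 'a rtree"
  assumes undef: "undefined \<notin> I" and trees: "\<And>t. t \<in> I \<Longrightarrow> rooted_tree (F t)"
begin

lemma rooted: "rooted_tree (join I F)"
  using undef trees by (rule rooted_tree_join)

lemma parent_iff: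
  "(tag t a, tag s b) \<in> parent (join I F) \<longleftrightarrow>
     t \<in> I \<and> (t = s \<and> (a, b) \<in> parent (F t) \<or> a = root (F t) \<and> s = undefined \<and> b = undefined)"
  by (rule join_parent_iff[OF undef])

lemma join_relpow:
  assumes t: "t \<in> I"
  shows "(a, b) \<in> parent (F t) ^^ n \<Longrightarrow> (tag t a, tag t b) \<in> parent (join I F) ^^ n"
proof (induction n arbitrary: b)
  case (Suc n)
  from Suc.prems obtain c where c: "(a, c) \<in> parent (F t) ^^ n" "(c, b) \<in> parent (F t)"
    by (rule relpow_Suc_E)
  show ?case
    by (rule relpow_Suc_I[OF Suc.IH[OF c(1)]]) (simp add: parent_iff t c(2))
qed simp

lemma depth_join:
  assumes t: "t \<in> I" and a: "a \<in> verts (F t)"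
  shows "depth (join I F) (tag t a) = Suc (depth (F t) a)"
proof (rule depth_eqI[OF rooted])
  have "(tag t a, tag t (root (F t))) \<in> parent (join I F) ^^ depth (F t) a"
    using depth_relpow[OF trees[OF t] a] by (rule join_relpow[OF t])
  then show "(tag t a, root (join I F)) \<in> parent (join I F) ^^ Suc (depth (F t) a)"
    by (rule relpow_Suc_I) (simp add: parent_iff t)
qed

lemma join_adj:
  assumes t: "t \<in> I" and a: "a \<in> verts (F t)" "a \<noteq> root (F t)"
    and y: "(tag t a, y) \<in> adj (join I F)"
  shows "y \<in> tag t ` verts (F t)"
proof -
  consider "y = tag t a" | "(tag t a, y) \<in> parent (join I F)" | "(y, tag t a) \<in> parent (join I F)"
    using y unfolding adj_iff by blast
  then show ?thesis
  proof cases
    case 1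
    then show ?thesis using a by simp
  next
    case 2
    then show ?thesis
      by (rule join_parentE) (use a parent_verts[OF trees[OF t]] in auto)
  next
    case 3
    then show ?thesis
      by (rule join_parentE) (use t undef parent_verts[OF trees[OF t]] in auto)
  qed
qed

text \<open>The root of \<open>F t\<close> is the only vertex of the copy that acquires a new
  neighbour, and a local game starting at depth at least \<open>2 ^ j\<close> does not reach
  it.\<close>

lemma lef_join:
  assumes t: "t \<in> I" and a: "a \<in> verts (F t)" "2 ^ j \<le> depth (F t) a"
  shows "lef j (F t) (join I F) {(a, tag t a)}"
proof -
  note T = trees[OF t]
  have "lef j (F t) (join I F) ((\<lambda>a. (a, tag t a)) ` {a})"
  proof (rule lef_local[where V = "verts (F t)" and U = "verts (F t) - {root (F t)}"])
    show "inj_on (tag t) (verts (F t))" by (rule inj_on_subset[OF inj_tag']) simp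
    show "(b, c) \<in> parent (F t) \<longleftrightarrow> (tag t b, tag t c) \<in> parent (join I F)" for b c
      using t undef by (auto simp: parent_iff)
    show "c \<in> verts (F t)" if "b \<in> verts (F t) - {root (F t)}" "(b, c) \<in> adj (F t)" for b c
      using that parent_verts[OF T] by (auto simp: adj_iff)
    show "y \<in> tag t ` verts (F t)"
      if "b \<in> verts (F t) - {root (F t)}" "(tag t b, y) \<in> adj (join I F)" for b y
      using join_adj[OF t] that by blast
    show "c \<in> verts (F t) - {root (F t)}" if "x \<in> {a}" "n < 2 ^ j" "near (F t) n x c" for x n c
    proof -
      have n: "near (F t) n a c" using that by simp
      have "depth (F t) c \<noteq> 0" using near_depth(1)[OF T n] a(2) that(2) by simp
      then show ?thesis using near_verts[OF T a(1) n] T by auto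
    qed
  qed
  then show ?thesis by simp
qed

text \<open>Collapsing everything outside the copy to the root of \<open>F t\<close> is a retraction
  onto it, so the join has no shortcuts between vertices of one component.\<close>

lemma near_join:
  assumes t: "t \<in> I" and ab: "a \<in> verts (F t)" "b \<in> verts (F t)"
    and n: "near (join I F) n (tag t a) (tag t b)"
  shows "near (F t) n a b"
proof -
  define r where "r x = (if x \<in> tag t ` verts (F t) then inv (tag t) x else root (F t))" for x
  have r_in: "r (tag t c) = c" if "c \<in> verts (F t)" for c
    using that by (simp add: r_def inv_f_f[OF inj_tag'])
  have r_out: "r (tag s c) = root (F t)" if "s \<noteq> t" for s c
    using that by (auto simp: r_def)
  have "(r x, r y) \<in> adj (F t)" if "(x, y) \<in> parent (join I F)" for x y
    using that
  proof (rule join_parentE)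
    fix s c d assume s: "s \<in> I" "x = tag s c" "y = tag s d" "(c, d) \<in> parent (F s)"
    show ?thesis
    proof (cases "s = t")
      case True
      then show ?thesis using s parent_verts[OF trees[OF t], of c d] by (simp add: r_in adj_iff)
    next
      case False
      then show ?thesis using s by (simp add: r_out adj_iff)
    qed
  next
    fix s assume s: "s \<in> I" "x = tag s (root (F s))" "y = tag undefined undefined"
    have "r y = root (F t)" using s t undef by (intro trans[OF _ r_out]) auto
    moreover have "r x = root (F t)"
      using s r_in[OF root_verts[OF trees[OF t]]] r_out by (cases "s = t") auto
    ultimately show ?thesis by (simp add: adj_iff)
  qed
  from near_retract[of "join I F" r, OF this n] show ?thesis by (simp add: r_in ab)
qed

text \<open>A path between different components passes through the new root. This is expressed by
  the depth taken with a negative sign on the component \<open>t\<close>, which still varies by at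
  most 1 along every edge.\<close>

lemma near_join_diff:
  assumes t: "t \<in> I" "s \<in> I" "t \<noteq> s" and a: "a \<in> verts (F t)" and b: "b \<in> verts (F s)"
    and n: "near (join I F) n (tag t a) (tag s b)"
  shows "depth (join I F) (tag t a) + depth (join I F) (tag s b) \<le> n"
proof -
  define f where "f x = (if x \<in> tag t ` verts (F t) then - int (depth (join I F) x)
     else int (depth (join I F) x))" for x
  have "\<bar>f x - f y\<bar> \<le> 1" if xy: "(x, y) \<in> parent (join I F)" for x y
    using xy
  proof (rule join_parentE)
    fix s c d assume s: "s \<in> I" "x = tag s c" "y = tag s d" "(c, d) \<in> parent (F s)"
    then have "c \<in> verts (F s)" "d \<in> verts (F s)" using parent_verts[OF trees] by blast+
    then have "x \<in> tag t ` verts (F t) \<longleftrightarrow> y \<in> tag t ` verts (F t)" using s by auto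
    then show ?thesis using depth_parent[OF rooted xy] by (simp add: f_def)
  next
    fix s assume s: "s \<in> I" "x = tag s (root (F s))" "y = tag undefined undefined"
    have y: "depth (join I F) y = 0" using depth_root[OF rooted] s by simp
    then have "depth (join I F) x = 1" using depth_parent[OF rooted xy] by simp
    then show ?thesis using y by (simp add: f_def)
  qed
  from near_Lipschitz[of "join I F" f, OF this n]
  have "\<bar>f (tag t a) - f (tag s b)\<bar> \<le> int n" .
  moreover have "f (tag t a) = - int (depth (join I F) (tag t a))" using a by (simp add: f_def)
  moreover have "f (tag s b) = int (depth (join I F) (tag s b))" using t by (auto simp: f_def)
  ultimately show ?thesis by linarith
qed

text \<open>The witnesses of a single rich component keep working: they are one level deeper, their
  local types are unchanged by \<open>lef_join\<close>, and by \<open>near_join\<close> they are no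
  closer to each other.\<close>

lemma rich_join:
  assumes t: "t \<in> I" and rich: "rich k (F t)"
  shows "rich k (join I F)"
  unfolding rich_def
proof (intro allI impI)
  fix T1 :: "'a rtree" and v j
  assume "rooted_tree T1" "v \<in> verts T1" "j < k" "2 ^ j < depth T1 v"
  then have "\<exists>W\<subseteq>verts (F t). infinite W \<and> (\<forall>w\<in>W. 2 ^ j < depth (F t) w \<and> lef j T1 (F t) {(v, w)}) \<and>
       (\<forall>w\<in>W. \<forall>w'\<in>W. w \<noteq> w' \<longrightarrow> \<not> near (F t) (2 ^ Suc j) w w')"
    using rich unfolding rich_def by simp
  then obtain W where W: "W \<subseteq> verts (F t)" "infinite W"
    and Wlef: "\<forall>w\<in>W. 2 ^ j < depth (F t) w \<and> lef j T1 (F t) {(v, w)}"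
    and Wsep: "\<forall>w\<in>W. \<forall>w'\<in>W. w \<noteq> w' \<longrightarrow> \<not> near (F t) (2 ^ Suc j) w w'"
    by (elim exE conjE) (rule that)
  show "\<exists>W\<subseteq>verts (join I F). infinite W \<and>
       (\<forall>w\<in>W. 2 ^ j < depth (join I F) w \<and> lef j T1 (join I F) {(v, w)}) \<and>
       (\<forall>w\<in>W. \<forall>w'\<in>W. w \<noteq> w' \<longrightarrow> \<not> near (join I F) (2 ^ Suc j) w w')"
  proof (intro exI[of _ "tag t ` W"] conjI ballI impI)
    show "tag t ` W \<subseteq> verts (join I F)" using W(1) t by auto
    show "infinite (tag t ` W)"
      using W(2) finite_imageD inj_on_subset[OF inj_tag'] by blast
  next
    fix w assume "w \<in> tag t ` W"
    then obtain a where a: "a \<in> W" "w = tag t a" by blast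
    have aF: "a \<in> verts (F t)" using a(1) W(1) by blast
    have d: "2 ^ j < depth (F t) a" and l: "lef j T1 (F t) {(v, a)}" using Wlef a(1) by auto
    show "2 ^ j < depth (join I F) w" using depth_join[OF t aF] d a(2) by simp
    show "lef j T1 (join I F) {(v, w)}"
      unfolding a(2) using lef_compose_single[OF l lef_join[OF t aF]] d by simp
  next
    fix w w' assume "w \<in> tag t ` W" "w' \<in> tag t ` W" "w \<noteq> w'"
    then obtain a a' where a: "a \<in> W" "w = tag t a" "a' \<in> W" "w' = tag t a'" "a \<noteq> a'" by blast
    then have "a \<in> verts (F t)" "a' \<in> verts (F t)" using W(1) by auto
    then show "\<not> near (join I F) (2 ^ Suc j) w w'"
      using near_join[OF t] Wsep a by metis
  qed
qed

end

section \<open>Cutting out a piece of bounded depth\<close>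

definition prune :: "nat \<Rightarrow> 'a rtree \<Rightarrow> 'a \<Rightarrow> 'a rtree" where
  "prune D T w = \<lparr>verts = {a \<in> descendants T w. depth T a \<le> depth T w + D}, root = w,
     parent = parent T \<inter> ({a \<in> descendants T w. depth T a \<le> depth T w + D} \<times>
       {a \<in> descendants T w. depth T a \<le> depth T w + D})\<rparr>"

lemma prune_simps [simp]:
  "a \<in> verts (prune D T w) \<longleftrightarrow> a \<in> descendants T w \<and> depth T a \<le> depth T w + D"
  "root (prune D T w) = w"
  "(a, b) \<in> parent (prune D T w) \<longleftrightarrow>
     (a, b) \<in> parent T \<and> a \<in> verts (prune D T w) \<and> b \<in> verts (prune D T w)"
  by (auto simp: prune_def)

lemma prune_relpow:
  assumes T: "rooted_tree T"
  shows "a \<in> verts (prune D T w) \<Longrightarrow> \<exists>n. depth T a = depth T w + n \<and> (a, w) \<in> parent (prune D T w) ^^ n"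
proof (induction "depth T a" arbitrary: a rule: less_induct)
  case less
  have "(a, w) \<in> (parent T)\<^sup>*" using less.prems by (simp add: descendants_def)
  then show ?case
  proof (cases rule: converse_rtranclE)
    case base
    then show ?thesis by (intro exI[of _ 0]) simp
  next
    case (step b)
    have d: "depth T a = Suc (depth T b)" using depth_parent[OF T step(1)] .
    have b: "b \<in> verts (prune D T w)"
      using step(2) less.prems d by (simp add: descendants_def)
    obtain n where n: "depth T b = depth T w + n" "(b, w) \<in> parent (prune D T w) ^^ n"
      using less.hyps[OF _ b] d by auto
    have "(a, b) \<in> parent (prune D T w)" using step(1) less.prems b by simp
    then have "(a, w) \<in> parent (prune D T w) ^^ Suc n" using n(2) by (rule relpow_Suc_I2)
    then show ?thesis using n(1) d by (intro exI[of _ "Suc n"]) simp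
  qed
qed

lemma rooted_tree_prune:
  assumes T: "rooted_tree T"
  shows "rooted_tree (prune D T w)"
proof -
  have "w \<in> verts (prune D T w)" by (simp add: descendants_refl)
  moreover have "parent (prune D T w) \<subseteq> verts (prune D T w) \<times> verts (prune D T w)"
    by (auto simp: prune_def)
  moreover have "(w, b) \<notin> parent (prune D T w)" for b
  proof
    assume b: "(w, b) \<in> parent (prune D T w)"
    then have "depth T w = Suc (depth T b)" using depth_parent[OF T] by simp
    moreover have "b \<in> verts (prune D T w)" using b by simp
    ultimately show False using prune_relpow[OF T, of b D w] by auto
  qed
  moreover have "\<exists>!b. (a, b) \<in> parent (prune D T w)" if "a \<in> verts (prune D T w) - {w}" for a
  proof -
    have "a \<in> verts (prune D T w)" using that by blast
    from prune_relpow[OF T this] obtain n where n: "(a, w) \<in> parent (prune D T w) ^^ n" by blast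
    moreover have "n \<noteq> 0" using n that by (intro notI) simp
    ultimately obtain b where b: "(a, b) \<in> parent (prune D T w)"
      using relpow_Suc_D2[of a w] by (cases n) blast+
    show ?thesis
    proof (rule ex1I)
      show "(a, b) \<in> parent (prune D T w)" by (rule b)
    next
      fix c assume "(a, c) \<in> parent (prune D T w)"
      then show "c = b" using b parent_unique[OF T, of a c b] by simp
    qed
  qed
  moreover have "(a, w) \<in> (parent (prune D T w))\<^sup>*" if "a \<in> verts (prune D T w)" for a
    using prune_relpow[OF T that] relpow_imp_rtrancl by blast
  ultimately show ?thesis unfolding rooted_tree_def prune_simps(2) by simp
qed

lemma depth_prune:
  assumes T: "rooted_tree T" and a: "a \<in> verts (prune D T w)"
  shows "depth T a = depth T w + depth (prune D T w) a"
proof -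
  obtain n where n: "depth T a = depth T w + n" "(a, w) \<in> parent (prune D T w) ^^ n"
    using prune_relpow[OF T a] by blast
  have "depth (prune D T w) a = n" using n(2) by (intro depth_eqI[OF rooted_tree_prune[OF T]]) simp
  then show ?thesis using n(1) by simp
qed

text \<open>The cut affects only the top vertex, which loses its parent, and the bottom level, which
  loses its children. The two depth conditions keep a local game with \<open>j\<close> moves away
  from both.\<close>

lemma lef_prune:
  assumes T: "rooted_tree T" and a: "a \<in> verts (prune D T w)"
    and d: "2 ^ j \<le> depth (prune D T w) a" "depth (prune D T w) a + 2 ^ j \<le> D"
  shows "lef j T (prune D T w) {(a, a)}"
proof -
  let ?C = "prune D T w"
  note C = rooted_tree_prune[OF T, of D w]
  have "lef j ?C T ((\<lambda>a. (a, id a)) ` {a})"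
  proof (rule lef_local[where V = "verts ?C" and
      U = "{a \<in> verts ?C. 0 < depth ?C a \<and> depth ?C a < D}"])
    show "inj_on id (verts ?C)" by simp
    show "(b, c) \<in> parent ?C \<longleftrightarrow> (id b, id c) \<in> parent T" if "b \<in> verts ?C" "c \<in> verts ?C" for b c
      using that by simp
    show "c \<in> verts ?C" if "b \<in> {a \<in> verts ?C. 0 < depth ?C a \<and> depth ?C a < D}" "(b, c) \<in> adj ?C"
      for b c
      using that unfolding adj_iff prune_simps(3) by blast
    show "y \<in> id ` verts ?C"
      if b: "b \<in> {a \<in> verts ?C. 0 < depth ?C a \<and> depth ?C a < D}" and y: "(id b, y) \<in> adj T" for b y
    proof -
      have bC: "b \<in> verts ?C" "0 < depth ?C b" "depth ?C b < D" using b by auto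
      have dT: "depth T b = depth T w + depth ?C b" by (rule depth_prune[OF T bC(1)])
      have bw: "b \<noteq> w" using bC(2) dT by auto
      have bd: "b \<in> descendants T w" using bC(1) by simp
      consider "y = b" | "(b, y) \<in> parent T" | "(y, b) \<in> parent T"
        using y unfolding adj_iff id_apply by blast
      then have "y \<in> verts ?C"
      proof cases
        case 1
        then show ?thesis using bC(1) by simp
      next
        case 2
        then show ?thesis
          using descendants_up[OF T 2 bd bw] depth_parent[OF T 2] dT bC(3) by simp
      next
        case 3
        then show ?thesis
          using descendants_down[OF 3 bd] depth_parent[OF T 3] dT bC(3) by simp
      qed
      then show ?thesis by simp
    qed
    show "c \<in> {a \<in> verts ?C. 0 < depth ?C a \<and> depth ?C a < D}"
      if "x \<in> {a}" "n < 2 ^ j" "near ?C n x c" for x n c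
    proof -
      have n: "near ?C n a c" using that by simp
      have "c \<in> verts ?C" using near_verts[OF C a n] .
      moreover have "0 < depth ?C c" "depth ?C c < D"
        using near_depth[OF C n] d that(2) by linarith+
      ultimately show ?thesis by blast
    qed
  qed
  then have "lef j ?C T {(a, a)}" by simp
  from lef_converse[OF this] have "lef j T ?C ({(a, a)}\<inverse>)" .
  then show ?thesis by (rule lef_subset) auto
qed

lemma ex_inj_avoiding:
  obtains \<tau> :: "nat \<Rightarrow> 'a::infinite" where "inj \<tau>" "undefined \<notin> range \<tau>"
proof -
  have "infinite (UNIV - {undefined :: 'a})" using infinite_UNIV by (rule infinite_remove)
  from infinite_countable_subset[OF this] obtain \<tau> :: "nat \<Rightarrow> 'a" where
    "inj \<tau>" "range \<tau> \<subseteq> UNIV - {undefined}" by blast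
  then show ?thesis using that by blast
qed

definition bounded_depth :: "nat \<Rightarrow> 'a rtree \<Rightarrow> bool" where
  "bounded_depth D T \<longleftrightarrow> (\<forall>a\<in>verts T. depth T a \<le> D)"

text \<open>For each \<open>j\<close> and each local type \<open>i\<close> that occurs at depth at
  least \<open>2 ^ j\<close> in some tree of depth at most \<open>2 ^ Suc k\<close>, choose a
  representative, and join infinitely many copies of all the representatives under a new root. The
  bound on the depth loses no type needed for richness, because a local game with \<open>j\<close>
  moves sees only a piece of at most \<open>2 ^ Suc j\<close> levels, which \<open>prune\<close>
  cuts out.\<close>

lemma ex_rich_bounded_depth:
  "\<exists>(A :: 'a::infinite rtree) D. rooted_tree A \<and> rich k A \<and> bounded_depth D A"
proof -
  have "\<exists>f :: 'a rtree \<Rightarrow> 'a list \<Rightarrow> nat. \<forall>T T' as bs. length as = 1 \<longrightarrow> length bs = 1 \<longrightarrow>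
      f T as = f T' bs \<longrightarrow> lef j T T' (set (zip as bs))" for j
    using lef_finite_index[of 1 j] by (elim exE conjE) (rule exI)
  then have "\<exists>f :: nat \<Rightarrow> 'a rtree \<Rightarrow> 'a list \<Rightarrow> nat. \<forall>j T T' as bs. length as = 1 \<longrightarrow> length bs = 1 \<longrightarrow>
      f j T as = f j T' bs \<longrightarrow> lef j T T' (set (zip as bs))"
    by (intro choice allI)
  then obtain f :: "nat \<Rightarrow> 'a rtree \<Rightarrow> 'a list \<Rightarrow> nat" where f: "\<forall>j T T' as bs. length as = 1 \<longrightarrow>
      length bs = 1 \<longrightarrow> f j T as = f j T' bs \<longrightarrow> lef j T T' (set (zip as bs))" ..
  have lef_f: "lef j T T' {(v, v')}" if "f j T [v] = f j T' [v']" for j T T' v v'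
    using f[rule_format, of "[v]" "[v']" j T T'] that by simp
  define valid where "valid j i p \<longleftrightarrow> rooted_tree (fst p) \<and> bounded_depth (2 ^ Suc k) (fst p) \<and>
     snd p \<in> verts (fst p) \<and> 2 ^ j \<le> depth (fst p) (snd p) \<and> f j (fst p) [snd p] = i" for j i p
  define rep where "rep j i = (SOME p. valid j i p)" for j i
  have rep: "valid j i (rep j i)" if "valid j i p" for j i p
    unfolding rep_def using that by (rule someI)
  obtain \<tau> :: "nat \<Rightarrow> 'a" where \<tau>: "inj \<tau>" "undefined \<notin> range \<tau>" by (rule ex_inj_avoiding)
  define lbl where "lbl j i n = \<tau> (prod_encode (prod_encode (j, i), n))" for j i n
  have lbl_inj: "lbl j i n = lbl j' i' n' \<longleftrightarrow> j = j' \<and> i = i' \<and> n = n'" for j i n j' i' n'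
    using inj_eq[OF \<tau>(1)] by (simp add: lbl_def)
  define F where "F t = (let p = prod_decode (fst (prod_decode (inv \<tau> t))) in
      fst (rep (fst p) (snd p)))" for t
  have F: "F (lbl j i n) = fst (rep j i)" for j i n
    by (simp add: F_def lbl_def inv_f_f[OF \<tau>(1)])
  define I where "I = {lbl j i n |j i n. \<exists>p. valid j i p}"
  have IE: "\<exists>j i n. t = lbl j i n \<and> valid j i (rep j i)" if "t \<in> I" for t
    using that rep unfolding I_def by blast
  interpret tree_family I F
  proof
    show "undefined \<notin> I" using \<tau>(2) by (auto simp: I_def lbl_def)
    show "rooted_tree (F t)" if "t \<in> I" for t
      using IE[OF that] by (auto simp: F valid_def)
  qed
  have "rich k (join I F)"
    unfolding rich_def
  proof (intro allI impI)
    fix T1 :: "'a rtree" and v j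
    assume T1: "rooted_tree T1" and v: "v \<in> verts T1" and j: "j < k" and d: "2 ^ j < depth T1 v"
    \<comment> \<open>The vertex \<open>w\<close> obtained below is the ancestor of \<open>v\<close>
      by \<open>2 ^ j\<close> generations. The piece of \<open>2 ^ Suc j\<close> levels under
      \<open>w\<close> has \<open>v\<close> exactly in its middle, as \<open>lef_prune\<close>
      requires.\<close>
    define m where "m = depth T1 v - 2 ^ j"
    have m: "depth T1 v = 2 ^ j + m" using d by (simp add: m_def)
    have "(v, root T1) \<in> parent T1 ^^ (2 ^ j + m)" using depth_relpow[OF T1 v] m by simp
    then have "(v, root T1) \<in> (parent T1 ^^ (2 ^ j)) O (parent T1 ^^ m)" by (simp only: relpow_add)
    then obtain w where vw: "(v, w) \<in> parent T1 ^^ (2 ^ j)" by (rule relcompE) simp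
    let ?D = "2 ^ Suc j" let ?B = "prune ?D T1 w"
    have dw: "depth T1 v = depth T1 w + 2 ^ j" using depth_parent_relpow[OF T1 vw] .
    have "v \<in> descendants T1 w"
      using relpow_imp_rtrancl[OF vw] by (simp add: descendants_def)
    then have vB: "v \<in> verts ?B" using dw by simp
    have dB: "depth ?B v = 2 ^ j" using depth_prune[OF T1 vB] dw by simp
    have "(2::nat) ^ Suc j \<le> 2 ^ Suc k" using j by (intro power_increasing) auto
    moreover have "depth ?B a \<le> ?D" if "a \<in> verts ?B" for a
      using depth_prune[OF T1 that] that by simp
    ultimately have "bounded_depth (2 ^ Suc k) ?B"
      unfolding bounded_depth_def using le_trans by blast
    then have "valid j (f j ?B [v]) (?B, v)"
      using rooted_tree_prune[OF T1] vB dB by (simp add: valid_def del: prune_simps(1))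
    note val = this rep[OF this]
    define i where "i = f j ?B [v]"
    define B v' where "B = fst (rep j i)" and "v' = snd (rep j i)"
    have B: "rooted_tree B" "v' \<in> verts B" "2 ^ j \<le> depth B v'" "f j B [v'] = f j ?B [v]"
      using val(2) unfolding valid_def i_def B_def v'_def by simp_all
    have lefB: "lef j T1 B {(v, v')}"
      using lef_compose_single[OF lef_prune[OF T1 vB] lef_f[of j ?B v B v']] B(4) dB by simp
    have inI: "lbl j i n \<in> I" for n using val(1) unfolding I_def i_def by blast
    have FB: "F (lbl j i n) = B" for n by (simp add: F B_def)
    have v'F: "v' \<in> verts (F (lbl j i n))" for n using B(2) FB by simp
    have dJ: "depth (join I F) (tag (lbl j i n) v') = Suc (depth B v')" for n
      using depth_join[OF inI v'F] FB by simp
    define W where "W = range (\<lambda>n. tag (lbl j i n) v')"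
    show "\<exists>W\<subseteq>verts (join I F). infinite W \<and>
       (\<forall>w\<in>W. 2 ^ j < depth (join I F) w \<and> lef j T1 (join I F) {(v, w)}) \<and>
       (\<forall>w\<in>W. \<forall>w'\<in>W. w \<noteq> w' \<longrightarrow> \<not> near (join I F) (2 ^ Suc j) w w')"
    proof (intro exI[of _ W] conjI ballI impI)
      show "W \<subseteq> verts (join I F)" using inI v'F by (auto simp: W_def)
      have "inj (\<lambda>n. tag (lbl j i n) v')" by (simp add: inj_def lbl_inj)
      then show "infinite W" unfolding W_def using finite_imageD infinite_UNIV_nat by blast
    next
      fix w assume "w \<in> W"
      then obtain n where n: "w = tag (lbl j i n) v'" by (auto simp: W_def)
      show "2 ^ j < depth (join I F) w" using dJ B(3) n by simp
      have "lef j B (join I F) {(v', w)}"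
        using lef_join[OF inI v'F] B(3) FB n by simp
      then show "lef j T1 (join I F) {(v, w)}" by (rule lef_compose_single[OF lefB])
    next
      fix w w' assume "w \<in> W" "w' \<in> W" "w \<noteq> w'"
      then obtain n n' where n: "w = tag (lbl j i n) v'" "w' = tag (lbl j i n') v'"
        "lbl j i n \<noteq> lbl j i n'" by (auto simp: W_def)
      \<comment> \<open>Both vertices have depth at least \<open>2 ^ j + 1\<close> and lie in
        different components, so their distance is at least \<open>2 ^ Suc j + 2\<close>.\<close>
      show "\<not> near (join I F) (2 ^ Suc j) w w'"
      proof
        assume "near (join I F) (2 ^ Suc j) w w'"
        from near_join_diff[OF inI inI n(3) v'F v'F this[unfolded n(1,2)]]
        show False using dJ B(3) by simp
      qed
    qed
  qed
  moreover have "bounded_depth (Suc (2 ^ Suc k)) (join I F)"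
    unfolding bounded_depth_def
  proof
    fix x assume "x \<in> verts (join I F)"
    then consider "x = root (join I F)" | t a where "t \<in> I" "a \<in> verts (F t)" "x = tag t a" by auto
    then show "depth (join I F) x \<le> Suc (2 ^ Suc k)"
    proof cases
      case 1
      then show ?thesis using depth_root[OF rooted] by simp
    next
      case 2
      obtain j i n where t: "t = lbl j i n" "valid j i (rep j i)" using IE[OF 2(1)] by blast
      have "depth (F t) a \<le> 2 ^ Suc k"
        using t 2(2) unfolding valid_def bounded_depth_def by (simp add: F)
      then show ?thesis using depth_join[OF 2(1,2)] 2(3) by simp
    qed
  qed
  ultimately show ?thesis using rooted by blast
qed

section \<open>Trees that coincide near the root\<close>

definition agree :: "nat \<Rightarrow> 'a rtree \<Rightarrow> 'a rtree \<Rightarrow> ('a \<Rightarrow> 'a) \<Rightarrow> bool" where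
  "agree i T T' h \<longleftrightarrow> inj_on h {a \<in> verts T. depth T a \<le> i} \<and> h ` {a \<in> verts T. depth T a \<le> i} \<subseteq> verts T' \<and>
     h (root T) = root T' \<and>
     (\<forall>a b. a \<in> verts T \<longrightarrow> depth T a \<le> i \<longrightarrow> b \<in> verts T \<longrightarrow> depth T b \<le> i \<longrightarrow>
        ((a, b) \<in> parent T \<longleftrightarrow> (h a, h b) \<in> parent T')) \<and>
     (\<forall>a y. a \<in> verts T \<longrightarrow> depth T a < i \<longrightarrow> (y, h a) \<in> parent T' \<longrightarrow>
        y \<in> h ` {a \<in> verts T. depth T a \<le> i})"

lemma agree_id:
  assumes "rooted_tree T"
  shows "agree i T T id"
  using assms parent_verts depth_parent unfolding agree_def by fastforce

lemma agree_0:
  assumes T: "rooted_tree T" and T': "rooted_tree T'"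
  shows "agree 0 T T' (\<lambda>_. root T')"
proof -
  have "{a \<in> verts T. depth T a \<le> 0} = {root T}"
    using depth_0_iff[OF T] root_verts[OF T] by auto
  moreover have "(a, b) \<notin> parent T" if "a \<in> verts T" "depth T a = 0" for a b
    using depth_0_iff[OF T that(1)] that(2) root_no_parent[OF T] by simp
  ultimately show ?thesis
    using root_verts[OF T'] root_no_parent[OF T] root_no_parent[OF T'] by (simp add: agree_def)
qed

text \<open>The vertices of depth below \<open>i\<close> form the interior: the last clause of
  \<open>agree\<close> provides the children of their images, and parents are already inside. A
  local game with \<open>k\<close> moves from the root stays at depths below \<open>2 ^ k\<close>,
  which is where the length \<open>2 ^ k\<close> of the compositions comes from.\<close>

lemma agree_lef:
  assumes T: "rooted_tree T" and T': "rooted_tree T'" and h: "agree i T T' h" and k: "2 ^ k \<le> i"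
  shows "lef k T T' {(root T, root T')}"
proof -
  let ?V = "{a \<in> verts T. depth T a \<le> i}"
  have hroot: "h (root T) = root T'" and inj: "inj_on h ?V"
    and par: "\<And>a b. a \<in> ?V \<Longrightarrow> b \<in> ?V \<Longrightarrow> (a, b) \<in> parent T \<longleftrightarrow> (h a, h b) \<in> parent T'"
    and child: "\<And>a y. a \<in> verts T \<Longrightarrow> depth T a < i \<Longrightarrow> (y, h a) \<in> parent T' \<Longrightarrow> y \<in> h ` ?V"
    using h unfolding agree_def by simp_all
  have "lef k T T' ((\<lambda>a. (a, h a)) ` {root T})"
  proof (rule lef_local[where V = ?V and U = "{a \<in> verts T. depth T a < i}", OF inj par])
    show "b \<in> ?V" if "a \<in> {a \<in> verts T. depth T a < i}" "(a, b) \<in> adj T" for a b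
    proof -
      have "near T (Suc 0) a b" using that(2) by (rule near_adj)
      then show ?thesis
        using near_depth(2)[OF T] near_verts[OF T] that(1) by fastforce
    qed
    show "y \<in> h ` ?V" if a: "a \<in> {a \<in> verts T. depth T a < i}" and y: "(h a, y) \<in> adj T'" for a y
    proof -
      consider "y = h a" | "(h a, y) \<in> parent T'" | "(y, h a) \<in> parent T'"
        using y unfolding adj_iff by blast
      then show ?thesis
      proof cases
        case 1
        then show ?thesis using a by simp
      next
        case 2
        then have "a \<noteq> root T" using hroot root_no_parent[OF T'] by auto
        then obtain b where b: "(a, b) \<in> parent T" using T a unfolding rooted_tree_def by blast
        then have bV: "b \<in> ?V" using a depth_parent[OF T b] parent_verts[OF T b] by simp
        have "(h a, h b) \<in> parent T'" using par[of a b] b bV a by simp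
        then have "y = h b" using parent_unique[OF T' 2] by blast
        then show ?thesis using bV by blast
      next
        case 3
        then show ?thesis using child a by blast
      qed
    qed
    show "c \<in> {a \<in> verts T. depth T a < i}" if "x \<in> {root T}" "n < 2 ^ k" "near T n x c" for x n c
    proof -
      have n: "near T n (root T) c" using that by simp
      then show ?thesis
        using near_verts[OF T root_verts[OF T] n] near_depth(2)[OF T n] T that(2) k by simp
    qed
  qed
  then show ?thesis by (simp add: hroot)
qed

text \<open>The new root is common to both joins, so every place where the components differ moves
  one level down.\<close>

lemma agree_join:
  assumes F: "tree_family I F" and F': "tree_family I F'"
    and H: "\<And>t. t \<in> I \<Longrightarrow> agree i (F t) (F' t) (H t)"
  shows "\<exists>h. agree (Suc i) (join I F) (join I F') h"
proof -
  interpret F: tree_family I F by (rule F)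
  interpret F': tree_family I F' by (rule F')
  let ?V = "\<lambda>t. {a \<in> verts (F t). depth (F t) a \<le> i}"
  let ?L = "join I F" let ?L' = "join I F'"
  define h where "h x = (let p = inv (\<lambda>(t, a). tag t a) x in
      if fst p \<in> I then tag (fst p) (H (fst p) (snd p)) else x)" for x
  have inv: "inv (\<lambda>(t, a). tag t a) (tag t a) = (t, a)" for t a :: 'a
    using inv_f_f[OF inj_tag, of "(t, a)"] by simp
  have h_in: "h (tag t a) = tag t (H t a)" if "t \<in> I" for t a
    using that by (simp add: h_def inv)
  have h_root: "h (tag undefined undefined) = tag undefined undefined"
    using F.undef by (simp add: h_def inv)
  have Hinj: "inj_on (H t) (?V t)" and Hv: "H t ` ?V t \<subseteq> verts (F' t)"
    and Hr: "H t (root (F t)) = root (F' t)"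
    and Hpar: "\<And>a b. a \<in> ?V t \<Longrightarrow> b \<in> ?V t \<Longrightarrow> (a, b) \<in> parent (F t) \<longleftrightarrow> (H t a, H t b) \<in> parent (F' t)"
    and Hchild: "\<And>a y. a \<in> verts (F t) \<Longrightarrow> depth (F t) a < i \<Longrightarrow> (y, H t a) \<in> parent (F' t) \<Longrightarrow>
      y \<in> H t ` ?V t" if "t \<in> I" for t
    using H[OF that] unfolding agree_def by simp_all
  have rootV: "root (F t) \<in> ?V t" if "t \<in> I" for t
    using root_verts[OF F.trees[OF that]] F.trees[OF that] by simp
  have Hroot_iff: "H t a = root (F' t) \<longleftrightarrow> a = root (F t)" if "t \<in> I" "a \<in> ?V t" for t a
    using inj_on_eq_iff[OF Hinj[OF that(1)] that(2) rootV[OF that(1)]] Hr[OF that(1)] by simp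
  have VE: "x = tag undefined undefined \<or> (\<exists>t a. t \<in> I \<and> a \<in> ?V t \<and> x = tag t a)"
    if x: "x \<in> verts ?L" "depth ?L x \<le> Suc i" for x
  proof -
    consider "x = tag undefined undefined" | t a where "t \<in> I" "a \<in> verts (F t)" "x = tag t a"
      using x(1) by auto
    then show ?thesis
    proof cases
      case 2
      then have "a \<in> ?V t" using F.depth_join[OF 2(1,2)] x(2) by simp
      then show ?thesis using 2 by blast
    qed simp
  qed
  have VI: "tag t a \<in> {x \<in> verts ?L. depth ?L x \<le> Suc i}" if "t \<in> I" "a \<in> ?V t" for t a
    using F.depth_join[OF that(1)] that by auto
  have nundef: "t \<noteq> undefined" if "t \<in> I" for t using F.undef that by blast
  have "agree (Suc i) ?L ?L' h"
    unfolding agree_def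
  proof (intro conjI allI impI)
    show "inj_on h {x \<in> verts ?L. depth ?L x \<le> Suc i}"
    proof (rule inj_onI)
      fix x y assume "x \<in> {x \<in> verts ?L. depth ?L x \<le> Suc i}" "y \<in> {x \<in> verts ?L. depth ?L x \<le> Suc i}"
        and eq: "h x = h y"
      then have "x = tag undefined undefined \<or> (\<exists>t a. t \<in> I \<and> a \<in> ?V t \<and> x = tag t a)"
        "y = tag undefined undefined \<or> (\<exists>t a. t \<in> I \<and> a \<in> ?V t \<and> y = tag t a)" using VE by simp_all
      then consider "x = tag undefined undefined" "y = tag undefined undefined"
        | t a where "x = tag undefined undefined" "t \<in> I" "y = tag t a"
        | t a where "y = tag undefined undefined" "t \<in> I" "x = tag t a"
        | t a s b where "t \<in> I" "a \<in> ?V t" "x = tag t a" "s \<in> I" "b \<in> ?V s" "y = tag s b" by blast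
      then show "x = y"
      proof cases
        case 4
        then have ts: "t = s" using eq by (simp add: h_in)
        then have "H s a = H s b" using eq 4 by (simp add: h_in)
        then have "a = b" using inj_onD[OF Hinj[OF 4(4)], of a b] 4(2,5) ts by simp
        then show ?thesis using 4(3,6) ts by simp
      qed (use eq nundef in \<open>simp_all add: h_in h_root\<close>, metis+)
    qed
    show "h ` {x \<in> verts ?L. depth ?L x \<le> Suc i} \<subseteq> verts ?L'"
    proof
      fix y assume "y \<in> h ` {x \<in> verts ?L. depth ?L x \<le> Suc i}"
      then obtain x where x: "x \<in> verts ?L" "depth ?L x \<le> Suc i" "y = h x" by blast
      from VE[OF x(1,2)] show "y \<in> verts ?L'"
      proof (elim disjE exE conjE)
        fix t a assume "t \<in> I" "a \<in> ?V t" "x = tag t a"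
        then show ?thesis using Hv x(3) by (auto simp: h_in)
      qed (simp add: x(3) h_root)
    qed
    show "h (root ?L) = root ?L'" by (simp add: h_root)
  next
    fix x y assume "x \<in> verts ?L" "depth ?L x \<le> Suc i" "y \<in> verts ?L" "depth ?L y \<le> Suc i"
    then have "x = tag undefined undefined \<or> (\<exists>t a. t \<in> I \<and> a \<in> ?V t \<and> x = tag t a)"
      "y = tag undefined undefined \<or> (\<exists>t a. t \<in> I \<and> a \<in> ?V t \<and> y = tag t a)" using VE by simp_all
    then consider "x = tag undefined undefined"
      | t a where "y = tag undefined undefined" "t \<in> I" "a \<in> ?V t" "x = tag t a"
      | t a s b where "t \<in> I" "a \<in> ?V t" "x = tag t a" "s \<in> I" "b \<in> ?V s" "y = tag s b" by blast
    then show "(x, y) \<in> parent ?L \<longleftrightarrow> (h x, h y) \<in> parent ?L'"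
    proof cases
      case 1
      then show ?thesis using root_no_parent[OF F.rooted] root_no_parent[OF F'.rooted]
        by (simp add: h_root)
    next
      case 2
      then show ?thesis using Hroot_iff[OF 2(2,3)] nundef[OF 2(2)]
        by (simp add: h_root h_in F.parent_iff F'.parent_iff)
    next
      case 4: 3
      then show ?thesis using Hpar[OF 4(1), of a b] nundef[OF 4(1)] nundef[OF 4(4)]
        by (auto simp: h_in F.parent_iff F'.parent_iff)
    qed
  next
    fix x y assume x: "x \<in> verts ?L" "depth ?L x < Suc i" and y: "(y, h x) \<in> parent ?L'"
    consider "x = tag undefined undefined" | t a where "t \<in> I" "a \<in> verts (F t)" "x = tag t a"
      using x(1) by auto
    then show "y \<in> h ` {x \<in> verts ?L. depth ?L x \<le> Suc i}"
    proof cases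
      case 1
      from y show ?thesis
      proof (rule join_parentE)
        fix s c d assume "s \<in> I" "h x = tag s d"
        then show ?thesis using 1 nundef by (auto simp: h_root)
      next
        fix s assume s: "s \<in> I" "y = tag s (root (F' s))"
        then have "y = h (tag s (root (F s)))" by (simp add: h_in Hr)
        then show ?thesis using VI[OF s(1) rootV[OF s(1)]] by blast
      qed
    next
      case 2
      have hx: "h x = tag t (H t a)" using 2 by (simp add: h_in)
      from y show ?thesis
      proof (rule join_parentE)
        fix s c d assume s: "s \<in> I" "y = tag s c" "h x = tag s d" "(c, d) \<in> parent (F' s)"
        then have st: "s = t" "H t a = d" using hx by auto
        have "depth (F t) a < i" using F.depth_join[OF 2(1,2)] x(2) 2(3) by simp
        then have "c \<in> H t ` ?V t" using Hchild[OF 2(1,2)] s(4) st by blast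
        then obtain b where b: "b \<in> ?V t" "c = H t b" by blast
        then have "y = h (tag t b)" using s(2) st 2(1) by (simp add: h_in)
        then show ?thesis using VI[OF 2(1) b(1)] by blast
      next
        fix s assume "h x = tag undefined undefined"
        then show ?thesis using hx nundef[OF 2(1)] by simp
      qed
    qed
  qed
  then show ?thesis by blast
qed

section \<open>Count vectors along a spine\<close>

fun count_up :: "nat \<Rightarrow> count \<Rightarrow> count" where
  "count_up k (Exactly u) = (if Suc u < k then Exactly (Suc u) else Omega)"
| "count_up k Omega = Omega"

lemma trunc_card_insert:
  assumes "a \<notin> A"
  shows "trunc_card k (insert a A) = count_up k (trunc_card k A)"
  using assms by (auto simp: trunc_card_def)

lemma trunc_card_in_counts: "trunc_card k A \<in> counts k"
  by (simp add: trunc_card_def counts_def)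

lemma count_up_in_counts: "count_up k x \<in> counts k"
  by (cases x) (auto simp: counts_def)

definition rich_classes :: "nat \<Rightarrow> ('v::infinite) rtree set set" where
  "rich_classes k = EV k ` {T. rooted_tree T \<and> rich k T}"

definition feed :: "nat \<Rightarrow> ('v rtree set \<Rightarrow> count) \<Rightarrow> ('v::infinite) rtree set \<Rightarrow> 'v rtree set" where
  "feed k n \<sigma> = Gam k (n(\<sigma> := count_up k (n \<sigma>)))"

text \<open>Realises a count vector by concrete trees, with a spare label \<open>s\<close> for the
  spine. A class in \<open>rich_classes k\<close> only promises some rich member, so the
  representative has to be chosen rich.\<close>

lemma ex_family:
  fixes n :: "('v::infinite) rtree set \<Rightarrow> count"
  assumes fin: "finite (ehr_classes k :: 'v rtree set set)" and k: "k > 0"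
    and n: "n \<in> ehr_classes k \<rightarrow>\<^sub>E counts k"
  shows "\<exists>I F s. tree_family I F \<and> s \<notin> I \<and> s \<noteq> undefined \<and>
    (\<forall>c\<in>ehr_classes k. trunc_card k {t \<in> I. EV k (F t) = c} = n c) \<and>
    (\<forall>g\<in>rich_classes k. n g \<noteq> Exactly 0 \<longrightarrow> (\<exists>t\<in>I. rich k (F t)))"
proof -
  let ?S = "ehr_classes k :: 'v rtree set set"
  obtain \<tau> :: "nat \<Rightarrow> 'v" where \<tau>: "inj \<tau>" "undefined \<notin> range \<tau>" by (rule ex_inj_avoiding)
  from finite_imp_inj_to_nat_seg[OF fin] obtain e :: "'v rtree set \<Rightarrow> nat" where e: "inj_on e ?S"
    by blast
  define rep :: "'v rtree set \<Rightarrow> 'v rtree" where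
    "rep c = (SOME T. rooted_tree T \<and> EV k T = c \<and> (c \<in> rich_classes k \<longrightarrow> rich k T))" for c
  have rep: "rooted_tree (rep c) \<and> EV k (rep c) = c \<and> (c \<in> rich_classes k \<longrightarrow> rich k (rep c))"
    if cS: "c \<in> ?S" for c
  proof -
    have "\<exists>T. rooted_tree T \<and> EV k T = c \<and> (c \<in> rich_classes k \<longrightarrow> rich k T)"
    proof (cases "c \<in> rich_classes k")
      case True
      then show ?thesis by (auto simp: rich_classes_def)
    next
      case False
      obtain T where "rooted_tree T" "EV k T = c" using ehr_classesE[OF cS] .
      then show ?thesis using False by blast
    qed
    then show ?thesis unfolding rep_def by (rule someI_ex)
  qed
  \<comment> \<open>The truncated count \<open>Omega\<close> is realised by \<open>k\<close> copies,
    the least number that is recorded as \<open>Omega\<close>.\<close>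
  define num where "num x = (case x of Exactly u \<Rightarrow> u | Omega \<Rightarrow> k)" for x
  \<comment> \<open>The successor keeps \<tau> 0 free; it becomes the spare label.\<close>
  define lbl where "lbl c i = \<tau> (Suc (prod_encode (e c, i)))" for c i
  have lbl_inj: "c = c' \<and> i = i'" if "lbl c i = lbl c' i'" "c \<in> ?S" "c' \<in> ?S" for c i c' i'
  proof -
    have "prod_encode (e c, i) = prod_encode (e c', i')"
      using that(1) injD[OF \<tau>(1)] unfolding lbl_def by blast
    then have "e c = e c'" "i = i'" by simp_all
    then show ?thesis using inj_onD[OF e] that(2,3) by blast
  qed
  define I where "I = {lbl c i |c i. c \<in> ?S \<and> i < num (n c)}"
  define F where "F t = rep (SOME c. c \<in> ?S \<and> (\<exists>i. t = lbl c i))" for t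
  have F: "F (lbl c i) = rep c" if c: "c \<in> ?S" for c i
  proof -
    have "(SOME c'. c' \<in> ?S \<and> (\<exists>i'. lbl c i = lbl c' i')) = c"
      using c lbl_inj by (intro some_equality) blast+
    then show ?thesis by (simp add: F_def)
  qed
  have "tree_family I F"
  proof
    show "undefined \<notin> I" using \<tau>(2) by (auto simp: I_def lbl_def)
    show "rooted_tree (F t)" if "t \<in> I" for t
      using that rep F by (auto simp: I_def)
  qed
  moreover have "\<tau> 0 \<notin> I" using injD[OF \<tau>(1)] by (force simp: I_def lbl_def)
  moreover have "\<tau> 0 \<noteq> undefined" using \<tau>(2) by (metis rangeI)
  moreover have "trunc_card k {t \<in> I. EV k (F t) = c} = n c" if c: "c \<in> ?S" for c
  proof -
    have "{t \<in> I. EV k (F t) = c} = lbl c ` {..<num (n c)}"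
    proof (intro equalityI subsetI)
      fix t assume "t \<in> {t \<in> I. EV k (F t) = c}"
      then obtain c' i where t: "t = lbl c' i" "c' \<in> ?S" "i < num (n c')" "EV k (F t) = c"
        unfolding I_def by blast
      then have "c' = c" using F[OF t(2)] rep[OF t(2)] by simp
      then show "t \<in> lbl c ` {..<num (n c)}" using t by blast
    next
      fix t assume "t \<in> lbl c ` {..<num (n c)}"
      then obtain i where i: "i < num (n c)" "t = lbl c i" by blast
      then have "t \<in> I" using c unfolding I_def by blast
      then show "t \<in> {t \<in> I. EV k (F t) = c}" using F[OF c] rep[OF c] i by simp
    qed
    moreover have "inj_on (lbl c) {..<num (n c)}"
      using lbl_inj c by (auto simp: inj_on_def)
    ultimately have "trunc_card k {t \<in> I. EV k (F t) = c} = trunc_card k {..<num (n c)}"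
      by (simp add: trunc_card_image)
    also have "\<dots> = n c"
      using PiE_mem[OF n c] by (auto simp: trunc_card_def counts_def num_def)
    finally show ?thesis .
  qed
  moreover have "\<exists>t\<in>I. rich k (F t)" if g: "g \<in> rich_classes k" "n g \<noteq> Exactly 0" for g
  proof -
    have gS: "g \<in> ?S" using g(1) EV_in_classes by (auto simp: rich_classes_def)
    have "0 < num (n g)" using g(2) k by (cases "n g") (auto simp: num_def)
    then have "lbl g 0 \<in> I" using gS unfolding I_def by blast
    moreover have "rich k (F (lbl g 0))" using F[OF gS] rep[OF gS] g(1) by simp
    ultimately show ?thesis by blast
  qed
  ultimately show ?thesis by blast
qed

lemma Gam_in_classes:
  fixes n :: "('v::infinite) rtree set \<Rightarrow> count"
  assumes "finite (ehr_classes k :: 'v rtree set set)" "k > 0" "n \<in> ehr_classes k \<rightarrow>\<^sub>E counts k"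
  shows "Gam k n \<in> ehr_classes k"
proof -
  obtain I F where I: "tree_family I F"
    and n: "\<forall>c\<in>ehr_classes k. trunc_card k {t \<in> I. EV k (F t) = c} = n c"
    using ex_family[OF assms] by blast
  interpret tree_family I F by (rule I)
  have "Gam k n = EV k (join I F)" using n by (intro Gam_join undef trees) auto
  then show ?thesis using EV_in_classes[OF rooted] by simp
qed

text \<open>Once a rich class appears among the children it is passed on to the root. This is what
  turns the probability of a class that is not rich into a recursion from above.\<close>

lemma Gam_rich:
  fixes n :: "('v::infinite) rtree set \<Rightarrow> count"
  assumes "finite (ehr_classes k :: 'v rtree set set)" "k > 0" "n \<in> ehr_classes k \<rightarrow>\<^sub>E counts k"
    and g: "g \<in> rich_classes k" "n g \<noteq> Exactly 0"
  shows "Gam k n \<in> rich_classes k"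
proof -
  obtain I F where I: "tree_family I F"
    and n: "\<forall>c\<in>ehr_classes k. trunc_card k {t \<in> I. EV k (F t) = c} = n c"
    and rich: "\<exists>t\<in>I. rich k (F t)"
    using ex_family[OF assms(1-3)] g by blast
  interpret tree_family I F by (rule I)
  have "Gam k n = EV k (join I F)" using n by (intro Gam_join undef trees) auto
  moreover have "rich k (join I F)" using rich rich_join by blast
  ultimately show ?thesis using rooted by (simp add: rich_classes_def)
qed

lemma count_up_PiE:
  "n \<in> S \<rightarrow>\<^sub>E counts k \<Longrightarrow> \<sigma> \<in> S \<Longrightarrow> n(\<sigma> := count_up k x) \<in> S \<rightarrow>\<^sub>E counts k"
  using count_up_in_counts by (auto simp: PiE_def extensional_def)

lemma feed_in_classes:
  fixes n :: "('v::infinite) rtree set \<Rightarrow> count"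
  assumes "finite (ehr_classes k :: 'v rtree set set)" "k > 0" "n \<in> ehr_classes k \<rightarrow>\<^sub>E counts k"
    and "\<sigma> \<in> ehr_classes k"
  shows "feed k n \<sigma> \<in> ehr_classes k"
  unfolding feed_def by (rule Gam_in_classes[OF assms(1,2) count_up_PiE[OF assms(3,4)]])

lemma tree_family_upd:
  assumes "tree_family I F" "s \<noteq> undefined" "rooted_tree X"
  shows "tree_family (insert s I) (F(s := X))"
  using assms unfolding tree_family_def by auto

lemma feed_join:
  assumes F: "tree_family I F" and s: "s \<notin> I" "s \<noteq> undefined" and X: "rooted_tree X"
    and n: "\<forall>c\<in>ehr_classes k. trunc_card k {t \<in> I. EV k (F t) = c} = n c"
  shows "feed k n (EV k X) = EV k (join (insert s I) (F(s := X)))"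
  unfolding feed_def
proof -
  interpret F: tree_family "insert s I" "F(s := X)" using tree_family_upd[OF F s(2) X] .
  have old: "{t \<in> I. EV k ((F(s := X)) t) = c} = {t \<in> I. EV k (F t) = c}" for c
    using s(1) by auto
  show "Gam k (n(EV k X := count_up k (n (EV k X)))) = EV k (join (insert s I) (F(s := X)))"
  proof (rule Gam_join[OF F.undef F.trees])
    fix c :: "'a rtree set" assume c: "c \<in> ehr_classes k"
    show "trunc_card k {t \<in> insert s I. EV k ((F(s := X)) t) = c} =
        (n(EV k X := count_up k (n (EV k X)))) c"
    proof (cases "c = EV k X")
      case True
      then have "{t \<in> insert s I. EV k ((F(s := X)) t) = c} = insert s {t \<in> I. EV k (F t) = c}"
        using old[of c] by auto
      then show ?thesis using True n c s(1) by (simp add: trunc_card_insert)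
    next
      case False
      then have "{t \<in> insert s I. EV k ((F(s := X)) t) = c} = {t \<in> I. EV k (F t) = c}"
        using old[of c] s(1) by auto
      then show ?thesis using False n c by simp
    qed
  qed
qed

text \<open>The head of the list belongs to the vertex nearest the root of the spine; \<sigma> is
  the class at its lower end.\<close>

primrec chain :: "nat \<Rightarrow> ('v rtree set \<Rightarrow> count) list \<Rightarrow> ('v::infinite) rtree set \<Rightarrow> 'v rtree set" where
  "chain k [] \<sigma> = \<sigma>"
| "chain k (n # ns) \<sigma> = feed k n (chain k ns \<sigma>)"

text \<open>The two trees share the spine and all the trees hanging from it, so they differ only
  from depth \<open>length ns\<close> on. Richness is claimed only on account of the head, where a
  rich side tree is a component of the outermost join.\<close>

lemma chain_trees:
  fixes \<sigma> \<sigma>' :: "('v::infinite) rtree set"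
  assumes fin: "finite (ehr_classes k :: 'v rtree set set)" and k: "k > 0"
    and \<sigma>: "\<sigma> \<in> ehr_classes k" "\<sigma>' \<in> ehr_classes k"
  shows "set ns \<subseteq> ehr_classes k \<rightarrow>\<^sub>E counts k \<Longrightarrow>
    \<exists>X X' h. rooted_tree X \<and> rooted_tree X' \<and> EV k X = chain k ns \<sigma> \<and> EV k X' = chain k ns \<sigma>' \<and>
      agree (length ns) X X' h \<and>
      (ns \<noteq> [] \<longrightarrow> (\<exists>g\<in>rich_classes k. hd ns g \<noteq> Exactly 0) \<longrightarrow> rich k X \<and> rich k X')"
proof (induction ns)
  case Nil
  obtain X where "rooted_tree X" "EV k X = \<sigma>" using ehr_classesE[OF \<sigma>(1)] .
  moreover obtain X' where "rooted_tree X'" "EV k X' = \<sigma>'" using ehr_classesE[OF \<sigma>(2)] .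
  ultimately show ?case using agree_0[of X X'] by auto
next
  case (Cons n ns)
  then obtain X X' h where X: "rooted_tree X" "EV k X = chain k ns \<sigma>"
    and X': "rooted_tree X'" "EV k X' = chain k ns \<sigma>'" and h: "agree (length ns) X X' h"
    by auto
  have n: "n \<in> ehr_classes k \<rightarrow>\<^sub>E counts k" using Cons.prems by simp
  obtain I F s where F: "tree_family I F" and s: "s \<notin> I" "s \<noteq> undefined"
    and cnt: "\<forall>c\<in>ehr_classes k. trunc_card k {t \<in> I. EV k (F t) = c} = n c"
    and good: "\<forall>g\<in>rich_classes k. n g \<noteq> Exactly 0 \<longrightarrow> (\<exists>t\<in>I. rich k (F t))"
    using ex_family[OF fin k n] by (elim exE conjE) (rule that)
  let ?J = "insert s I" let ?Y = "join ?J (F(s := X))" let ?Y' = "join ?J (F(s := X'))"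
  interpret Y: tree_family ?J "F(s := X)" using tree_family_upd[OF F s(2) X(1)] .
  interpret Y': tree_family ?J "F(s := X')" using tree_family_upd[OF F s(2) X'(1)] .
  have "\<exists>h'. agree (Suc (length ns)) ?Y ?Y' h'"
  \<comment> \<open>The spine component uses the agreement reached so far; the side trees are
    literally the same and use the identity.\<close>
  proof (rule agree_join[where H = "\<lambda>t. if t = s then h else id"])
    show "tree_family ?J (F(s := X))" "tree_family ?J (F(s := X'))"
      by (rule Y.tree_family_axioms, rule Y'.tree_family_axioms)
    show "agree (length ns) ((F(s := X)) t) ((F(s := X')) t) (if t = s then h else id)"
      if "t \<in> ?J" for t
      using h agree_id[OF Y.trees[OF that]] by (cases "t = s") auto
  qed
  then obtain h' where "agree (Suc (length ns)) ?Y ?Y' h'" ..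
  moreover have "EV k ?Y = chain k (n # ns) \<sigma>" "EV k ?Y' = chain k (n # ns) \<sigma>'"
    using feed_join[OF F s X(1) cnt] feed_join[OF F s X'(1) cnt] X(2) X'(2) by simp_all
  moreover have "rich k ?Y \<and> rich k ?Y'" if ex: "\<exists>g\<in>rich_classes k. n g \<noteq> Exactly 0"
  proof -
    obtain t where t: "t \<in> I" "rich k (F t)" using good ex by blast
    then have "rich k ((F(s := X)) t)" "rich k ((F(s := X')) t)" using s(1) by auto
    then show ?thesis using Y.rich_join[of t k] Y'.rich_join[of t k] t(1) by simp
  qed
  ultimately show ?case using Y.rooted Y'.rooted
    by (intro exI[of _ ?Y] exI[of _ ?Y'] exI[of _ h']) simp
qed

lemma chain_const:
  fixes \<sigma> \<sigma>' :: "('v::infinite) rtree set"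
  assumes fin: "finite (ehr_classes k :: 'v rtree set set)" and k: "k > 0"
    and ns: "set (n # ns) \<subseteq> ehr_classes k \<rightarrow>\<^sub>E counts k" and len: "2 ^ k \<le> Suc (length ns)"
    and g: "g \<in> rich_classes k" "n g \<noteq> Exactly 0"
    and \<sigma>: "\<sigma> \<in> ehr_classes k" "\<sigma>' \<in> ehr_classes k"
  shows "chain k (n # ns) \<sigma> = chain k (n # ns) \<sigma>'"
proof -
  obtain X X' h where X: "rooted_tree X" "rooted_tree X'"
    and EV: "EV k X = chain k (n # ns) \<sigma>" "EV k X' = chain k (n # ns) \<sigma>'"
    and h: "agree (length (n # ns)) X X' h" and
    rich: "n # ns \<noteq> [] \<longrightarrow> (\<exists>g\<in>rich_classes k. hd (n # ns) g \<noteq> Exactly 0) \<longrightarrow> rich k X \<and> rich k X'"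
    using chain_trees[OF fin k \<sigma> ns] by (elim exE conjE) (rule that)
  have "rich k X" "rich k X'" using rich g by auto
  moreover have "lef k X X' {(root X, root X')}" using agree_lef[OF X h] len by simp
  ultimately have "EV k X = EV k X'" by (rule EV_eq_if_rich[OF X])
  then show ?thesis using EV by simp
qed

section \<open>Classes of trees of bounded depth\<close>

lemma relpow_subset: "(a, b) \<in> (r :: ('a \<times> 'a) set) ^^ n \<Longrightarrow> r \<subseteq> s \<Longrightarrow> (a, b) \<in> s ^^ n"
  by (induction n arbitrary: b) auto

lemma depth_subtree:
  assumes T: "rooted_tree T" and u: "u \<in> rootchildren T" and a: "a \<in> descendants T u"
  shows "depth T a = Suc (depth (subtree T u) a)"
proof -
  have "(a, u) \<in> parent (subtree T u) ^^ depth (subtree T u) a"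
    using depth_relpow[OF rooted_tree_rootchild[OF T u], of a] a by simp
  then have "(a, u) \<in> parent T ^^ depth (subtree T u) a"
    by (rule relpow_subset) auto
  then have "depth T a = depth T u + depth (subtree T u) a" by (rule depth_parent_relpow[OF T])
  moreover have "depth T u = 1" using depth_parent[OF T, of u "root T"] u T
    by (simp add: rootchild_iff)
  ultimately show ?thesis by simp
qed

text \<open>Classes built by nested applications of \<Gamma> from the zero vector, that is, from a
  root without children. The nesting corresponds to the depth of a tree and not to its number of
  vertices: \<open>Omega\<close> is allowed as a count, so infinite trees of bounded depth are
  included.\<close>

inductive fin_class :: "nat \<Rightarrow> ('v::infinite) rtree set \<Rightarrow> bool" for k where
  "n \<in> ehr_classes k \<rightarrow>\<^sub>E counts k \<Longrightarrow>
   (\<And>i. i \<in> ehr_classes k \<Longrightarrow> n i \<noteq> Exactly 0 \<Longrightarrow> fin_class k i) \<Longrightarrow> fin_class k (Gam k n)"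

lemma fin_class_bounded_depth:
  fixes T :: "('v::infinite) rtree"
  assumes k: "k > 0"
  shows "rooted_tree T \<Longrightarrow> bounded_depth D T \<Longrightarrow> fin_class k (EV k T)"
proof (induction D arbitrary: T rule: less_induct)
  case (less D)
  note T = less.prems(1)
  define n where "n = (\<lambda>c\<in>ehr_classes k. trunc_card k {v \<in> rootchildren T. EV k (subtree T v) = c})"
  have "fin_class k i" if i: "i \<in> ehr_classes k" "n i \<noteq> Exactly 0" for i
  proof -
    have "{v \<in> rootchildren T. EV k (subtree T v) = i} \<noteq> {}"
    proof
      assume "{v \<in> rootchildren T. EV k (subtree T v) = i} = {}"
      then have "n i = trunc_card k ({} :: 'v set)" using i(1) by (simp only: n_def restrict_apply if_True)
      then show False using i(2) k by (simp add: trunc_card_def)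
    qed
    then obtain u where u: "u \<in> rootchildren T" "EV k (subtree T u) = i" by blast
    have d: "Suc (depth (subtree T u) a) \<le> D" if "a \<in> descendants T u" for a
      using depth_subtree[OF T u(1) that] less.prems(2) that
        descendants_subset[OF T rootchild_verts[OF T u(1)]]
      unfolding bounded_depth_def by (metis subsetD)
    then have "0 < D" using descendants_refl[of u T] by fastforce
    moreover have "bounded_depth (D - 1) (subtree T u)"
      unfolding bounded_depth_def using d by fastforce
    ultimately have "fin_class k (EV k (subtree T u))"
      using less.IH[of "D - 1" "subtree T u"] rooted_tree_rootchild[OF T u(1)] by simp
    then show ?thesis using u(2) by simp
  qed
  moreover have "n \<in> ehr_classes k \<rightarrow>\<^sub>E counts k"
    unfolding n_def by (intro restrict_PiE_iff[THEN iffD2] ballI trunc_card_in_counts)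
  ultimately have "fin_class k (Gam k n)" by (intro fin_class.intros)
  moreover have "Gam k n = EV k T" by (rule Gam_eq[OF T]) (simp add: n_def)
  ultimately show ?case by simp
qed

lemma ex_rich_fin_class:
  assumes "k > 0"
  shows "\<exists>g :: ('v::infinite) rtree set. g \<in> rich_classes k \<and> fin_class k g"
proof -
  obtain A :: "'v rtree" and D where A: "rooted_tree A" "rich k A" "bounded_depth D A"
    using ex_rich_bounded_depth by blast
  then have "EV k A \<in> rich_classes k" by (simp add: rich_classes_def)
  then show ?thesis using fin_class_bounded_depth[OF assms A(1,3)] by blast
qed

section \<open>Contraction of the recursion\<close>

lemma finite_counts: "finite (counts k)"
  by (simp add: counts_def)

lemma sum_counts: "(\<Sum>u\<in>counts k. f u) = (\<Sum>u<k. f (Exactly u)) + (f Omega :: real)"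
proof -
  have "sum f (counts k) = sum f (Exactly ` {..<k}) + sum f {Omega}"
    unfolding counts_def by (intro sum.union_disjoint) auto
  also have "sum f (Exactly ` {..<k}) = (\<Sum>u<k. f (Exactly u))"
    by (subst sum.reindex) (simp_all add: inj_on_def)
  finally show ?thesis by simp
qed

lemma sum_count_prob: "(\<Sum>u\<in>counts k. count_prob k r u) = 1"
  by (simp add: sum_counts)

lemma poisson_weight_nonneg: "0 \<le> r \<Longrightarrow> 0 \<le> poisson_weight r u"
  by (simp add: poisson_weight_def)

lemma sum_poisson_weight_le_1:
  assumes "0 \<le> r"
  shows "(\<Sum>u<n. poisson_weight r u) \<le> 1"
proof -
  have s: "(\<lambda>n. r ^ n / fact n) sums exp r"
    using exp_converges[of r] by (simp add: divide_inverse mult.commute)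
  have "(\<Sum>u<n. r ^ u / fact u) \<le> exp r"
    using sum_le_suminf[OF sums_summable[OF s], of "{..<n}"] sums_unique[OF s] assms by simp
  then have "exp (- r) * (\<Sum>u<n. r ^ u / fact u) \<le> exp (- r) * exp r" by (intro mult_left_mono) simp_all
  then show ?thesis by (simp add: poisson_weight_def sum_distrib_left exp_minus field_simps)
qed

lemma count_prob_Omega_ge:
  assumes "0 \<le> r"
  shows "poisson_weight r k \<le> count_prob k r Omega"
  using sum_poisson_weight_le_1[OF assms, of "Suc k"] by simp

lemma count_prob_nonneg: "0 \<le> r \<Longrightarrow> 0 \<le> count_prob k r u"
proof (cases u)
  case (Exactly i)
  assume "0 \<le> r"
  then show ?thesis using Exactly by (simp add: poisson_weight_nonneg)
next
  case Omega
  assume "0 \<le> r"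
  then have "0 \<le> poisson_weight r k" "poisson_weight r k \<le> count_prob k r Omega"
    by (rule poisson_weight_nonneg, rule count_prob_Omega_ge)
  then show ?thesis unfolding Omega by (rule order_trans)
qed

lemma poisson_weight_ge:
  assumes "0 \<le> l" "l \<le> r" "r \<le> c"
  shows "exp (- c) * l ^ u / fact u \<le> poisson_weight r u"
  unfolding poisson_weight_def using assms
  by (intro divide_right_mono mult_mono power_mono) simp_all

text \<open>Explicit bound: the exponential is at least \<open>exp (- c)\<close> and the power is
  monotone. For \<open>Omega\<close> the probability of exactly \<open>k\<close> serves as lower
  bound.\<close>

lemma count_prob_ge:
  assumes "0 < l"
  shows "\<exists>\<epsilon>>0. \<forall>r. l \<le> r \<longrightarrow> r \<le> c \<longrightarrow> \<epsilon> \<le> count_prob k r u"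
proof -
  define v where "v = (case u of Exactly i \<Rightarrow> i | Omega \<Rightarrow> k)"
  have "exp (- c) * l ^ v / fact v \<le> count_prob k r u" if "l \<le> r" "r \<le> c" for r
  proof (cases u)
    case (Exactly i)
    then show ?thesis using poisson_weight_ge[of l r c v] assms that by (simp add: v_def)
  next
    case Omega
    then show ?thesis
      using poisson_weight_ge[of l r c v] count_prob_Omega_ge[of r k] assms that
      by (simp add: v_def)
  qed
  moreover have "0 < exp (- c) * l ^ v / fact v" using assms by simp
  ultimately show ?thesis by blast
qed

text \<open>A Poisson weight has as derivative the preceding weight minus itself; over the counts
  below \<open>k\<close> these differences telescope, leaving the weight at \<open>k - 1\<close> for
  the tail.\<close>

fun count_prob_deriv :: "nat \<Rightarrow> real \<Rightarrow> count \<Rightarrow> real" where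
  "count_prob_deriv k r (Exactly u) =
     (if u = 0 then 0 else poisson_weight r (u - 1)) - poisson_weight r u"
| "count_prob_deriv k r Omega = (if k = 0 then 0 else poisson_weight r (k - 1))"

lemma DERIV_poisson_weight:
  "((\<lambda>r. poisson_weight r u) has_real_derivative count_prob_deriv k r (Exactly u)) (at r)"
proof (cases u)
  case 0
  show ?thesis unfolding poisson_weight_def 0
    by (auto intro!: derivative_eq_intros simp: poisson_weight_def)
next
  case (Suc v)
  have "((\<lambda>r. exp (- r) * r ^ Suc v) has_real_derivative
      exp (- r) * (real (Suc v) * r ^ v) - exp (- r) * r ^ Suc v) (at r)"
    by (auto intro!: derivative_eq_intros simp del: power_Suc)
  then have "((\<lambda>r. exp (- r) * r ^ Suc v / fact (Suc v)) has_real_derivative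
      (exp (- r) * (real (Suc v) * r ^ v) - exp (- r) * r ^ Suc v) / fact (Suc v)) (at r)"
    by (rule DERIV_cdivide)
  moreover have "(exp (- r) * (real (Suc v) * r ^ v) - exp (- r) * r ^ Suc v) / fact (Suc v) =
      exp (- r) * r ^ v / fact v - exp (- r) * r ^ Suc v / fact (Suc v)"
    by (simp add: diff_divide_distrib fact_Suc del: power_Suc of_nat_Suc)
  ultimately show ?thesis by (simp add: poisson_weight_def Suc del: power_Suc fact_Suc)
qed

lemma DERIV_count_prob:
  "((\<lambda>r. count_prob k r u) has_real_derivative count_prob_deriv k r u) (at r)"
proof (cases u)
  case (Exactly i)
  then show ?thesis using DERIV_poisson_weight[of i k r] by simp
next
  case Omega
  define g where "g u = (if u = 0 then 0 else poisson_weight r (u - 1))" for u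
  have "((\<lambda>r. 1 - (\<Sum>u<k. poisson_weight r u)) has_real_derivative
      0 - (\<Sum>u<k. count_prob_deriv k r (Exactly u))) (at r)"
    by (intro DERIV_diff DERIV_const DERIV_sum DERIV_poisson_weight)
  moreover have "(\<Sum>u<k. count_prob_deriv k r (Exactly u)) = (\<Sum>u<k. g u - g (Suc u))"
    by (simp add: g_def)
  then have "(\<Sum>u<k. count_prob_deriv k r (Exactly u)) = g 0 - g k"
    by (simp only: sum_lessThan_telescope')
  ultimately show ?thesis using Omega by (simp add: g_def split: if_splits)
qed

text \<open>For a Poisson variable \<open>N\<close> of mean \<open>r\<close>, the derivative of the
  expectation of \<open>h N\<close> is the expectation of \<open>h (N + 1) - h N\<close>. The
  truncated form is a summation by parts with \<open>g\<close>, the weights shifted by one;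
  \<open>Omega\<close> contributes nothing on the right because \<open>count_up\<close> fixes
  it.\<close>

lemma sum_count_prob_deriv:
  fixes h :: "count \<Rightarrow> real"
  shows "(\<Sum>u\<in>counts k. count_prob_deriv k r u * h u) =
    (\<Sum>u\<in>counts k. count_prob k r u * (h (count_up k u) - h u))"
proof -
  define g where "g u = (if u = 0 then 0 else poisson_weight r (u - 1))" for u
  define H where "H u = h (if u < k then Exactly u else Omega)" for u
  have "(\<Sum>u\<in>counts k. count_prob_deriv k r u * h u) = (\<Sum>u<k. (g u - g (Suc u)) * H u) + g k * H k"
    by (simp add: sum_counts g_def H_def)
  moreover have "(\<Sum>u\<in>counts k. count_prob k r u * (h (count_up k u) - h u)) =
      (\<Sum>u<k. g (Suc u) * (H (Suc u) - H u))"
    by (simp add: sum_counts g_def H_def if_distrib[of h] cong: if_cong)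
  moreover have "(\<Sum>u<k. (g u - g (Suc u)) * H u) - (\<Sum>u<k. g (Suc u) * (H (Suc u) - H u)) =
      (\<Sum>u<k. g u * H u - g (Suc u) * H (Suc u))"
    unfolding sum_subtractf[symmetric] by (intro sum.cong refl) (simp add: algebra_simps)
  moreover have "(\<Sum>u<k. g u * H u - g (Suc u) * H (Suc u)) = - (g k * H k)"
    using sum_lessThan_telescope'[of "\<lambda>u. g u * H u" k] by (simp add: g_def[of 0])
  ultimately show ?thesis by simp
qed

lemma sum_PiE_insert:
  fixes f :: "('a \<Rightarrow> 'b) \<Rightarrow> real"
  assumes "i \<notin> S"
  shows "(\<Sum>a\<in>insert i S \<rightarrow>\<^sub>E C. f a) = (\<Sum>g\<in>S \<rightarrow>\<^sub>E C. \<Sum>u\<in>C. f (g(i := u)))"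
proof -
  have "(\<Sum>a\<in>insert i S \<rightarrow>\<^sub>E C. f a) = (\<Sum>p\<in>C \<times> (S \<rightarrow>\<^sub>E C). f ((\<lambda>(y, g). g(i := y)) p))"
    unfolding PiE_insert_eq using inj_combinator[OF assms] by (subst sum.reindex) (simp_all add: o_def)
  also have "\<dots> = (\<Sum>u\<in>C. \<Sum>g\<in>S \<rightarrow>\<^sub>E C. f (g(i := u)))"
    by (simp add: sum.cartesian_product split_def)
  finally show ?thesis by (subst sum.swap)
qed

text \<open>The decreasing sequence \<open>U\<close> has a limit \<open>L < 1\<close> that lies
  strictly above the fixed-point equation by the defect \<delta>:
  \<open>L = exp (c * (L - 1)) - \<delta>\<close>, so the exponential exceeds \<open>L\<close> there
  by \<delta> and its tangent cannot be steep.\<close>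

lemma contraction_rate:
  fixes c \<delta> :: real
  assumes c: "0 < c" and \<delta>: "0 < \<delta>" and U0: "U 0 = 1" and U: "\<And>n. U (Suc n) = exp (c * (U n - 1)) - \<delta>"
  shows "\<exists>N \<gamma>. \<gamma> < 1 \<and> (\<forall>n\<ge>N. c * exp (c * (U n - 1)) \<le> \<gamma>)"
proof -
  have step: "U (Suc n) \<le> U n" for n
  proof (induction n)
    case 0
    then show ?case using \<delta> by (simp add: U U0)
  next
    case (Suc n)
    then have "exp (c * (U (Suc n) - 1)) \<le> exp (c * (U n - 1))" using c by simp
    then show ?case unfolding U[of "Suc n"] U[of n] by simp
  qed
  have lower: "- \<delta> \<le> U n" for n
  proof (cases n)
    case 0
    then show ?thesis using U0 \<delta> by simp
  next
    case (Suc m)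
    then show ?thesis using U[of m] by simp
  qed
  have "decseq U" using step by (rule decseq_SucI)
  then obtain L where L: "U \<longlonglongrightarrow> L" using lower decseq_convergent[of U "- \<delta>"] by blast
  have "(\<lambda>n. exp (c * (U n - 1)) - \<delta>) \<longlonglongrightarrow> exp (c * (L - 1)) - \<delta>"
    by (intro tendsto_intros L)
  moreover have "(\<lambda>n. U (Suc n)) \<longlonglongrightarrow> L" using L by (rule LIMSEQ_Suc)
  ultimately have L_eq: "L = exp (c * (L - 1)) - \<delta>"
    unfolding U by (rule LIMSEQ_unique[rotated])
  have "L \<le> U 1" using decseq_ge[OF \<open>decseq U\<close> L] .
  then have L1: "L < 1" using U[of 0] U0 \<delta> by simp
  let ?e = "exp (c * (L - 1))"
  \<comment> \<open>The curve \<open>exp (c * (u - 1))\<close> has the value 1 at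
    \<open>u = 1\<close>, and its tangent at \<open>L\<close> lies below it. The slope
    \<open>c * ?e\<close> is thus at most \<open>(1 - ?e) / (1 - L)\<close>.\<close>
  have "1 = ?e * exp (c * (1 - L))" by (simp flip: exp_add add: algebra_simps)
  also have "\<dots> \<ge> ?e * (1 + c * (1 - L))"
    using exp_ge_add_one_self[of "c * (1 - L)"] by (intro mult_left_mono) simp_all
  finally have "?e * (1 + c * (1 - L)) \<le> 1" by simp
  then have "(c * ?e) * (1 - L) \<le> 1 - ?e" by (simp add: algebra_simps)
  also have "\<dots> < 1 * (1 - L)" using L_eq \<delta> by simp
  finally have lt: "c * ?e < 1" using L1 by (simp only: mult_less_cancel_right)
  define \<gamma> where "\<gamma> = (1 + c * ?e) / 2"
  have "(\<lambda>n. c * exp (c * (U n - 1))) \<longlonglongrightarrow> c * ?e" by (intro tendsto_intros L)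
  moreover have "c * ?e < \<gamma>" using lt by (simp add: \<gamma>_def)
  ultimately have "\<forall>\<^sub>F n in sequentially. c * exp (c * (U n - 1)) < \<gamma>" by (rule order_tendstoD(2))
  then obtain N where "\<forall>n\<ge>N. c * exp (c * (U n - 1)) < \<gamma>" unfolding eventually_sequentially by blast
  then have "\<forall>n\<ge>N. c * exp (c * (U n - 1)) \<le> \<gamma>" using less_imp_le by blast
  moreover have "\<gamma> < 1" using lt by (simp add: \<gamma>_def)
  ultimately show ?thesis by blast
qed

section \<open>Expectations over child counts and their derivatives\<close>

locale finite_classes =
  fixes k :: nat and c :: real and S :: "('v::infinite) rtree set set"
  assumes k: "k > 0" and c: "c > 0" and fin: "finite S" and S: "S = ehr_classes k"
begin

abbreviation A :: "('v rtree set \<Rightarrow> count) set" where "A \<equiv> S \<rightarrow>\<^sub>E counts k"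

abbreviation D :: "('v rtree set \<Rightarrow> real) set" where "D \<equiv> distrs k"

definition weight :: "('v rtree set \<Rightarrow> real) \<Rightarrow> ('v rtree set \<Rightarrow> count) \<Rightarrow> real" where
  "weight x a = (\<Prod>i\<in>S. count_prob k (c * x i) (a i))"

definition E :: "('v rtree set \<Rightarrow> real) \<Rightarrow> (('v rtree set \<Rightarrow> count) \<Rightarrow> real) \<Rightarrow> real" where
  "E x H = (\<Sum>a\<in>A. weight x a * H a)"

lemma fin_A: "finite A"
  by (intro finite_PiE fin finite_counts)

lemma Psi_eq: "Psi k c x j = E x (\<lambda>a. of_bool (Gam k a = j))"
  unfolding Psi_def E_def weight_def S[symmetric]
  by (subst sum.inter_filter[OF fin_A]) (auto intro: sum.cong)

lemma E_prod: "E x (\<lambda>a. \<Prod>i\<in>S. g i (a i)) = (\<Prod>i\<in>S. \<Sum>u\<in>counts k. count_prob k (c * x i) u * g i u)"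
  unfolding E_def weight_def prod.distrib[symmetric]
  by (rule prod_sum_PiE[symmetric]) (simp_all add: fin finite_counts)

lemma E_1: "E x (\<lambda>_. 1) = 1"
  using E_prod[of x "\<lambda>_ _. 1"] by (simp add: sum_count_prob)

lemma E_sum: "E x (\<lambda>a. \<Sum>i\<in>J. f i a) = (\<Sum>i\<in>J. E x (f i))"
  unfolding E_def sum_distrib_left by (rule sum.swap)

lemma E_cmult: "E x (\<lambda>a. r * f a) = r * E x f"
  by (simp add: E_def sum_distrib_left mult_ac)

lemma E_diff: "E x (\<lambda>a. f a - g a) = E x f - E x g"
  by (simp add: E_def right_diff_distrib sum_subtractf)

lemma E_cong: "(\<And>a. a \<in> A \<Longrightarrow> f a = g a) \<Longrightarrow> E x f = E x g"
  unfolding E_def by (intro sum.cong) simp_all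

lemma Gam_S: "a \<in> A \<Longrightarrow> Gam k a \<in> S"
  using Gam_in_classes[of k a] fin k by (simp add: S)

lemma feed_S: "a \<in> A \<Longrightarrow> i \<in> S \<Longrightarrow> feed k a i \<in> S"
  using feed_in_classes[of k a i] fin k by (simp add: S)

lemma sum_indicator: "s \<in> S \<Longrightarrow> (\<Sum>j\<in>S. of_bool (s = j) * h j) = (h s :: real)"
  using fin by (simp add: of_bool_def if_distrib[of "\<lambda>z. z * _"] sum.delta' cong: if_cong)

lemma D_nonneg: "x \<in> D \<Longrightarrow> i \<in> S \<Longrightarrow> 0 \<le> x i"
  by (simp add: distrs_def S)

lemma D_sum: "x \<in> D \<Longrightarrow> sum x S = 1"
  by (simp add: distrs_def S)

lemma D_le_1: "x \<in> D \<Longrightarrow> i \<in> S \<Longrightarrow> x i \<le> 1"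
  using member_le_sum[of i S x] fin D_nonneg D_sum by fastforce

lemma weight_nonneg: "x \<in> D \<Longrightarrow> 0 \<le> weight x a"
  unfolding weight_def using c D_nonneg by (intro prod_nonneg) (auto intro!: count_prob_nonneg)

lemma E_mono:
  assumes "x \<in> D" "\<And>a. a \<in> A \<Longrightarrow> f a \<le> g a"
  shows "E x f \<le> E x g"
  unfolding E_def using assms weight_nonneg by (intro sum_mono mult_left_mono) simp_all

lemma E_ge_weight:
  assumes x: "x \<in> D" and a: "a \<in> A" "f a = 1" and f: "\<And>b. b \<in> A \<Longrightarrow> 0 \<le> f b"
  shows "weight x a \<le> E x f"
proof -
  have "weight x a = weight x a * f a" by (simp add: a)
  also have "\<dots> \<le> E x f"
    unfolding E_def using a(1) fin_A f weight_nonneg[OF x]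
    by (intro member_le_sum[of a A "\<lambda>a. weight x a * f a"]) auto
  finally show ?thesis .
qed

lemma Psi_D:
  assumes "x \<in> D"
  shows "Psi k c x \<in> D"
proof -
  have "E x (\<lambda>_. 0) \<le> Psi k c x j" for j unfolding Psi_eq by (rule E_mono[OF assms]) simp
  then have "0 \<le> Psi k c x j" for j by (simp add: E_def)
  moreover have "Psi k c x j = 0" if "j \<notin> S" for j
  proof -
    have "Psi k c x j = E x (\<lambda>_. 0)" unfolding Psi_eq using Gam_S that by (intro E_cong) auto
    then show ?thesis by (simp add: E_def)
  qed
  moreover have "(\<Sum>j\<in>S. Psi k c x j) = E x (\<lambda>a. \<Sum>j\<in>S. of_bool (Gam k a = j) * 1)"
    unfolding Psi_eq by (subst E_sum) simp
  moreover have "E x (\<lambda>a. \<Sum>j\<in>S. of_bool (Gam k a = j) * 1) = E x (\<lambda>_. 1)"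
    using sum_indicator[OF Gam_S, of _ "\<lambda>_. 1"] by (intro E_cong)
  ultimately show ?thesis unfolding distrs_def S[symmetric] by (simp add: E_1)
qed

lemma Psi_pow_D: "x \<in> D \<Longrightarrow> (Psi k c ^^ n) x \<in> D"
  by (induction n) (simp_all add: Psi_D)

text \<open>The counts of different classes are independent, so coordinate \<open>i\<close> can be
  split off and differentiated alone by \<open>sum_count_prob_deriv\<close>.\<close>

lemma sum_weight_deriv:
  assumes i: "i \<in> S"
  shows "(\<Sum>a\<in>A. count_prob_deriv k (c * x i) (a i) * (\<Prod>l\<in>S - {i}. count_prob k (c * x l) (a l)) * H a) =
    E x (\<lambda>a. H (a(i := count_up k (a i))) - H a)"
proof -
  define B where "B = (S - {i} \<rightarrow>\<^sub>E counts k)"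
  define q where "q g = (\<Prod>l\<in>S - {i}. count_prob k (c * x l) (g l))" for g
  have Si: "insert i (S - {i}) = S" using i by blast
  have q_upd: "(\<Prod>l\<in>S - {i}. count_prob k (c * x l) ((g(i := u)) l)) = q g" for g u
    unfolding q_def by (intro prod.cong) auto
  have w_upd: "weight x (g(i := u)) = count_prob k (c * x i) u * q g" for g u
    unfolding weight_def prod.remove[OF fin i] q_upd by simp
  have split: "(\<Sum>a\<in>A. f a) = (\<Sum>g\<in>B. \<Sum>u\<in>counts k. f (g(i := u)))" for f :: "_ \<Rightarrow> real"
    using sum_PiE_insert[of i "S - {i}" f "counts k"] unfolding Si B_def by simp
  have "(\<Sum>a\<in>A. count_prob_deriv k (c * x i) (a i) * (\<Prod>l\<in>S - {i}. count_prob k (c * x l) (a l)) * H a) =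
      (\<Sum>g\<in>B. q g * (\<Sum>u\<in>counts k. count_prob_deriv k (c * x i) u * H (g(i := u))))"
    unfolding split q_upd by (simp add: sum_distrib_left mult_ac)
  also have "\<dots> = (\<Sum>g\<in>B. q g * (\<Sum>u\<in>counts k. count_prob k (c * x i) u *
      (H (g(i := count_up k u)) - H (g(i := u)))))"
    by (subst sum_count_prob_deriv) simp
  also have "\<dots> = E x (\<lambda>a. H (a(i := count_up k (a i))) - H a)"
    unfolding E_def split w_upd by (simp add: sum_distrib_left mult_ac)
  finally show ?thesis .
qed

lemma E_has_derivative:
  assumes z: "\<And>i. i \<in> S \<Longrightarrow> ((\<lambda>t. z t i) has_real_derivative z' i) (at t)"
  shows "((\<lambda>t. E (z t) H) has_real_derivative
    c * (\<Sum>i\<in>S. z' i * E (z t) (\<lambda>a. H (a(i := count_up k (a i))) - H a))) (at t)"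
proof -
  have q: "((\<lambda>t. count_prob k (c * z t i) u) has_real_derivative
      count_prob_deriv k (c * z t i) u * (c * z' i)) (at t)" if "i \<in> S" for i u
    by (rule DERIV_chain2[OF DERIV_count_prob]) (intro DERIV_cmult z that)
  have "((\<lambda>t. weight (z t) a) has_real_derivative
      (\<Sum>i\<in>S. count_prob_deriv k (c * z t i) (a i) * (c * z' i) *
        (\<Prod>l\<in>S - {i}. count_prob k (c * z t l) (a l)))) (at t)" for a
    unfolding weight_def by (rule has_field_derivative_prod) (rule q)
  then have "((\<lambda>t. E (z t) H) has_real_derivative
      (\<Sum>a\<in>A. (\<Sum>i\<in>S. count_prob_deriv k (c * z t i) (a i) * (c * z' i) *
        (\<Prod>l\<in>S - {i}. count_prob k (c * z t l) (a l))) * H a)) (at t)"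
    unfolding E_def by (intro DERIV_sum DERIV_cmult_right)
  moreover have "(\<Sum>a\<in>A. (\<Sum>i\<in>S. count_prob_deriv k (c * z t i) (a i) * (c * z' i) *
        (\<Prod>l\<in>S - {i}. count_prob k (c * z t l) (a l))) * H a) =
      (\<Sum>i\<in>S. c * z' i * (\<Sum>a\<in>A. count_prob_deriv k (c * z t i) (a i) *
        (\<Prod>l\<in>S - {i}. count_prob k (c * z t l) (a l)) * H a))"
    unfolding sum_distrib_right sum_distrib_left
    by (subst sum.swap) (intro sum.cong refl, simp add: mult_ac)
  moreover have "\<dots> = (\<Sum>i\<in>S. c * (z' i * E (z t) (\<lambda>a. H (a(i := count_up k (a i))) - H a)))"
  proof (rule sum.cong[OF refl])
    fix i assume i: "i \<in> S"
    show "c * z' i * (\<Sum>a\<in>A. count_prob_deriv k (c * z t i) (a i) *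
        (\<Prod>l\<in>S - {i}. count_prob k (c * z t l) (a l)) * H a) =
      c * (z' i * E (z t) (\<lambda>a. H (a(i := count_up k (a i))) - H a))"
      unfolding sum_weight_deriv[OF i] by (rule mult.assoc)
  qed
  ultimately show ?thesis by (simp only: sum_distrib_left)
qed

text \<open>The derivative of an expectation contains the differences
  \<open>H (N + 1) - H N\<close>. As \<open>z'\<close> sums to zero the subtracted terms cancel, and
  what remains is \<open>c\<close> times an average of push-forwards of \<open>z'\<close>.\<close>

lemma Psi_has_derivative:
  assumes z: "\<And>i. i \<in> S \<Longrightarrow> ((\<lambda>t. z t i) has_real_derivative z' i) (at t)"
    and sum0: "sum z' S = 0"
  shows "((\<lambda>t. Psi k c (z t) j) has_real_derivative
    c * (\<Sum>i\<in>S. z' i * E (z t) (\<lambda>a. of_bool (feed k a i = j)))) (at t)"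
proof -
  have "((\<lambda>t. E (z t) (\<lambda>a. of_bool (Gam k a = j))) has_real_derivative
    c * (\<Sum>i\<in>S. z' i * E (z t) (\<lambda>a. of_bool (Gam k (a(i := count_up k (a i))) = j)
      - of_bool (Gam k a = j)))) (at t)"
    by (rule E_has_derivative[OF z])
  moreover have "(\<Sum>i\<in>S. z' i * E (z t) (\<lambda>a. of_bool (Gam k (a(i := count_up k (a i))) = j)
      - of_bool (Gam k a = j))) =
      (\<Sum>i\<in>S. z' i * E (z t) (\<lambda>a. of_bool (feed k a i = j))) -
      sum z' S * E (z t) (\<lambda>a. of_bool (Gam k a = j))"
    unfolding E_diff feed_def
    by (simp add: right_diff_distrib sum_subtractf sum_distrib_right)
  ultimately show ?thesis unfolding Psi_eq using sum0 by simp
qed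

section \<open>The probability of a rich class\<close>

definition G :: "'v rtree set set" where "G = rich_classes k"

definition mass :: "('v rtree set \<Rightarrow> real) \<Rightarrow> real" where "mass x = sum x G"

definition avoids_G :: "('v rtree set \<Rightarrow> count) \<Rightarrow> bool" where
  "avoids_G a \<longleftrightarrow> (\<forall>g\<in>G. a g = Exactly 0)"

lemma G_S: "G \<subseteq> S"
  unfolding G_def S rich_classes_def using EV_in_classes by auto

lemma finite_G: "finite G"
  using G_S fin by (rule finite_subset)

text \<open>The number of children with a class in \<open>G\<close> is Poisson with mean
  \<open>c * mass x\<close>; this is its probability of being zero.\<close>

lemma E_avoids_G: "E x (\<lambda>a. of_bool (avoids_G a)) = exp (- (c * mass x))"
proof -
  define g where "g i u = (if i \<in> G \<and> u \<noteq> Exactly 0 then 0 else 1 :: real)" for i u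
  have "E x (\<lambda>a. of_bool (avoids_G a)) = E x (\<lambda>a. \<Prod>i\<in>S. g i (a i))"
  proof (rule E_cong)
    fix a show "of_bool (avoids_G a) = (\<Prod>i\<in>S. g i (a i))"
    proof (cases "avoids_G a")
      case True
      then have "\<forall>i\<in>S. g i (a i) = 1" by (simp add: avoids_G_def g_def)
      then show ?thesis using True by (simp add: prod.neutral)
    next
      case False
      then obtain i where "i \<in> G" "a i \<noteq> Exactly 0" unfolding avoids_G_def by blast
      then have "\<exists>i\<in>S. g i (a i) = 0" using G_S by (auto simp: g_def)
      then show ?thesis using False fin by simp
    qed
  qed
  also have "\<dots> = (\<Prod>i\<in>S. if i \<in> G then exp (- (c * x i)) else 1)"
    unfolding E_prod
  proof (rule prod.cong[OF refl])
    fix i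
    show "(\<Sum>u\<in>counts k. count_prob k (c * x i) u * g i u) =
        (if i \<in> G then exp (- (c * x i)) else 1)"
    proof (cases "i \<in> G")
      case True
      have "(\<Sum>u<k. count_prob k (c * x i) (Exactly u) * g i (Exactly u)) =
          (\<Sum>u<k. if u = 0 then poisson_weight (c * x i) 0 else 0)"
        by (intro sum.cong) (auto simp: g_def True)
      also have "\<dots> = poisson_weight (c * x i) 0" using k by (subst sum.delta) simp_all
      finally show ?thesis
        using True by (simp add: sum_counts g_def poisson_weight_def del: count_prob.simps)
    next
      case False
      then show ?thesis by (simp add: g_def sum_count_prob)
    qed
  qed
  also have "\<dots> = (\<Prod>i\<in>G. exp (- (c * x i)))"
    using fin G_S by (simp add: prod.inter_restrict[symmetric] Int_absorb1)
  also have "\<dots> = exp (- (c * mass x))"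
    by (simp add: exp_sum[OF finite_G, symmetric] mass_def sum_distrib_left sum_negf)
  finally show ?thesis .
qed

text \<open>By \<open>Gam_rich\<close>, a class outside \<open>G\<close> can arise only if no child
  has a class in \<open>G\<close>. The vector \<open>a\<close> belongs to that event and still leads
  into \<open>G\<close>, so its probability can be subtracted.\<close>

lemma mass_Psi:
  assumes x: "x \<in> D" and a: "a \<in> A" "avoids_G a" "Gam k a \<in> G"
  shows "1 - mass (Psi k c x) \<le> exp (- (c * mass x)) - weight x a"
proof -
  have "mass (Psi k c x) = E x (\<lambda>b. \<Sum>g\<in>G. of_bool (Gam k b = g))"
    unfolding mass_def Psi_eq E_sum ..
  also have "\<dots> = E x (\<lambda>b. of_bool (Gam k b \<in> G))"
    using finite_G by (intro E_cong) (simp add: of_bool_def sum.delta')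
  finally have "1 - mass (Psi k c x) = E x (\<lambda>b. 1 - of_bool (Gam k b \<in> G))"
    unfolding E_diff E_1 by simp
  also have "\<dots> \<le> E x (\<lambda>b. of_bool (avoids_G b) - of_bool (b = a))"
  proof (rule E_mono[OF x])
    fix b assume b: "b \<in> A"
    show "1 - of_bool (Gam k b \<in> G) \<le> (of_bool (avoids_G b) - of_bool (b = a) :: real)"
    proof (cases "avoids_G b")
      case True
      then show ?thesis using a by (cases "b = a") auto
    next
      case False
      then obtain g where "g \<in> G" "b g \<noteq> Exactly 0" unfolding avoids_G_def by blast
      then have "Gam k b \<in> G"
        using Gam_rich[of k b g] fin k b unfolding G_def S by blast
      then show ?thesis using False a(2) by auto
    qed
  qed
  also have "\<dots> = exp (- (c * mass x)) - weight x a"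
  proof -
    have "E x (\<lambda>b. of_bool (b = a)) = weight x a"
      unfolding E_def using fin_A a(1)
      by (simp add: of_bool_def if_distrib[of "\<lambda>z. _ * z"] sum.delta cong: if_cong)
    then show ?thesis unfolding E_diff E_avoids_G by simp
  qed
  finally show ?thesis .
qed

text \<open>The bound is uniform over all starting points and all late iterates, since the
  contraction factor has to be the same on the whole of \<open>D\<close>.\<close>

definition ev_positive :: "'v rtree set \<Rightarrow> bool" where
  "ev_positive i \<longleftrightarrow> (\<exists>\<delta>>0. \<exists>N. \<forall>m\<ge>N. \<forall>x\<in>D. \<delta> \<le> (Psi k c ^^ m) x i)"

text \<open>A coordinate with count 0 has probability at least \<open>exp (- c)\<close> because no
  entry of a distribution exceeds 1. The other coordinates have means between a positive bound and
  \<open>c\<close>, and \<open>count_prob_ge\<close> applies.\<close>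

lemma ev_weight_positive:
  assumes n: "n \<in> A" and pos: "\<And>i. i \<in> S \<Longrightarrow> n i \<noteq> Exactly 0 \<Longrightarrow> ev_positive i"
  shows "\<exists>\<delta>>0. \<exists>N. \<forall>m\<ge>N. \<forall>x\<in>D. \<delta> \<le> weight ((Psi k c ^^ m) x) n"
proof -
  define Q where "Q i \<delta> N \<longleftrightarrow> (\<forall>m\<ge>N. \<forall>x\<in>D. \<delta> \<le> count_prob k (c * (Psi k c ^^ m) x i) (n i))" for i \<delta> N
  have "\<exists>\<delta>. 0 < \<delta> \<and> (\<exists>N. Q i \<delta> N)" if i: "i \<in> S" for i
  proof (cases "n i = Exactly 0")
    case True
    have "exp (- c) \<le> count_prob k (c * (Psi k c ^^ m) x i) (n i)" if "x \<in> D" for m x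
      using D_le_1[OF Psi_pow_D[OF that] i, of m] c True by (simp add: poisson_weight_def)
    then show ?thesis by (intro exI[of _ "exp (- c)"] conjI exI[of _ 0]) (simp_all add: Q_def)
  next
    case False
    obtain \<delta> N where \<delta>: "0 < \<delta>" and N: "\<forall>m\<ge>N. \<forall>x\<in>D. \<delta> \<le> (Psi k c ^^ m) x i"
      using pos[OF i False] unfolding ev_positive_def by blast
    have "0 < c * \<delta>" using c \<delta> by simp
    then obtain \<epsilon> where \<epsilon>: "0 < \<epsilon>"
      and *: "\<forall>r. c * \<delta> \<le> r \<longrightarrow> r \<le> c \<longrightarrow> \<epsilon> \<le> count_prob k r (n i)"
      using count_prob_ge[of "c * \<delta>" c k "n i"] by blast
    have "\<epsilon> \<le> count_prob k (c * (Psi k c ^^ m) x i) (n i)" if "N \<le> m" "x \<in> D" for m x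
      using N[rule_format, OF that] D_le_1[OF Psi_pow_D[OF that(2)] i, of m] c
      by (intro *[rule_format]) simp_all
    then have "Q i \<epsilon> N" by (simp add: Q_def)
    then show ?thesis using \<epsilon> by blast
  qed
  then have "\<forall>i\<in>S. \<exists>\<delta>. 0 < \<delta> \<and> (\<exists>N. Q i \<delta> N)" by simp
  from bchoice[OF this] obtain \<delta> where \<delta>: "\<forall>i\<in>S. 0 < \<delta> i \<and> (\<exists>N. Q i (\<delta> i) N)" ..
  then have "\<forall>i\<in>S. \<exists>N. Q i (\<delta> i) N" by simp
  from bchoice[OF this] obtain N where N: "\<forall>i\<in>S. Q i (\<delta> i) (N i)" ..
  \<comment> \<open>The sum of the thresholds stands in for their maximum.\<close>
  have "prod \<delta> S \<le> weight ((Psi k c ^^ m) x) n" if m: "sum N S \<le> m" and x: "x \<in> D" for m x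
    unfolding weight_def
  proof (rule prod_mono)
    fix i assume i: "i \<in> S"
    have "N i \<le> m" using member_le_sum[of i S N] i fin m by simp
    then show "0 \<le> \<delta> i \<and> \<delta> i \<le> count_prob k (c * (Psi k c ^^ m) x i) (n i)"
      using N \<delta> i x by (simp add: Q_def less_imp_le)
  qed
  moreover have "0 < prod \<delta> S" using \<delta> by (intro prod_pos) simp
  ultimately show ?thesis by blast
qed

text \<open>Each application of \<Gamma> in the derivation of the class costs one further
  iterate.\<close>

lemma fin_class_ev_positive:
  "fin_class k \<sigma> \<Longrightarrow> ev_positive \<sigma>"
proof (induction rule: fin_class.induct)
  case (1 n)
  then have n: "n \<in> A" by (simp add: S)
  obtain \<delta> N where \<delta>: "0 < \<delta>" and N: "\<forall>m\<ge>N. \<forall>x\<in>D. \<delta> \<le> weight ((Psi k c ^^ m) x) n"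
    using ev_weight_positive[OF n] 1 unfolding S by blast
  have "\<delta> \<le> (Psi k c ^^ m) x (Gam k n)" if m: "Suc N \<le> m" and x: "x \<in> D" for m x
  proof -
    obtain l where l: "m = Suc l" "N \<le> l" using m by (cases m) auto
    have "\<delta> \<le> weight ((Psi k c ^^ l) x) n" using N l(2) x by simp
    also have "\<dots> \<le> Psi k c ((Psi k c ^^ l) x) (Gam k n)"
      unfolding Psi_eq[of "(Psi k c ^^ l) x" "Gam k n"]
      by (rule E_ge_weight[OF Psi_pow_D[OF x] n]) simp_all
    finally show ?thesis by (simp add: l(1))
  qed
  then show ?case unfolding ev_positive_def using \<delta> by blast
qed

text \<open>Descending in the derivation as long as some child has a class in \<open>G\<close> ends
  at a vector that produces a rich class from children none of which has one. Such a vector is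
  needed because \<open>mass_Psi\<close> gains only from vectors that avoid
  \<open>G\<close>.\<close>

lemma fin_class_minimal:
  "fin_class k \<sigma> \<Longrightarrow> \<sigma> \<in> G \<Longrightarrow>
    \<exists>n\<in>A. avoids_G n \<and> Gam k n \<in> G \<and> (\<forall>i\<in>S. n i \<noteq> Exactly 0 \<longrightarrow> fin_class k i)"
proof (induction rule: fin_class.induct)
  case (1 n)
  show ?case
  proof (cases "avoids_G n")
    case True
    then show ?thesis using 1 unfolding S by blast
  next
    case False
    then obtain g where g: "g \<in> G" "n g \<noteq> Exactly 0" unfolding avoids_G_def by blast
    then have "g \<in> ehr_classes k" using G_S S by blast
    from 1(3)[OF this g(2,1)] show ?thesis .
  qed
qed

lemma ex_rate:
  "\<exists>N \<gamma>. 0 \<le> \<gamma> \<and> \<gamma> < 1 \<and> (\<forall>m\<ge>N. \<forall>x\<in>D. c * exp (- (c * mass ((Psi k c ^^ m) x))) \<le> \<gamma>)"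
proof -
  obtain n where n: "n \<in> A" "avoids_G n" "Gam k n \<in> G"
    and fin_n: "\<forall>i\<in>S. n i \<noteq> Exactly 0 \<longrightarrow> fin_class k i"
    using ex_rich_fin_class[OF k] fin_class_minimal unfolding G_def by blast
  obtain \<delta> M where \<delta>: "0 < \<delta>" and M: "\<forall>m\<ge>M. \<forall>x\<in>D. \<delta> \<le> weight ((Psi k c ^^ m) x) n"
    using ev_weight_positive[OF n(1)] fin_n fin_class_ev_positive by blast
  \<comment> \<open>At iterate \<open>M\<close> nothing is known beyond the trivial bound 1; from
    there on the weight of \<open>n\<close> is at least \<delta>, so each step gains
    \<delta>.\<close>
  define U where "U = rec_nat 1 (\<lambda>_ u. exp (c * (u - 1)) - \<delta>)"
  have U: "U 0 = 1" "U (Suc m) = exp (c * (U m - 1)) - \<delta>" for m by (simp_all add: U_def)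
  have le: "1 - mass ((Psi k c ^^ (M + m)) x) \<le> U m" if x: "x \<in> D" for m x
  proof (induction m)
    case 0
    have "0 \<le> mass ((Psi k c ^^ M) x)"
      unfolding mass_def using D_nonneg[OF Psi_pow_D[OF x]] G_S by (intro sum_nonneg) blast
    then show ?case by (simp add: U)
  next
    case (Suc m)
    let ?y = "(Psi k c ^^ (M + m)) x"
    have "1 - mass (Psi k c ?y) \<le> exp (- (c * mass ?y)) - weight ?y n"
      by (rule mass_Psi[OF Psi_pow_D[OF x] n])
    also have "\<dots> \<le> exp (c * (U m - 1)) - \<delta>"
    proof (rule diff_mono)
      have "- (c * mass ?y) = c * ((1 - mass ?y) - 1)" by (simp add: algebra_simps)
      also have "\<dots> \<le> c * (U m - 1)" using Suc.IH c by (intro mult_left_mono) simp_all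
      finally show "exp (- (c * mass ?y)) \<le> exp (c * (U m - 1))" by simp
      show "\<delta> \<le> weight ?y n" using M x by simp
    qed
    finally show ?case by (simp add: U)
  qed
  obtain N \<gamma> where \<gamma>: "\<gamma> < 1" and N: "\<forall>m\<ge>N. c * exp (c * (U m - 1)) \<le> \<gamma>"
    using contraction_rate[OF c \<delta> U] by blast
  have "0 < c * exp (c * (U N - 1))" using c by simp
  also have "\<dots> \<le> \<gamma>" using N by simp
  finally have "0 \<le> \<gamma>" by simp
  moreover have "c * exp (- (c * mass ((Psi k c ^^ m) x))) \<le> \<gamma>" if m: "M + N \<le> m" and x: "x \<in> D" for m x
  proof -
    have "- (c * mass ((Psi k c ^^ m) x)) = c * ((1 - mass ((Psi k c ^^ m) x)) - 1)"
      by (simp add: algebra_simps)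
    also have "\<dots> \<le> c * (U (m - M) - 1)"
      using le[OF x, of "m - M"] m c by (intro mult_left_mono) simp_all
    finally have "c * exp (- (c * mass ((Psi k c ^^ m) x))) \<le> c * exp (c * (U (m - M) - 1))"
      using c by simp
    also have "\<dots> \<le> \<gamma>" using N m by simp
    finally show ?thesis .
  qed
  ultimately show ?thesis using \<gamma> by blast
qed

section \<open>The derivative of the iterates along a segment\<close>

definition path :: "('v rtree set \<Rightarrow> real) \<Rightarrow> ('v rtree set \<Rightarrow> real) \<Rightarrow> nat \<Rightarrow> real \<Rightarrow> 'v rtree set \<Rightarrow> real" where
  "path x y n t = (Psi k c ^^ n) (\<lambda>i. y i + t * (x i - y i))"

text \<open>Defined by the recursion that the chain rule will produce. The vanishing of its sum can
  then be shown first, which \<open>Psi_has_derivative\<close> needs before \<open>dpath\<close> is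
  known to be the derivative.\<close>

primrec dpath :: "('v rtree set \<Rightarrow> real) \<Rightarrow> ('v rtree set \<Rightarrow> real) \<Rightarrow> nat \<Rightarrow> real \<Rightarrow> 'v rtree set \<Rightarrow> real" where
  "dpath x y 0 t = (\<lambda>j. x j - y j)"
| "dpath x y (Suc n) t =
     (\<lambda>j. c * (\<Sum>i\<in>S. dpath x y n t i * E (path x y n t) (\<lambda>a. of_bool (feed k a i = j))))"

lemma path_D:
  assumes x: "x \<in> D" and y: "y \<in> D" and t: "0 \<le> t" "t \<le> 1"
  shows "path x y n t \<in> D"
proof -
  have conv: "y i + t * (x i - y i) = (1 - t) * y i + t * x i" for i by (simp add: algebra_simps)
  have "(\<lambda>i. y i + t * (x i - y i)) \<in> D"
    unfolding conv distrs_def S[symmetric]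
    using x y t D_nonneg[OF x] D_nonneg[OF y] D_sum[OF x] D_sum[OF y]
    by (auto simp: distrs_def S[symmetric] sum.distrib sum_distrib_left[symmetric])
  then show ?thesis unfolding path_def by (rule Psi_pow_D)
qed

lemma dpath_Suc_eq:
  "dpath x y (Suc n) t j =
    c * E (path x y n t) (\<lambda>a. \<Sum>i\<in>S. dpath x y n t i * of_bool (feed k a i = j))"
  by (simp add: E_sum E_cmult)

text \<open>The dual of the statement that a composition of maps \<open>feed\<close> which is constant kills vectors of
  sum zero: by induction, applying \<open>h\<close> to the derivative averages \<open>h\<close> along such compositions.\<close>

lemma sum_dpath_eq_0:
  fixes h :: "'v rtree set \<Rightarrow> real"
  assumes xy: "x \<in> D" "y \<in> D"
    and h: "\<And>ns \<sigma> \<sigma>'. length ns = n \<Longrightarrow> set ns \<subseteq> A \<Longrightarrow> \<sigma> \<in> S \<Longrightarrow> \<sigma>' \<in> S \<Longrightarrow>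
      h (chain k ns \<sigma>) = h (chain k ns \<sigma>')"
  shows "(\<Sum>j\<in>S. h j * dpath x y n t j) = 0"
  using h
proof (induction n arbitrary: h)
  case 0
  have eq: "h i = h j" if "i \<in> S" "j \<in> S" for i j using 0[of "[]" i j] that by simp
  have "S \<noteq> {}" using D_sum[OF xy(1)] by auto
  then obtain i where i: "i \<in> S" by blast
  have "(\<Sum>j\<in>S. h j * (x j - y j)) = (\<Sum>j\<in>S. h i * (x j - y j))"
    using eq[OF i] by (intro sum.cong) simp_all
  also have "\<dots> = h i * (sum x S - sum y S)"
    by (simp only: sum_distrib_left[symmetric] sum_subtractf)
  finally show ?case using D_sum xy by simp
next
  case (Suc n)
  let ?w = "dpath x y n t"
  have zero: "(\<Sum>j\<in>S. h j * (\<Sum>i\<in>S. ?w i * of_bool (feed k a i = j))) = 0" if a: "a \<in> A" for a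
  proof -
    have "(\<Sum>j\<in>S. h j * (\<Sum>i\<in>S. ?w i * of_bool (feed k a i = j))) =
        (\<Sum>i\<in>S. ?w i * (\<Sum>j\<in>S. of_bool (feed k a i = j) * h j))"
      unfolding sum_distrib_left by (subst sum.swap) (simp add: mult_ac)
    also have "\<dots> = (\<Sum>i\<in>S. h (feed k a i) * ?w i)"
      by (intro sum.cong refl) (simp add: sum_indicator[OF feed_S[OF a]])
    also have "\<dots> = 0"
    proof (rule Suc.IH)
      fix ns \<sigma> \<sigma>' assume "length ns = n" "set ns \<subseteq> A" "\<sigma> \<in> S" "\<sigma>' \<in> S"
      then show "h (feed k a (chain k ns \<sigma>)) = h (feed k a (chain k ns \<sigma>'))"
        using Suc.prems[of "a # ns" \<sigma> \<sigma>'] a by simp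
    qed
    finally show ?thesis .
  qed
  have "(\<Sum>j\<in>S. h j * dpath x y (Suc n) t j) =
      (\<Sum>j\<in>S. c * E (path x y n t) (\<lambda>a. h j * (\<Sum>i\<in>S. ?w i * of_bool (feed k a i = j))))"
    unfolding dpath_Suc_eq E_cmult by (simp add: mult_ac)
  also have "\<dots> = c * E (path x y n t) (\<lambda>a. \<Sum>j\<in>S. h j * (\<Sum>i\<in>S. ?w i * of_bool (feed k a i = j)))"
    by (simp add: E_sum sum_distrib_left)
  also have "\<dots> = c * E (path x y n t) (\<lambda>a. 0)"
    by (rule arg_cong[of _ _ "(*) c"], rule E_cong, rule zero)
  finally show ?case by (simp add: E_def)
qed

lemma path_has_derivative:
  assumes xy: "x \<in> D" "y \<in> D"
  shows "i \<in> S \<Longrightarrow> ((\<lambda>t. path x y n t i) has_real_derivative dpath x y n t i) (at t)"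
proof (induction n arbitrary: i)
  case 0
  show ?case unfolding path_def by (auto intro!: derivative_eq_intros)
next
  case (Suc n)
  \<comment> \<open>For a constant \<open>h\<close> the hypothesis of \<open>sum_dpath_eq_0\<close>
    is trivial, and the lemma says that tangent vectors have sum zero.\<close>
  have "(\<Sum>j\<in>S. 1 * dpath x y n t j) = 0" by (rule sum_dpath_eq_0[OF xy, where h = "\<lambda>_. 1"]) simp
  then have "sum (dpath x y n t) S = 0" by simp
  from Psi_has_derivative[OF Suc.IH this, of i] show ?case by (simp add: path_def)
qed

text \<open>For each fixed count vector the tangent vector is pushed forward, which does not
  increase the l1 norm; vectors outside \<open>P\<close> push it to zero. Averaging leaves the
  probability of \<open>P\<close> as a factor.\<close>

lemma l1_dpath_Suc:
  assumes xy: "x \<in> D" "y \<in> D" and t: "0 \<le> t" "t \<le> 1"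
    and P: "\<And>a j. a \<in> A \<Longrightarrow> \<not> P a \<Longrightarrow> j \<in> S \<Longrightarrow>
      (\<Sum>i\<in>S. dpath x y n t i * of_bool (feed k a i = j)) = 0"
  shows "(\<Sum>j\<in>S. \<bar>dpath x y (Suc n) t j\<bar>) \<le>
    c * E (path x y n t) (\<lambda>a. of_bool (P a)) * (\<Sum>i\<in>S. \<bar>dpath x y n t i\<bar>)"
proof -
  let ?w = "dpath x y n t" and ?z = "path x y n t"
  let ?L = "\<Sum>i\<in>S. \<bar>?w i\<bar>"
  note z = path_D[OF xy t, of n]
  let ?s = "\<lambda>a j. \<Sum>i\<in>S. ?w i * of_bool (feed k a i = j)"
  have s: "(\<Sum>j\<in>S. \<bar>?s a j\<bar>) \<le> of_bool (P a) * ?L" if a: "a \<in> A" for a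
  proof (cases "P a")
    case True
    have "(\<Sum>j\<in>S. \<bar>?s a j\<bar>) \<le> (\<Sum>j\<in>S. \<Sum>i\<in>S. \<bar>?w i\<bar> * of_bool (feed k a i = j))"
      by (intro sum_mono order_trans[OF sum_abs]) (simp add: abs_mult)
    also have "\<dots> = (\<Sum>i\<in>S. \<bar>?w i\<bar> * (\<Sum>j\<in>S. of_bool (feed k a i = j) * 1))"
      unfolding sum_distrib_left by (subst sum.swap) simp
    also have "\<dots> = ?L"
      by (intro sum.cong refl) (simp add: sum_indicator[OF feed_S[OF a], of _ "\<lambda>_. 1", simplified])
    finally show ?thesis using True by simp
  next
    case False
    then show ?thesis using P[OF a] by simp
  qed
  have abs_E: "\<bar>E ?z f\<bar> \<le> E ?z (\<lambda>a. \<bar>f a\<bar>)" for f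
    unfolding E_def using weight_nonneg[OF z]
    by (intro order_trans[OF sum_abs] sum_mono) (simp add: abs_mult)
  have "(\<Sum>j\<in>S. \<bar>dpath x y (Suc n) t j\<bar>) = c * (\<Sum>j\<in>S. \<bar>E ?z (\<lambda>a. ?s a j)\<bar>)"
    unfolding dpath_Suc_eq using c by (simp add: abs_mult sum_distrib_left)
  also have "\<dots> \<le> c * (\<Sum>j\<in>S. E ?z (\<lambda>a. \<bar>?s a j\<bar>))"
    using c by (intro mult_left_mono sum_mono abs_E) simp
  also have "\<dots> = c * E ?z (\<lambda>a. \<Sum>j\<in>S. \<bar>?s a j\<bar>)" by (simp add: E_sum)
  also have "\<dots> \<le> c * E ?z (\<lambda>a. ?L * of_bool (P a))"
    using c s by (intro mult_left_mono E_mono[OF z]) (simp_all add: mult.commute)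
  finally show ?thesis unfolding E_cmult by (simp only: mult_ac)
qed

lemma l1_dpath_le:
  assumes xy: "x \<in> D" "y \<in> D" and t: "0 \<le> t" "t \<le> 1"
  shows "(\<Sum>j\<in>S. \<bar>dpath x y n t j\<bar>) \<le> c ^ n * (\<Sum>i\<in>S. \<bar>x i - y i\<bar>)"
proof (induction n)
  case (Suc n)
  have "(\<Sum>j\<in>S. \<bar>dpath x y (Suc n) t j\<bar>) \<le> c * (\<Sum>i\<in>S. \<bar>dpath x y n t i\<bar>)"
    using l1_dpath_Suc[OF xy t, of "\<lambda>_. True" n] by (simp add: E_1 del: dpath.simps)
  also have "\<dots> \<le> c * (c ^ n * (\<Sum>i\<in>S. \<bar>x i - y i\<bar>))" using Suc c by (intro mult_left_mono) simp_all
  finally show ?case by (simp add: mult_ac del: dpath.simps)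
qed simp

text \<open>If the count vector \<open>a\<close> contains a rich class, every composition of
  \<open>feed k a\<close> with \<open>n\<close> further maps is constant, as its length
  \<open>Suc n\<close> is at least \<open>2 ^ k\<close>. Testing with the indicator of
  \<open>feed k a \<sigma> = j\<close> shows that \<open>a\<close> pushes the tangent vector to
  zero.\<close>

lemma l1_dpath_avoids_G:
  assumes xy: "x \<in> D" "y \<in> D" and t: "0 \<le> t" "t \<le> 1" and n: "2 ^ k \<le> Suc n"
  shows "(\<Sum>j\<in>S. \<bar>dpath x y (Suc n) t j\<bar>) \<le>
    c * exp (- (c * mass (path x y n t))) * (\<Sum>i\<in>S. \<bar>dpath x y n t i\<bar>)"
  unfolding E_avoids_G[symmetric]
proof (rule l1_dpath_Suc[OF xy t])
  fix a j assume a: "a \<in> A" "\<not> avoids_G a"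
  then obtain g where g: "g \<in> G" "a g \<noteq> Exactly 0" unfolding avoids_G_def by blast
  have "(\<Sum>i\<in>S. of_bool (feed k a i = j) * dpath x y n t i) = 0"
  proof (rule sum_dpath_eq_0[OF xy])
    fix ns \<sigma> \<sigma>' assume ns: "length ns = n" "set ns \<subseteq> A" "\<sigma> \<in> S" "\<sigma>' \<in> S"
    have "chain k (a # ns) \<sigma> = chain k (a # ns) \<sigma>'"
      using ns a(1) n g fin unfolding G_def S by (intro chain_const[OF _ k]) auto
    then show "of_bool (feed k a (chain k ns \<sigma>) = j) =
        (of_bool (feed k a (chain k ns \<sigma>') = j) :: real)" by simp
  qed
  then show "(\<Sum>i\<in>S. dpath x y n t i * of_bool (feed k a i = j)) = 0" by (simp add: mult.commute)
qed

lemma Psi_pow_contraction: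
  "\<exists>s>0. \<exists>\<alpha><1. \<forall>x\<in>D. \<forall>y\<in>D. rho k ((Psi k c ^^ s) x) ((Psi k c ^^ s) y) \<le> \<alpha> * rho k x y"
proof -
  obtain N \<gamma> where \<gamma>: "0 \<le> \<gamma>" "\<gamma> < 1"
    and N: "\<forall>m\<ge>N. \<forall>x\<in>D. c * exp (- (c * mass ((Psi k c ^^ m) x))) \<le> \<gamma>"
    using ex_rate by blast
  \<comment> \<open>From step \<open>M\<close> on, both conditions hold: the compositions are long
    enough to be constant, and the rate \<gamma> is valid. The steps before are bounded by
    \<open>c\<close> each.\<close>
  define M where "M = 2 ^ k + N"
  have bound: "(\<Sum>j\<in>S. \<bar>dpath x y (M + m) t j\<bar>) \<le> c ^ M * \<gamma> ^ m * (\<Sum>i\<in>S. \<bar>x i - y i\<bar>)"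
    if xy: "x \<in> D" "y \<in> D" and t: "0 \<le> t" "t \<le> 1" for x y t m
  proof (induction m)
    case 0
    show ?case using l1_dpath_le[OF xy t, of M] by simp
  next
    case (Suc m)
    have "path x y (M + m) t = (Psi k c ^^ (M + m)) (path x y 0 t)" by (simp add: path_def)
    then have "c * exp (- (c * mass (path x y (M + m) t))) \<le> \<gamma>"
      using N path_D[OF xy t, of 0] by (simp add: M_def)
    then have "c * exp (- (c * mass (path x y (M + m) t))) * (\<Sum>i\<in>S. \<bar>dpath x y (M + m) t i\<bar>) \<le>
        \<gamma> * (c ^ M * \<gamma> ^ m * (\<Sum>i\<in>S. \<bar>x i - y i\<bar>))"
      using Suc.IH \<gamma> by (intro mult_mono) (simp_all add: sum_nonneg)
    moreover have "2 ^ k \<le> Suc (M + m)" by (simp add: M_def)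
    ultimately show ?case
      using l1_dpath_avoids_G[OF xy t, of "M + m"] by (simp add: mult_ac del: dpath.simps)
  qed
  \<comment> \<open>One factor \<open>card S\<close> comes from adding up the coordinates of the
    image, the other from bounding the l1 distance of \<open>x\<close> and \<open>y\<close> by the
    Euclidean one.\<close>
  define K where "K = real (card S) * real (card S) * c ^ M"
  have "(\<lambda>m. K * \<gamma> ^ m) \<longlonglongrightarrow> K * 0" using \<gamma> by (intro tendsto_intros LIMSEQ_realpow_zero)
  then have "\<forall>\<^sub>F m in sequentially. K * \<gamma> ^ m < 1"
    by (rule order_tendstoD(2)) simp
  then obtain m where m: "K * \<gamma> ^ m < 1" unfolding eventually_sequentially by blast
  define s where "s = M + m"
  have "rho k ((Psi k c ^^ s) x) ((Psi k c ^^ s) y) \<le> K * \<gamma> ^ m * rho k x y"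
    if xy: "x \<in> D" "y \<in> D" for x y
  proof -
    let ?L = "\<Sum>i\<in>S. \<bar>x i - y i\<bar>"
    have diff: "\<bar>(Psi k c ^^ s) x j - (Psi k c ^^ s) y j\<bar> \<le> c ^ M * \<gamma> ^ m * ?L" if j: "j \<in> S" for j
    proof -
      \<comment> \<open>The intermediate point depends on the coordinate \<open>j\<close>, which
        does no harm since \<open>bound\<close> holds for every \<open>t\<close> in the unit
        interval.\<close>
      obtain t where t: "0 < t" "t < 1" "path x y s 1 j - path x y s 0 j = (1 - 0) * dpath x y s t j"
        using MVT2[of 0 1 "\<lambda>t. path x y s t j" "\<lambda>t. dpath x y s t j"]
          path_has_derivative[OF xy j] by auto
      have "\<bar>dpath x y s t j\<bar> \<le> (\<Sum>j\<in>S. \<bar>dpath x y s t j\<bar>)"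
        using fin j by (intro member_le_sum) simp_all
      also have "\<dots> \<le> c ^ M * \<gamma> ^ m * ?L" unfolding s_def using bound[OF xy] t by simp
      finally show ?thesis using t(3) by (simp add: path_def)
    qed
    have L: "?L \<le> real (card S) * rho k x y"
    proof (rule sum_bounded_above)
      fix i assume "i \<in> S"
      then have "\<bar>x i - y i\<bar> \<le> L2_set (\<lambda>i. \<bar>x i - y i\<bar>) S" using fin by (intro member_le_L2_set)
      then show "\<bar>x i - y i\<bar> \<le> rho k x y" by (simp add: rho_def S L2_set_def)
    qed
    have "rho k ((Psi k c ^^ s) x) ((Psi k c ^^ s) y) \<le>
        (\<Sum>j\<in>S. \<bar>(Psi k c ^^ s) x j - (Psi k c ^^ s) y j\<bar>)"
      unfolding rho_def S[symmetric] by (rule L2_set_le_sum_abs)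
    also have "\<dots> \<le> real (card S) * (c ^ M * \<gamma> ^ m * ?L)"
      using diff by (rule sum_bounded_above)
    also have "\<dots> \<le> real (card S) * (c ^ M * \<gamma> ^ m * (real (card S) * rho k x y))"
      using L c \<gamma> by (intro mult_left_mono) simp_all
    finally show ?thesis by (simp add: K_def mult_ac)
  qed
  moreover have "0 < s" by (simp add: s_def M_def)
  ultimately show ?thesis using m by blast
qed

end

theorem theorem4p2:
  fixes k :: nat and c :: real
  assumes "k > 0" and "c > 0"
  shows "\<exists>s::nat. s > 0 \<and> (\<exists>\<alpha>::real. \<alpha> < 1 \<and>
           (\<forall>x \<in> (distrs k :: (('v::infinite) rtree set \<Rightarrow> real) set). \<forall>y \<in> distrs k.
              rho k ((Psi k c ^^ s) x) ((Psi k c ^^ s) y) \<le> \<alpha> * rho k x y))"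
proof (cases "finite (ehr_classes k :: 'v rtree set set)")
  case True
  then interpret finite_classes k c "ehr_classes k :: 'v rtree set set"
    using assms by unfold_locales simp_all
  show ?thesis using Psi_pow_contraction by blast
next
  case False
  \<comment> \<open>Sums over infinite sets are \<open>0\<close>, so no vector has total mass \<open>1\<close>.\<close>
  then have "(distrs k :: ('v rtree set \<Rightarrow> real) set) = {}"
    by (simp add: distrs_def)
  then show ?thesis by (intro exI[of _ 1] exI[of _ 0] conjI) simp_all
qed

end
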